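(* Let $\mu\in\mathcal M$ be either finite ($\mu\in\mathcal M_{\mathrm{finite}}$) or co-finite ($\mu\in\mathcal M_{\mathrm{cofinite}}$). Then the spectrum of the restriction $\Gamma_\mu^{\perp}=\Gamma_\mu|_{(\operatorname{Ker}\Gamma_\mu)^\perp}$ is simple.
   Context: $\mathbb R_+=(0,\infty)$; $L^2=L^2(\mathbb R_+)$ is the complex Hilbert space with respect to Lebesgue measure. Measures are positive Borel measures on $\mathbb R_+$ (in particular with no mass at $0$). $\mathcal M$ is the set of measures $\mu$ on $\mathbb R_+$ such that $h_\mu(t):=\int_0^\infty e^{-t\lambda}\,d\mu(\lambda)<\infty$ for all $t>0$. $\mathcal M_{\mathrm{finite}}\subset\mathcal M$ is the set of finite measures; $\mathcal M_{\mathrm{cofinite}}\subset\mathcal M$ is the set of $\mu\in\mathcal M$ with $\int_0^\infty x^{-2}\,d\mu(x)<\infty$. Hankel operator $\Gamma_\mu$, $\mu\in\mathcal M$: for $f\in L^2$ let $(\mathcal L f)(x)=\int_0^\infty e^{-tx}f(t)\,dt$, $x>0$, and define the quadratic form $Q_\mu[f]=\int_0^\infty|\mathcal L f(x)|^2\,d\mu(x)$ with domain $\operatorname{Dom}Q_\mu=\{f\in L^2: Q_\mu[f]<\infty\}$. It is known that $Q_\mu$ is closed and that $C^\infty_{\mathrm{comp}}(\mathbb R_+)$ (smooth functions with compact support in $(0,\infty)$) is contained in $\operatorname{Dom}Q_\mu$ and dense in it in the form norm. $\Gamma_\mu$ is the positive semi-definite self-adjoint operator in $L^2$ associated with the closed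 form $Q_\mu$. (Formally, $\Gamma_\mu$ is the integral operator with kernel $h_\mu(t+s)$; it may be unbounded.) A vector $w$ in a Hilbert space $\mathcal H$ is cyclic for a self-adjoint operator $A$ in $\mathcal H$ if $\{\varphi(A)w:\ \varphi \text{ bounded continuous}\}$ is dense in $\mathcal H$; the spectrum of $A$ is simple if a cyclic vector exists. *)

theory Defs
  imports "HOL-Analysis.Analysis"
begin

section \<open>Complex Hilbert spaces\<close>

text \<open>The inner product is linear in the first argument. The type class \<open>real_inner\<close> is the
  underlying real Hilbert space, so that norm and topology are those of the library.\<close>

class complex_hilbert = real_inner + complete_space +
  fixes scaleC :: "complex \<Rightarrow> 'a \<Rightarrow> 'a" (infixr "*\<^sub>C" 75)
    and cinner :: "'a \<Rightarrow> 'a \<Rightarrow> complex"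
  assumes scaleC_add_right: "c *\<^sub>C (x + y) = c *\<^sub>C x + c *\<^sub>C y"
    and scaleC_add_left: "(c + d) *\<^sub>C x = c *\<^sub>C x + d *\<^sub>C x"
    and scaleC_scaleC: "c *\<^sub>C (d *\<^sub>C x) = (c * d) *\<^sub>C x"
    and scaleR_scaleC: "r *\<^sub>R x = complex_of_real r *\<^sub>C x"
    and cinner_commute: "cinner x y = cnj (cinner y x)"
    and cinner_add_left: "cinner (x + y) z = cinner x z + cinner y z"
    and cinner_scaleC_left: "cinner (c *\<^sub>C x) y = c * cinner x y"
    and inner_eq_Re_cinner: "inner x y = Re (cinner x y)"


section \<open>Unbounded operators, functional calculus, cyclic vectors\<close>

text \<open>Unbounded operators are given by their graphs; \<open>(f, g) \<in> A\<close> means that \<open>f\<close> is in the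
  domain of \<open>A\<close> and \<open>A f = g\<close>.\<close>

definition op_ker :: "('a::complex_hilbert \<times> 'a) set \<Rightarrow> 'a set" where
  "op_ker A = {f. (f, 0) \<in> A}"

definition ortho_compl :: "'a::complex_hilbert set \<Rightarrow> 'a set" where
  "ortho_compl S = {f. \<forall>g\<in>S. cinner f g = 0}"

definition op_restrict :: "('a::complex_hilbert \<times> 'a) set \<Rightarrow> 'a set \<Rightarrow> ('a \<times> 'a) set" where
  "op_restrict A H = {(f, g) \<in> A. f \<in> H}"

definition bdd_cont :: "(real \<Rightarrow> complex) set" where
  "bdd_cont = {\<phi>. continuous_on UNIV \<phi> \<and> bounded (range \<phi>)}"

definition bounded_op_on :: "'a::complex_hilbert set \<Rightarrow> ('a \<Rightarrow> 'a) \<Rightarrow> bool" where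
  "bounded_op_on H T \<longleftrightarrow>
     (\<forall>u\<in>H. T u \<in> H) \<and>
     (\<forall>u\<in>H. \<forall>v\<in>H. T (u + v) = T u + T v) \<and>
     (\<forall>c. \<forall>u\<in>H. T (c *\<^sub>C u) = c *\<^sub>C T u) \<and>
     (\<exists>C. \<forall>u\<in>H. norm (T u) \<le> C * norm u)"

text \<open>\<open>\<Phi>\<close> is the bounded continuous functional calculus \<open>\<phi> \<mapsto> \<phi>(A)\<close> of an operator \<open>A\<close> in the
  Hilbert space \<open>H\<close> (a closed complex subspace of the ambient type): the unital \<open>*\<close>-homomorphism
  from the bounded continuous functions on the line to the bounded operators on \<open>H\<close> which sends
  \<open>x \<mapsto> 1 / (x - z)\<close> to the resolvent \<open>(A - z)\<^sup>-\<^sup>1\<close> for all non-real \<open>z\<close>. For self-adjoint \<open>A\<close>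
  it exists (by the spectral theorem, \<open>\<phi>(A) = \<integral> \<phi> dE\<close> with \<open>E\<close> the spectral measure) and it is
  unique: the resolvents determine it on functions vanishing at infinity by the Stone-Weierstrass
  theorem, hence \<open>\<phi>(A)\<close> on the dense range of \<open>(A - z)\<^sup>-\<^sup>1\<close> for every \<open>\<phi>\<close>. The values of
  \<open>\<Phi>\<close> on other functions, or outside \<open>H\<close>, are irrelevant.\<close>

definition functional_calculus ::
    "'a::complex_hilbert set \<Rightarrow> ('a \<times> 'a) set \<Rightarrow> ((real \<Rightarrow> complex) \<Rightarrow> 'a \<Rightarrow> 'a) \<Rightarrow> bool" where
  "functional_calculus H A \<Phi> \<longleftrightarrow>
     (\<forall>\<phi>\<in>bdd_cont. bounded_op_on H (\<Phi> \<phi>)) \<and>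
     (\<forall>u\<in>H. \<Phi> (\<lambda>x. 1) u = u) \<and>
     (\<forall>\<phi>\<in>bdd_cont. \<forall>\<psi>\<in>bdd_cont. \<forall>u\<in>H. \<Phi> (\<lambda>x. \<phi> x + \<psi> x) u = \<Phi> \<phi> u + \<Phi> \<psi> u) \<and>
     (\<forall>c. \<forall>\<phi>\<in>bdd_cont. \<forall>u\<in>H. \<Phi> (\<lambda>x. c * \<phi> x) u = c *\<^sub>C \<Phi> \<phi> u) \<and>
     (\<forall>\<phi>\<in>bdd_cont. \<forall>\<psi>\<in>bdd_cont. \<forall>u\<in>H. \<Phi> (\<lambda>x. \<phi> x * \<psi> x) u = \<Phi> \<phi> (\<Phi> \<psi> u)) \<and>
     (\<forall>\<phi>\<in>bdd_cont. \<forall>u\<in>H. \<forall>v\<in>H. cinner (\<Phi> (\<lambda>x. cnj (\<phi> x)) u) v = cinner u (\<Phi> \<phi> v)) \<and>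
     (\<forall>z. Im z \<noteq> 0 \<longrightarrow> (\<forall>u\<in>H. \<forall>v\<in>H.
        \<Phi> (\<lambda>x. 1 / (complex_of_real x - z)) u = v \<longleftrightarrow> (v, u + z *\<^sub>C v) \<in> A))"

definition cyclic_vector :: "'a::complex_hilbert set \<Rightarrow> ('a \<times> 'a) set \<Rightarrow> 'a \<Rightarrow> bool" where
  "cyclic_vector H A w \<longleftrightarrow>
     w \<in> H \<and> (\<exists>\<Phi>. functional_calculus H A \<Phi> \<and> H \<subseteq> closure {\<Phi> \<phi> w |\<phi>. \<phi> \<in> bdd_cont})"

definition simple_spectrum :: "'a::complex_hilbert set \<Rightarrow> ('a \<times> 'a) set \<Rightarrow> bool" where
  "simple_spectrum H A \<longleftrightarrow> (\<exists>w. cyclic_vector H A w)"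


section \<open>The Hilbert space of square integrable functions on the half-line\<close>

abbreviation Rplus :: "real measure" where
  "Rplus \<equiv> restrict_space lborel {0<..}"

definition square_int :: "(real \<Rightarrow> complex) \<Rightarrow> bool" where
  "square_int f \<longleftrightarrow> f \<in> borel_measurable Rplus \<and> integrable Rplus (\<lambda>t. (cmod (f t))\<^sup>2)"

lemma square_int_measurable [measurable_dest]: "square_int f \<Longrightarrow> f \<in> borel_measurable Rplus"
  by (simp add: square_int_def)

lemma borel_measurable_cnj_comp [measurable]:
  "f \<in> borel_measurable M \<Longrightarrow> (\<lambda>t. cnj (f t)) \<in> borel_measurable M"
  by (rule borel_measurable_continuous_on) (intro continuous_intros)

lemma square_int_mult:
  assumes "square_int f" "square_int g"
  shows "integrable Rplus (\<lambda>t. f t * cnj (g t))"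
proof (rule Bochner_Integration.integrable_bound)
  show "integrable Rplus (\<lambda>t. (cmod (f t))\<^sup>2 + (cmod (g t))\<^sup>2)"
    using assms by (simp add: square_int_def)
  show "(\<lambda>t. f t * cnj (g t)) \<in> borel_measurable Rplus"
    using assms[THEN square_int_measurable] by measurable
  have "a * b \<le> a\<^sup>2 + b\<^sup>2" if "a \<ge> 0" "b \<ge> 0" for a b :: real
    using that sum_squares_bound[of a b] mult_nonneg_nonneg[of a b] by linarith
  then show "AE t in Rplus. norm (f t * cnj (g t)) \<le> norm ((cmod (f t))\<^sup>2 + (cmod (g t))\<^sup>2)"
    by (intro AE_I2) (simp add: norm_mult)
qed

lemma square_int_add:
  assumes "square_int f" "square_int g"
  shows "square_int (\<lambda>t. f t + g t)"
  unfolding square_int_def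
proof
  show m: "(\<lambda>t. f t + g t) \<in> borel_measurable Rplus"
    using assms[THEN square_int_measurable] by measurable
  have b: "(cmod (a + b))\<^sup>2 \<le> 2 * (cmod a)\<^sup>2 + 2 * (cmod b)\<^sup>2" for a b :: complex
  proof -
    have "(cmod (a + b))\<^sup>2 \<le> (cmod a + cmod b)\<^sup>2"
      by (intro power_mono norm_triangle_ineq) auto
    also have "\<dots> \<le> 2 * (cmod a)\<^sup>2 + 2 * (cmod b)\<^sup>2"
      using sum_squares_bound[of "cmod a" "cmod b"] by (simp add: power2_sum)
    finally show ?thesis .
  qed
  show "integrable Rplus (\<lambda>t. (cmod (f t + g t))\<^sup>2)"
  proof (rule Bochner_Integration.integrable_bound)
    show "integrable Rplus (\<lambda>t. 2 * (cmod (f t))\<^sup>2 + 2 * (cmod (g t))\<^sup>2)"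
      using assms by (simp add: square_int_def)
    show "(\<lambda>t. (cmod (f t + g t))\<^sup>2) \<in> borel_measurable Rplus"
      using m by measurable
  qed (use b in \<open>auto intro!: AE_I2\<close>)
qed

lemma square_int_scale: "square_int f \<Longrightarrow> square_int (\<lambda>t. c * f t)"
  unfolding square_int_def by (auto simp: norm_mult power_mult_distrib)

lemma square_int_zero: "square_int (\<lambda>t. 0)"
  by (simp add: square_int_def)

lemma square_int_minus: "square_int f \<Longrightarrow> square_int (\<lambda>t. - f t)"
  using square_int_scale[of f "-1"] by simp

lemma square_int_diff: "square_int f \<Longrightarrow> square_int g \<Longrightarrow> square_int (\<lambda>t. f t - g t)"
  using square_int_add[of f "\<lambda>t. - g t"] square_int_minus by simp

definition L2_rel :: "(real \<Rightarrow> complex) \<Rightarrow> (real \<Rightarrow> complex) \<Rightarrow> bool" where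
  "L2_rel f g \<longleftrightarrow> square_int f \<and> square_int g \<and> (AE t in Rplus. f t = g t)"

lemma L2_relD: "L2_rel f g \<Longrightarrow> square_int f"
  by (simp add: L2_rel_def)

lemma L2_relI: "square_int f \<Longrightarrow> (\<And>t. f t = g t) \<Longrightarrow> L2_rel f g"
proof -
  assume "square_int f" and "\<And>t. f t = g t"
  then have "f = g" "square_int f" by auto
  then show ?thesis by (simp add: L2_rel_def)
qed

lemmas square_int_intros =
  square_int_add square_int_diff square_int_minus square_int_scale square_int_zero

quotient_type L2 = "real \<Rightarrow> complex" / partial: L2_rel
proof (rule part_equivpI)
  show "\<exists>f. L2_rel f f"
    by (rule exI[of _ "\<lambda>t. 0"]) (simp add: L2_rel_def square_int_zero)
  show "symp L2_rel"
    by (auto simp: symp_def L2_rel_def)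
  show "transp L2_rel"
    by (auto simp: transp_def L2_rel_def)
qed

lift_definition L2_inner :: "L2 \<Rightarrow> L2 \<Rightarrow> complex" is
  "\<lambda>f g. \<integral>t. f t * cnj (g t) \<partial>Rplus"
proof -
  fix f f' g g' assume *: "L2_rel f f'" "L2_rel g g'"
  then have "AE t in Rplus. f t = f' t" "AE t in Rplus. g t = g' t"
    by (auto simp: L2_rel_def)
  then have "AE t in Rplus. f t * cnj (g t) = f' t * cnj (g' t)"
    by eventually_elim simp
  then show "(\<integral>t. f t * cnj (g t) \<partial>Rplus) = (\<integral>t. f' t * cnj (g' t) \<partial>Rplus)"
    using * by (intro integral_cong_AE)
      (auto simp: L2_rel_def square_int_def intro!: borel_measurable_times)
qed

instantiation L2 :: real_inner
begin

lift_definition zero_L2 :: L2 is "\<lambda>t. 0"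
  by (simp add: L2_rel_def square_int_zero)

lift_definition plus_L2 :: "L2 \<Rightarrow> L2 \<Rightarrow> L2" is "\<lambda>f g t. f t + g t"
  by (auto simp: L2_rel_def square_int_add)

lift_definition minus_L2 :: "L2 \<Rightarrow> L2 \<Rightarrow> L2" is "\<lambda>f g t. f t - g t"
  by (auto simp: L2_rel_def square_int_diff)

lift_definition uminus_L2 :: "L2 \<Rightarrow> L2" is "\<lambda>f t. - f t"
  by (auto simp: L2_rel_def square_int_minus)

lift_definition scaleR_L2 :: "real \<Rightarrow> L2 \<Rightarrow> L2" is "\<lambda>r f t. complex_of_real r * f t"
  by (auto simp: L2_rel_def square_int_scale)

definition inner_L2 :: "L2 \<Rightarrow> L2 \<Rightarrow> real" where "inner_L2 f g = Re (L2_inner f g)"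
definition norm_L2 :: "L2 \<Rightarrow> real" where "norm_L2 f = sqrt (inner f f)"
definition dist_L2 :: "L2 \<Rightarrow> L2 \<Rightarrow> real" where "dist_L2 f g = norm (f - g)"
definition sgn_L2 :: "L2 \<Rightarrow> L2" where "sgn_L2 f = scaleR (inverse (norm f)) f"
definition uniformity_L2 :: "(L2 \<times> L2) filter" where
  "uniformity_L2 = (INF e\<in>{0<..}. principal {(x, y). dist x y < e})"
definition open_L2 :: "L2 set \<Rightarrow> bool" where
  "open_L2 U = (\<forall>x\<in>U. \<forall>\<^sub>F (x', y) in uniformity. x' = x \<longrightarrow> y \<in> U)"

instance
proof
  fix x y z :: L2 and r s :: real
  show "dist x y = norm (x - y)" "sgn x = scaleR (inverse (norm x)) x" "norm x = sqrt (inner x x)"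
    by (simp_all add: dist_L2_def sgn_L2_def norm_L2_def)
  show "uniformity = (INF e\<in>{0<..}. principal {(x, y :: L2). dist x y < e})"
    by (rule uniformity_L2_def)
  show "open U = (\<forall>x\<in>U. \<forall>\<^sub>F (x', y) in uniformity. x' = x \<longrightarrow> y \<in> U)" for U :: "L2 set"
    by (rule open_L2_def)
  show "x + y + z = x + (y + z)" "x + y = y + x" "0 + x = x" "- x + x = 0" "x - y = x + - y"
    "r *\<^sub>R (x + y) = r *\<^sub>R x + r *\<^sub>R y" "(r + s) *\<^sub>R x = r *\<^sub>R x + s *\<^sub>R x"
    "r *\<^sub>R (s *\<^sub>R x) = (r * s) *\<^sub>R x" "1 *\<^sub>R x = x"
    by (transfer, rule L2_relI, intro square_int_intros; simp add: L2_relD algebra_simps; fail)+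
  show "inner x y = inner y x"
    unfolding inner_L2_def
  proof transfer
    fix f g
    have "(\<integral>t. f t * cnj (g t) \<partial>Rplus) = (\<integral>t. cnj (g t * cnj (f t)) \<partial>Rplus)"
      by (simp add: mult.commute)
    also have "\<dots> = cnj (\<integral>t. g t * cnj (f t) \<partial>Rplus)"
      by (rule Bochner_Integration.integral_cnj)
    finally show "Re (\<integral>t. f t * cnj (g t) \<partial>Rplus) = Re (\<integral>t. g t * cnj (f t) \<partial>Rplus)"
      by simp
  qed
  show "inner (x + y) z = inner x z + inner y z"
    unfolding inner_L2_def
    by transfer (simp add: L2_rel_def distrib_right square_int_mult)
  show "inner (r *\<^sub>R x) y = r * inner x y"
    unfolding inner_L2_def
    by transfer (simp add: mult.assoc)
  have *: "L2_inner x x = complex_of_real (Re (L2_inner x x)) \<and> 0 \<le> Re (L2_inner x x)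
      \<and> (Re (L2_inner x x) = 0 \<longleftrightarrow> x = 0)"
  proof transfer
    fix f assume "L2_rel f f"
    then have f: "square_int f" by (simp add: L2_rel_def)
    have e: "(\<integral>t. f t * cnj (f t) \<partial>Rplus) = complex_of_real (\<integral>t. (cmod (f t))\<^sup>2 \<partial>Rplus)"
      by (simp flip: complex_norm_square of_real_power)
    have "(\<integral>t. (cmod (f t))\<^sup>2 \<partial>Rplus) = 0 \<longleftrightarrow> (AE t in Rplus. (cmod (f t))\<^sup>2 = 0)"
      using f by (intro integral_nonneg_eq_0_iff_AE) (auto simp: square_int_def)
    then show "(\<integral>t. f t * cnj (f t) \<partial>Rplus)
        = complex_of_real (Re (\<integral>t. f t * cnj (f t) \<partial>Rplus))
      \<and> 0 \<le> Re (\<integral>t. f t * cnj (f t) \<partial>Rplus)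
      \<and> (Re (\<integral>t. f t * cnj (f t) \<partial>Rplus) = 0 \<longleftrightarrow> L2_rel f (\<lambda>t. 0))"
      using f unfolding e by (simp add: L2_rel_def square_int_zero)
  qed
  then show "0 \<le> inner x x" "(inner x x = 0) = (x = 0)"
    by (simp_all add: inner_L2_def)
qed

end

lemma norm_L2_abs:
  assumes "square_int f"
  shows "(norm (abs_L2 f))\<^sup>2 = (\<integral>t. (cmod (f t))\<^sup>2 \<partial>Rplus)"
proof -
  have "L2_rel f f" using assms by (simp add: L2_rel_def)
  then have "L2_inner (abs_L2 f) (abs_L2 f) = (\<integral>t. f t * cnj (f t) \<partial>Rplus)"
    by (simp add: L2_inner.abs_eq)
  also have "\<dots> = complex_of_real (\<integral>t. (cmod (f t))\<^sup>2 \<partial>Rplus)"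
    by (simp flip: complex_norm_square of_real_power)
  finally show ?thesis
    by (simp add: power2_norm_eq_inner inner_L2_def)
qed

lemma nn_integral_L2:
  assumes "square_int f"
  shows "(\<integral>\<^sup>+t. ennreal ((cmod (f t))\<^sup>2) \<partial>Rplus) = ennreal ((norm (abs_L2 f))\<^sup>2)"
  using assms by (simp add: norm_L2_abs nn_integral_eq_integral square_int_def)

lemma abs_L2_diff:
  assumes "square_int f" "square_int g"
  shows "abs_L2 f - abs_L2 g = abs_L2 (\<lambda>t. f t - g t)"
  using assms by (simp add: minus_L2.abs_eq L2_rel_def)

lemma L2_abs_cases: "\<exists>f. square_int f \<and> x = abs_L2 f"
proof (induct x rule: L2.abs_induct)
  case (1 f)
  then show ?case using L2_relD[OF 1(1)] by blast
qed

instance L2 :: complete_space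
proof
  fix X :: "nat \<Rightarrow> L2" assume C: "Cauchy X"
  have "\<forall>n. \<exists>f. square_int f \<and> X n = abs_L2 f"
    using L2_abs_cases by blast
  then obtain F where F: "\<And>n. square_int (F n)" and XF: "\<And>n. X n = abs_L2 (F n)"
    by metis
  note [measurable] = F[THEN square_int_measurable]
  have nd: "(\<integral>\<^sup>+t. ennreal ((cmod (F m t - F n t))\<^sup>2) \<partial>Rplus) = ennreal ((dist (X m) (X n))\<^sup>2)"
    for m n
    using nn_integral_L2[OF square_int_diff[OF F F]]
    by (simp add: XF abs_L2_diff F dist_norm)
  have "\<forall>k. \<exists>N. \<forall>m\<ge>N. \<forall>n\<ge>N. dist (X m) (X n) < (1/4)^k"
    using C unfolding Cauchy_def by (meson zero_less_power zero_less_divide_1_iff zero_less_numeral)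
  then obtain N where N: "\<And>k m n. m \<ge> N k \<Longrightarrow> n \<ge> N k \<Longrightarrow> dist (X m) (X n) < (1/4)^k"
    by metis
  define r where "r k = k + (\<Sum>i\<le>k. N i)" for k
  have rN: "r k \<ge> N k" and rk: "r k \<ge> k" and rS: "r (Suc k) \<ge> r k" for k
    by (auto simp: r_def intro!: trans_le_add2 member_le_sum)
  define g where "g k t = ennreal (4^k * (cmod (F (r (Suc k)) t - F (r k) t))\<^sup>2)" for k t
  have [measurable]: "g k \<in> borel_measurable Rplus" for k
    unfolding g_def by measurable
  have gk: "(\<integral>\<^sup>+t. g k t \<partial>Rplus) \<le> ennreal ((1/4)^k)" for k
  proof -
    have "(\<integral>\<^sup>+t. g k t \<partial>Rplus) = ennreal (4^k) * ennreal ((dist (X (r (Suc k))) (X (r k)))\<^sup>2)"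
      unfolding g_def nd[symmetric] by (subst nn_integral_cmult[symmetric]) (auto simp: ennreal_mult)
    also have "\<dots> \<le> ennreal (4^k) * ennreal (((1/4)^k)\<^sup>2)"
      using N[of k "r (Suc k)" "r k"] rN[of k] rS[of k]
      by (intro mult_left_mono ennreal_leI power_mono) auto
    also have "\<dots> = ennreal ((1/4)^k)"
      by (simp add: ennreal_mult[symmetric] power2_eq_square power_one_over)
    finally show ?thesis .
  qed
  have "(\<integral>\<^sup>+t. (\<Sum>k. g k t) \<partial>Rplus) = (\<Sum>k. \<integral>\<^sup>+t. g k t \<partial>Rplus)"
    by (rule nn_integral_suminf) measurable
  also have "\<dots> \<le> (\<Sum>k. ennreal ((1/4)^k))"
    by (intro suminf_le gk) auto
  also have "\<dots> < \<infinity>"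
    by (subst suminf_ennreal2) (auto intro!: summable_geometric)
  finally have "AE t in Rplus. (\<Sum>k. g k t) \<noteq> \<infinity>"
    by (intro nn_integral_PInf_AE) auto
  then have conv: "AE t in Rplus. convergent (\<lambda>k. F (r k) t)"
  proof eventually_elim
    case (elim t)
    define S where "S = enn2real (\<Sum>k. g k t)"
    have S: "4^k * (cmod (F (r (Suc k)) t - F (r k) t))\<^sup>2 \<le> S" for k
    proof -
      have "g k t \<le> (\<Sum>k. g k t)"
        using sum_le_suminf[of "\<lambda>k. g k t" "{k}"] by simp
      then have "enn2real (g k t) \<le> S"
        unfolding S_def using elim by (intro enn2real_mono) (auto simp: top.not_eq_extremum)
      then show ?thesis by (simp add: g_def)
    qed
    have b: "norm (F (r (Suc k)) t - F (r k) t) \<le> sqrt S * (1/2)^k" for k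
    proof -
      have "(2^k * cmod (F (r (Suc k)) t - F (r k) t))\<^sup>2 \<le> S"
      proof -
        have "(4::real)^k = (2^k)\<^sup>2"
          by (simp add: power2_eq_square flip: power_mult_distrib)
        then show ?thesis
          using S[of k] unfolding power_mult_distrib by simp
      qed
      then have "2^k * cmod (F (r (Suc k)) t - F (r k) t) \<le> sqrt S"
        by (rule real_le_rsqrt)
      then show ?thesis by (simp add: field_simps power_one_over)
    qed
    have "summable (\<lambda>k. F (r (Suc k)) t - F (r k) t)"
      by (rule summable_comparison_test'[OF _ b]) (auto intro!: summable_mult summable_geometric)
    then have "convergent (\<lambda>n. F (r n) t - F (r 0) t)"
      by (simp add: summable_iff_convergent sum_lessThan_telescope[where f = "\<lambda>k. F (r k) t"])
    then show ?case
      by (simp add: convergent_diff_const_right_iff)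
  qed
  define G where "G t = lim (\<lambda>k. F (r k) t)" for t
  have [measurable]: "G \<in> borel_measurable Rplus"
    unfolding G_def by (rule borel_measurable_lim_metric) measurable
  have bound: "(\<integral>\<^sup>+t. ennreal ((cmod (F n t - G t))\<^sup>2) \<partial>Rplus) \<le> ennreal (((1/4)^k)\<^sup>2)"
    if n: "n \<ge> N k" for n k
  proof -
    have "AE t in Rplus. ennreal ((cmod (F n t - G t))\<^sup>2)
        = liminf (\<lambda>j. ennreal ((cmod (F n t - F (r j) t))\<^sup>2))"
      using conv
    proof eventually_elim
      case (elim t)
      then have "(\<lambda>j. F (r j) t) \<longlonglongrightarrow> G t"
        unfolding G_def by (simp add: convergent_LIMSEQ_iff)
      then have "(\<lambda>j. ennreal ((cmod (F n t - F (r j) t))\<^sup>2))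
          \<longlonglongrightarrow> ennreal ((cmod (F n t - G t))\<^sup>2)"
        by (intro tendsto_intros)
      then show ?case
        by (intro lim_imp_Liminf[symmetric]) simp_all
    qed
    then have "(\<integral>\<^sup>+t. ennreal ((cmod (F n t - G t))\<^sup>2) \<partial>Rplus)
        = (\<integral>\<^sup>+t. liminf (\<lambda>j. ennreal ((cmod (F n t - F (r j) t))\<^sup>2)) \<partial>Rplus)"
      by (rule nn_integral_cong_AE)
    also have "\<dots> \<le> liminf (\<lambda>j. \<integral>\<^sup>+t. ennreal ((cmod (F n t - F (r j) t))\<^sup>2) \<partial>Rplus)"
      by (rule nn_integral_liminf) measurable
    also have "\<dots> \<le> limsup (\<lambda>j. \<integral>\<^sup>+t. ennreal ((cmod (F n t - F (r j) t))\<^sup>2) \<partial>Rplus)"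
      by (rule Liminf_le_Limsup) simp
    also have "\<dots> \<le> ennreal (((1/4)^k)\<^sup>2)"
    proof (rule Limsup_bounded)
      show "\<forall>\<^sub>F j in sequentially. (\<integral>\<^sup>+t. ennreal ((cmod (F n t - F (r j) t))\<^sup>2) \<partial>Rplus)
          \<le> ennreal (((1/4)^k)\<^sup>2)"
        using eventually_ge_at_top[of "N k"]
      proof eventually_elim
        case (elim j)
        then show ?case
          unfolding nd using N[of k n "r j"] n rk[of j]
          by (intro ennreal_leI power_mono) auto
      qed
    qed
    finally show ?thesis .
  qed
  have d: "square_int (\<lambda>t. F n t - G t)" if "n \<ge> N k" for n k
    unfolding square_int_def
  proof
    show "integrable Rplus (\<lambda>t. (cmod (F n t - G t))\<^sup>2)"
      using bound[OF that] le_less_trans by (intro integrableI_nonneg) fastforce+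
  qed measurable
  have G: "square_int G"
    using square_int_diff[OF F d[OF order_refl, of 0], of "N 0"] by simp
  have "X \<longlonglongrightarrow> abs_L2 G"
  proof (rule metric_LIMSEQ_I)
    fix e :: real assume "e > 0"
    then obtain k where k: "(1/4)^k < e"
      using real_arch_pow_inv[of e "1/4"] by auto
    have "dist (X n) (abs_L2 G) < e" if "n \<ge> N k" for n
    proof -
      have "ennreal ((dist (X n) (abs_L2 G))\<^sup>2) \<le> ennreal (((1/4)^k)\<^sup>2)"
        using bound[OF that] nn_integral_L2[OF d[OF that]]
        by (simp add: XF dist_norm abs_L2_diff F G)
      then have "dist (X n) (abs_L2 G) \<le> (1/4)^k"
        by (subst (asm) ennreal_le_iff) (auto intro: power2_le_imp_le)
      then show ?thesis using k by simp
    qed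
    then show "\<exists>n0. \<forall>n\<ge>n0. dist (X n) (abs_L2 G) < e" by blast
  qed
  then show "convergent X" by (auto simp: convergent_def)
qed

instantiation L2 :: complex_hilbert
begin

lift_definition scaleC_L2 :: "complex \<Rightarrow> L2 \<Rightarrow> L2" is "\<lambda>c f t. c * f t"
  by (auto simp: L2_rel_def square_int_scale)

definition cinner_L2 :: "L2 \<Rightarrow> L2 \<Rightarrow> complex" where "cinner_L2 = L2_inner"

instance
proof
  fix x y z :: L2 and c d :: complex and r :: real
  show "c *\<^sub>C (x + y) = c *\<^sub>C x + c *\<^sub>C y" "(c + d) *\<^sub>C x = c *\<^sub>C x + d *\<^sub>C x"
    "c *\<^sub>C (d *\<^sub>C x) = (c * d) *\<^sub>C x" "r *\<^sub>R x = complex_of_real r *\<^sub>C x"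
    by (transfer, rule L2_relI, intro square_int_intros; simp add: L2_relD algebra_simps; fail)+
  show "cinner x y = cnj (cinner y x)"
    unfolding cinner_L2_def
    by transfer (simp add: mult.commute flip: Bochner_Integration.integral_cnj)
  show "cinner (x + y) z = cinner x z + cinner y z"
    unfolding cinner_L2_def
    by transfer (simp add: L2_rel_def distrib_right square_int_mult)
  show "cinner (c *\<^sub>C x) y = c * cinner x y"
    unfolding cinner_L2_def
    by transfer (simp add: mult.assoc)
  show "inner x y = Re (cinner x y)"
    by (simp add: cinner_L2_def inner_L2_def)
qed

end


section \<open>The Hankel operators\<close>

lift_definition laplace :: "L2 \<Rightarrow> real \<Rightarrow> complex" is
  "\<lambda>f x. \<integral>t. complex_of_real (exp (- (t * x))) * f t \<partial>Rplus"
proof (rule ext)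
  fix f g :: "real \<Rightarrow> complex" and x :: real
  assume *: "L2_rel f g"
  then have [measurable]: "f \<in> borel_measurable Rplus" "g \<in> borel_measurable Rplus"
    by (auto simp: L2_rel_def square_int_def)
  have [measurable]: "(\<lambda>t. complex_of_real (exp (- (t * x)))) \<in> borel_measurable Rplus"
    by (intro measurable_restrict_space1) measurable
  show "(\<integral>t. complex_of_real (exp (- (t * x))) * f t \<partial>Rplus)
      = (\<integral>t. complex_of_real (exp (- (t * x))) * g t \<partial>Rplus)"
    using * by (intro integral_cong_AE) (auto simp: L2_rel_def)
qed

text \<open>The class \<open>\<M>\<close>. Its elements are measures on the space \<open>(0, \<infinity>)\<close>.\<close>

definition hankel_kernel :: "real measure \<Rightarrow> real \<Rightarrow> ennreal" where
  "hankel_kernel \<mu> t = (\<integral>\<^sup>+x. ennreal (exp (- (t * x))) \<partial>\<mu>)"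

definition M_class :: "real measure set" where
  "M_class = {\<mu>. sets \<mu> = sets (restrict_space borel {0<..}) \<and> (\<forall>t>0. hankel_kernel \<mu> t < \<infinity>)}"

definition M_finite :: "real measure set" where
  "M_finite = {\<mu> \<in> M_class. finite_measure \<mu>}"

definition M_cofinite :: "real measure set" where
  "M_cofinite = {\<mu> \<in> M_class. (\<integral>\<^sup>+x. ennreal (1 / x\<^sup>2) \<partial>\<mu>) < \<infinity>}"

definition hankel_form_dom :: "real measure \<Rightarrow> L2 set" where
  "hankel_form_dom \<mu> = {f. (\<integral>\<^sup>+x. ennreal ((cmod (laplace f x))\<^sup>2) \<partial>\<mu>) < \<infinity>}"

text \<open>The sesquilinear form obtained from \<open>Q\<^sub>\<mu>\<close> by polarization.\<close>

definition hankel_form :: "real measure \<Rightarrow> L2 \<Rightarrow> L2 \<Rightarrow> complex" where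
  "hankel_form \<mu> f g = (\<integral>x. laplace f x * cnj (laplace g x) \<partial>\<mu>)"

text \<open>The graph of the self-adjoint operator associated with the closed form \<open>Q\<^sub>\<mu>\<close> (first
  representation theorem): \<open>f\<close> is in its domain with image \<open>g\<close> iff \<open>f \<in> Dom Q\<^sub>\<mu>\<close> and
  \<open>Q\<^sub>\<mu>[f, u] = \<langle>g, u\<rangle>\<close> for all \<open>u \<in> Dom Q\<^sub>\<mu>\<close>.\<close>

definition hankel_op :: "real measure \<Rightarrow> (L2 \<times> L2) set" where
  "hankel_op \<mu> = {(f, g). f \<in> hankel_form_dom \<mu> \<and>
     (\<forall>u\<in>hankel_form_dom \<mu>. hankel_form \<mu> f u = cinner g u)}"

definition hankel_perp_space :: "real measure \<Rightarrow> L2 set" where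
  "hankel_perp_space \<mu> = ortho_compl (op_ker (hankel_op \<mu>))"

definition hankel_perp :: "real measure \<Rightarrow> (L2 \<times> L2) set" where
  "hankel_perp \<mu> = op_restrict (hankel_op \<mu>) (hankel_perp_space \<mu>)"

end

theory Submission
  imports Defs
begin

text \<open>Write \<open>\<Gamma>\<close> for the Hankel operator, \<open>L\<close> for the Laplace transform and \<open>H\<^sub>0\<close> for the orthogonal
  complement of the kernel of \<open>\<Gamma>\<close>. Since \<open>\<Gamma> = L\<^sup>* L\<close>, the operator on \<open>H\<^sub>0\<close> is a copy of
  \<open>G = L L\<^sup>*\<close>, the integral operator on \<open>L\<^sup>2(\<mu>)\<close> with kernel \<open>1 / (x + y)\<close>. If \<open>X\<close> multiplies by
  \<open>p (x)\<close> and \<open>p (x) + p (y) = (x + y) m (x) m (y)\<close>, then formally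
  \<open>X G + G X = \<langle>\<cdot>, m\<rangle> m\<close>, a rank one operator. For a finite measure this applies with \<open>m = 1\<close>,
  \<open>p (x) = x\<close>, and for a co-finite one with \<open>m (x) = p (x) = 1 / x\<close>: in each case the assumption
  on \<open>\<mu>\<close> says exactly that \<open>m \<in> L\<^sup>2(\<mu>)\<close>.

  The claim is that \<open>m\<close> is cyclic for \<open>G\<close>. Let \<open>K\<close> be the orthogonal complement of the cyclic
  subspace of \<open>m\<close>. It reduces \<open>G\<close>, and the form of \<open>X G + G X\<close> vanishes on it. With two operators
  that are positive and anticommute, one of which has trivial kernel, the other one is \<open>0\<close>;
  but \<open>X\<close> is strictly positive, so \<open>K = 0\<close>. To make this precise for unbounded \<open>G\<close> and \<open>X\<close>,
  everything is written in terms of \<open>R = (\<Gamma> + 1)\<^sup>-\<^sup>1\<close> and its Cayley transform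
  \<open>V = 1 - 2 R = (\<Gamma> - 1) (\<Gamma> + 1)\<^sup>-\<^sup>1\<close>. The form \<open>\<theta> [g] = \<integral> p |L g|\<^sup>2 d\<mu>\<close> of \<open>X\<close> is finite on
  the range of \<open>R (1 - R)\<close>, \<open>N k = \<theta> [R (1 - R) k]\<close> is a bounded form, and anticommutation becomes
  \<open>N (V k) = N k\<close> for \<open>k\<close> in the copy of \<open>K\<close> in \<open>H\<^sub>0\<close> (lemma \<open>theta_V\<close>). On \<open>H\<^sub>0\<close> the
  self-adjoint contraction \<open>V\<close> has neither of the eigenvalues \<open>1\<close> and \<open>-1\<close>, so its powers tend to \<open>0\<close>
  strongly, \<open>N k = 0\<close>, and hence \<open>k = 0\<close> (lemma \<open>cyclic_complement_trivial\<close>). The vector of \<open>H\<^sub>0\<close> used in place of \<open>m\<close> is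
  \<open>w = R L\<^sup>* m\<close>, which exists although \<open>L\<^sup>* m\<close> need not.

  Two things remain. The resolvent \<open>R\<close> is obtained by minimisation over the form domain (lemmas
  \<open>exists_minimiser\<close> and \<open>exists_graph_projection\<close>). The bounded continuous functional calculus of
  \<open>\<Gamma>\<close> is constructed from \<open>R\<close> with operator-valued Bernstein polynomials (theorem
  \<open>functional_calculus_lift\<close>).\<close>

section \<open>Complex Hilbert spaces\<close>

lemma cinner_add_right: "cinner x (y + z) = cinner x y + cinner x z"
  by (metis cinner_commute cinner_add_left complex_cnj_add)

lemma cinner_scaleC_right: "cinner x (c *\<^sub>C y) = cnj c * cinner x y"
  by (metis cinner_commute cinner_scaleC_left complex_cnj_mult)

lemma cinner_scaleR_left: "cinner (r *\<^sub>R x) y = r * cinner x y"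
  by (simp add: scaleR_scaleC cinner_scaleC_left)

lemma cinner_scaleR_right: "cinner x (r *\<^sub>R y) = r * cinner x y"
  by (simp add: scaleR_scaleC cinner_scaleC_right)

lemma cinner_zero_left [simp]: "cinner 0 x = 0"
  using cinner_scaleR_left[of 0 0 x] by simp

lemma cinner_zero_right [simp]: "cinner x 0 = 0"
  using cinner_scaleR_right[of x 0 0] by simp

lemma cinner_minus_left: "cinner (- x) y = - cinner x y"
  using cinner_scaleR_left[of "-1" x y] by simp

lemma cinner_minus_right: "cinner x (- y) = - cinner x y"
  using cinner_scaleR_right[of x "-1" y] by simp

lemma cinner_diff_left: "cinner (x - y) z = cinner x z - cinner y z"
  using cinner_add_left[of x "- y" z] by (simp add: cinner_minus_left)

lemma cinner_diff_right: "cinner x (y - z) = cinner x y - cinner x z"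
  using cinner_add_right[of x y "- z"] by (simp add: cinner_minus_right)

lemmas cinner_simps = cinner_add_left cinner_add_right cinner_diff_left cinner_diff_right
  cinner_minus_left cinner_minus_right cinner_scaleC_left cinner_scaleC_right

lemma cinner_self: "cinner x x = complex_of_real ((norm x)\<^sup>2)"
proof -
  have "Im (cinner x x) = 0"
    using arg_cong[OF cinner_commute[of x x], of Im] by simp
  then show ?thesis
    by (simp add: complex_eq_iff power2_norm_eq_inner inner_eq_Re_cinner)
qed

lemma cinner_eqI:
  assumes "\<And>c. inner x (c *\<^sub>C y) = inner x' (c *\<^sub>C y')"
  shows "cinner x y = cinner x' y'"
  using assms[of 1] assms[of \<i>]
  by (simp add: complex_eq_iff inner_eq_Re_cinner cinner_scaleC_right)

lemma scaleC_1 [simp]: "1 *\<^sub>C x = x"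
  using scaleR_scaleC[of 1 x] by simp

lemma scaleC_0_left [simp]: "0 *\<^sub>C x = 0"
  using scaleR_scaleC[of 0 x] by simp

lemma scaleC_0_right [simp]: "c *\<^sub>C 0 = 0"
  using scaleC_add_right[of c 0 0] by simp

lemma scaleC_minus1: "(-1) *\<^sub>C x = - x"
  using scaleR_scaleC[of "-1" x] by simp

lemma norm_scaleC: "norm (c *\<^sub>C x) = cmod c * norm x"
proof -
  have "complex_of_real ((norm (c *\<^sub>C x))\<^sup>2) = (c * cnj c) * cinner x x"
    unfolding cinner_self[symmetric] by (simp add: cinner_scaleC_left cinner_scaleC_right)
  also have "\<dots> = complex_of_real ((cmod c * norm x)\<^sup>2)"
    by (simp add: cinner_self power_mult_distrib flip: complex_norm_square)
  finally have "(norm (c *\<^sub>C x))\<^sup>2 = (cmod c * norm x)\<^sup>2"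
    by (simp only: of_real_eq_iff)
  then show ?thesis by (simp add: power2_eq_iff_nonneg)
qed

lemma unimodular_rotation: "\<exists>c. cmod c = 1 \<and> c * z = complex_of_real (cmod z)"
proof (cases "z = 0")
  case True
  then show ?thesis by (intro exI[of _ 1]) simp
next
  case False
  then show ?thesis
    using complex_norm_square[of z]
    by (intro exI[of _ "cnj z / complex_of_real (cmod z)"])
      (simp add: norm_divide power2_eq_square field_simps)
qed

lemma norm_cinner_le: "cmod (cinner x y) \<le> norm x * norm y"
proof -
  obtain c where c: "cmod c = 1" "c * cinner x y = complex_of_real (cmod (cinner x y))"
    using unimodular_rotation by blast
  have "cmod (cinner x y) = inner (c *\<^sub>C x) y"
    by (simp add: inner_eq_Re_cinner cinner_scaleC_left c)
  also have "\<dots> \<le> norm (c *\<^sub>C x) * norm y"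
    by (rule norm_cauchy_schwarz)
  finally show ?thesis by (simp add: norm_scaleC c)
qed

lemma bounded_linear_scaleC: "bounded_linear (\<lambda>x. c *\<^sub>C x)"
  by (rule bounded_linear_intro[where K = "cmod c"])
    (simp_all add: scaleC_add_right scaleR_scaleC scaleC_scaleC norm_scaleC mult.commute)

lemma bounded_linear_cinner_left: "bounded_linear (\<lambda>x. cinner x y)"
  by (rule bounded_linear_intro[where K = "norm y"])
    (simp_all add: cinner_add_left cinner_scaleR_left norm_cinner_le scaleR_conv_of_real)

lemmas tendsto_scaleC = bounded_linear.tendsto[OF bounded_linear_scaleC]
  and tendsto_cinner_left = bounded_linear.tendsto[OF bounded_linear_cinner_left]

definition csubspace :: "'a::complex_hilbert set \<Rightarrow> bool" where
  "csubspace S \<longleftrightarrow> 0 \<in> S \<and> (\<forall>x\<in>S. \<forall>y\<in>S. x + y \<in> S) \<and> (\<forall>c. \<forall>x\<in>S. c *\<^sub>C x \<in> S)"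

lemma csubspaceD:
  assumes "csubspace S"
  shows "0 \<in> S" "x \<in> S \<Longrightarrow> y \<in> S \<Longrightarrow> x + y \<in> S" "x \<in> S \<Longrightarrow> c *\<^sub>C x \<in> S"
    "x \<in> S \<Longrightarrow> y \<in> S \<Longrightarrow> x - y \<in> S" "x \<in> S \<Longrightarrow> r *\<^sub>R x \<in> S"
proof -
  show *: "0 \<in> S" "x \<in> S \<Longrightarrow> y \<in> S \<Longrightarrow> x + y \<in> S" "x \<in> S \<Longrightarrow> c *\<^sub>C x \<in> S" for x y c
    using assms by (auto simp: csubspace_def)
  show "x \<in> S \<Longrightarrow> y \<in> S \<Longrightarrow> x - y \<in> S" "x \<in> S \<Longrightarrow> r *\<^sub>R x \<in> S"
    using *(2)[of x "(-1) *\<^sub>C y"] *(3)[of y "-1"] *(3)[of x "complex_of_real r"]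
    by (simp_all add: scaleC_minus1 scaleR_scaleC)
qed

lemma convex_csubspace: "csubspace S \<Longrightarrow> convex S"
  unfolding convex_def by (meson csubspaceD)

lemma csubspace_closure:
  assumes S: "csubspace S"
  shows "csubspace (closure S)"
  unfolding csubspace_def
proof (intro conjI ballI allI)
  show "0 \<in> closure S"
    using csubspaceD(1)[OF S] closure_subset by blast
next
  fix x y assume "x \<in> closure S" "y \<in> closure S"
  then obtain X Y where "\<And>n. X n \<in> S" "X \<longlonglongrightarrow> x" "\<And>n. Y n \<in> S" "Y \<longlonglongrightarrow> y"
    unfolding closure_sequential by blast
  then show "x + y \<in> closure S"
    unfolding closure_sequential
    by (intro exI[of _ "\<lambda>n. X n + Y n"]) (auto intro: tendsto_add csubspaceD(2)[OF S])
next
  fix c x assume "x \<in> closure S"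
  then obtain X where "\<And>n. X n \<in> S" "X \<longlonglongrightarrow> x"
    unfolding closure_sequential by blast
  then show "c *\<^sub>C x \<in> closure S"
    unfolding closure_sequential
    by (intro exI[of _ "\<lambda>n. c *\<^sub>C X n"]) (auto intro: tendsto_scaleC csubspaceD(3)[OF S])
qed

lemma csubspace_ortho_compl: "csubspace (ortho_compl S)"
  by (auto simp: csubspace_def ortho_compl_def cinner_simps)

lemma closed_ortho_compl: "closed (ortho_compl S)"
proof -
  have "ortho_compl S = (\<Inter>g\<in>S. (\<lambda>f. cinner f g) -` {0})"
    by (auto simp: ortho_compl_def)
  then show ?thesis
    by (auto intro!: closed_INT continuous_closed_vimage
        linear_continuous_at bounded_linear_cinner_left)
qed

section \<open>Minimisation and orthogonal projection\<close>

text \<open>The direct method: by the parallelogram identity the distance term alone makes a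
  minimising sequence Cauchy in the norm, and the rest of the functional only has to be lower
  semicontinuous. This covers the projection onto a closed subspace (\<open>p = 0\<close>) as well as the
  projection onto the graph of a closed operator.\<close>

lemma exists_minimiser:
  fixes C :: "'a::{real_inner, complete_space} set" and p :: "'a \<Rightarrow> real"
  assumes C: "convex C" "C \<noteq> {}"
    and nonneg: "\<And>u. u \<in> C \<Longrightarrow> 0 \<le> p u"
    and mid: "\<And>u v. u \<in> C \<Longrightarrow> v \<in> C \<Longrightarrow> p ((1/2) *\<^sub>R (u + v)) \<le> (p u + p v) / 2"
    and lsc: "\<And>X l c. (\<And>n. X n \<in> C) \<Longrightarrow> X \<longlonglongrightarrow> l \<Longrightarrow> (\<lambda>n. p (X n)) \<longlonglongrightarrow> c \<Longrightarrow> l \<in> C \<and> p l \<le> c"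
  shows "\<exists>u\<in>C. \<forall>v\<in>C. p u + (norm (u - f))\<^sup>2 \<le> p v + (norm (v - f))\<^sup>2"
proof -
  define F where "F u = p u + (norm (u - f))\<^sup>2" for u
  define I where "I = Inf (F ` C)"
  have F0: "0 \<le> F u" if "u \<in> C" for u
    using nonneg[OF that] by (simp add: F_def)
  have bb: "bdd_below (F ` C)"
    using F0 by (intro bdd_belowI2)
  have IF: "I \<le> F u" if "u \<in> C" for u
    unfolding I_def using bb that by (rule cINF_lower)
  have "\<exists>u\<in>C. F u < I + inverse (real (Suc n))" for n
    using cINF_less_iff[of C F "I + inverse (real (Suc n))"] C(2) bb
    by (simp add: I_def)
  then obtain X where X: "\<And>n. X n \<in> C" "\<And>n. F (X n) < I + inverse (real (Suc n))"
    by metis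
  have FX: "(\<lambda>n. F (X n)) \<longlonglongrightarrow> I"
  proof (rule tendsto_sandwich[of "\<lambda>_. I" _ _ "\<lambda>n. I + inverse (real (Suc n))"])
    show "(\<lambda>n. I + inverse (real (Suc n))) \<longlonglongrightarrow> I"
      using tendsto_add[OF tendsto_const LIMSEQ_inverse_real_of_nat, of I] by simp
  qed (use IF X(1) less_imp_le[OF X(2)] in \<open>auto intro!: always_eventually\<close>)
  have par: "(norm (a - b))\<^sup>2 \<le> 2 * (F a - I) + 2 * (F b - I)" if "a \<in> C" "b \<in> C" for a b
  proof -
    have m: "(1/2) *\<^sub>R (a + b) \<in> C"
      using convexD[OF C(1) that, of "1/2" "1/2"] by (simp add: scaleR_add_right)
    have "(norm ((1/2) *\<^sub>R (a + b) - f))\<^sup>2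
        = (norm (a - f))\<^sup>2 / 2 + (norm (b - f))\<^sup>2 / 2 - (norm (a - b))\<^sup>2 / 4"
      by (simp add: power2_norm_eq_inner inner_simps inner_commute field_simps)
    moreover have "I \<le> F ((1/2) *\<^sub>R (a + b))"
      by (rule IF[OF m])
    ultimately show ?thesis
      using mid[OF that] by (simp add: F_def field_simps)
  qed
  have "Cauchy X"
    unfolding Cauchy_iff
  proof (intro allI impI)
    fix e :: real assume e: "0 < e"
    have "\<forall>\<^sub>F n in sequentially. F (X n) < I + e\<^sup>2 / 4"
      using e by (intro order_tendstoD(2)[OF FX]) simp
    then obtain N where N: "\<And>n. n \<ge> N \<Longrightarrow> F (X n) < I + e\<^sup>2 / 4"
      by (auto simp: eventually_sequentially)
    have "norm (X m - X n) < e" if "m \<ge> N" "n \<ge> N" for m n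
    proof -
      have "(norm (X m - X n))\<^sup>2 < e\<^sup>2"
        using par[OF X(1) X(1), of m n] N[OF that(1)] N[OF that(2)] by (simp add: field_simps)
      then show ?thesis using e by (simp add: power_less_imp_less_base)
    qed
    then show "\<exists>M. \<forall>m\<ge>M. \<forall>n\<ge>M. norm (X m - X n) < e" by blast
  qed
  then obtain u where u: "X \<longlonglongrightarrow> u"
    by (auto simp: Cauchy_convergent_iff convergent_def)
  have "(\<lambda>n. F (X n) - (norm (X n - f))\<^sup>2) \<longlonglongrightarrow> I - (norm (u - f))\<^sup>2"
    by (intro tendsto_intros FX u)
  then have "u \<in> C \<and> p u \<le> I - (norm (u - f))\<^sup>2"
    using lsc[OF X(1) u] by (simp add: F_def)
  then show ?thesis
    using IF by (intro bexI[of _ u]) (force simp: F_def)+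
qed

text \<open>The first variation of a quadratic functional vanishes at a minimum.\<close>

lemma linear_term_eq_0:
  fixes a b :: real
  assumes "\<And>t. 0 \<le> 2 * t * a + t\<^sup>2 * b"
  shows "a = 0"
proof (rule ccontr)
  assume a: "a \<noteq> 0"
  define c where "c = \<bar>b\<bar> + 1"
  have c: "c > 0" "b < 2 * c" by (auto simp: c_def)
  have "0 \<le> 2 * (- a / c) * a + (- a / c)\<^sup>2 * b"
    by (rule assms)
  also have "\<dots> = (a\<^sup>2 / c\<^sup>2) * (b - 2 * c)"
    using c by (simp add: field_simps power2_eq_square)
  also have "\<dots> < 0"
    using a c by (intro mult_pos_neg) auto
  finally show False by simp
qed

lemma exists_orthogonal_vector:
  fixes S :: "'a::complex_hilbert set"
  assumes S: "csubspace S" and k: "k \<notin> closure S"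
  shows "\<exists>s\<in>closure S. k - s \<noteq> 0 \<and> (\<forall>g\<in>S. cinner (k - s) g = 0)"
proof -
  note T = csubspace_closure[OF S]
  have "\<exists>u\<in>closure S. \<forall>v\<in>closure S. 0 + (norm (u - k))\<^sup>2 \<le> 0 + (norm (v - k))\<^sup>2"
    using csubspaceD(1)[OF T] convex_csubspace[OF T]
    by (intro exists_minimiser) (auto intro: closed_sequentially[OF closed_closure] dest: LIMSEQ_unique)
  then obtain u where u: "u \<in> closure S" "\<And>v. v \<in> closure S \<Longrightarrow> (norm (u - k))\<^sup>2 \<le> (norm (v - k))\<^sup>2"
    by auto
  have "inner (u - k) g = 0" if g: "g \<in> closure S" for g
  proof (rule linear_term_eq_0)
    fix t :: real
    have "(norm (u - k))\<^sup>2 \<le> (norm (u + t *\<^sub>R g - k))\<^sup>2"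
      using T g u(1) by (intro u csubspaceD)
    then show "0 \<le> 2 * t * inner (u - k) g + t\<^sup>2 * (norm g)\<^sup>2"
      unfolding power2_norm_eq_inner
      by (simp add: inner_simps inner_commute algebra_simps power2_eq_square)
  qed
  then have "inner (k - u) g = 0" if "g \<in> closure S" for g
    using that by (metis inner_diff_left minus_diff_eq inner_minus_left neg_equal_0_iff_equal)
  then have "cinner (k - u) g = cinner (0::'a) 0" if "g \<in> S" for g
    using that closure_subset[of S] csubspaceD(3)[OF T]
    by (intro cinner_eqI) auto
  moreover have "k - u \<noteq> 0"
    using k u(1) by auto
  ultimately show ?thesis using u(1) by auto
qed

text \<open>The numbers \<open>\<parallel>V\<^sup>j k\<parallel>\<^sup>2 = \<langle>V\<^sup>2\<^sup>j k, k\<rangle>\<close> decrease, so they converge, and the squared distance of two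
  even powers of \<open>V\<close> applied to \<open>k\<close> is a second difference of them.\<close>

lemma symmetric_contraction_even_powers_tendsto:
  fixes V :: "'a::{real_inner, complete_space} \<Rightarrow> 'a"
  assumes V: "bounded_linear V"
    and sym: "\<And>x y. inner (V x) y = inner x (V y)"
    and contr: "\<And>x. norm (V x) \<le> norm x"
  shows "\<exists>p. (\<lambda>n. (V ^^ (2 * n)) k) \<longlonglongrightarrow> p \<and> V (V p) = p"
proof -
  define s where "s n = (norm ((V ^^ n) k))\<^sup>2" for n
  have symn: "inner ((V ^^ n) x) y = inner x ((V ^^ n) y)" for n x y
    by (induct n arbitrary: x y) (simp_all add: sym funpow_swap1)
  have dec: "s (Suc n) \<le> s n" for n
    by (simp add: s_def contr power_mono)
  have "convergent s"
    using dec by (intro Bseq_monoseq_convergent decseq_bounded[of s 0] decseq_imp_monoseq)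
      (auto simp: s_def intro: decseq_SucI)
  then obtain L where L: "s \<longlonglongrightarrow> L" by (auto simp: convergent_def)
  have dist2: "(norm ((V ^^ (2 * m)) k - (V ^^ (2 * n)) k))\<^sup>2 = s (2 * m) + s (2 * n) - 2 * s (m + n)" for m n
  proof -
    have "inner ((V ^^ (2 * m)) k) ((V ^^ (2 * n)) k) = inner k ((V ^^ (2 * (m + n))) k)"
      by (simp add: symn funpow_add)
    moreover have "s j = inner k ((V ^^ (2 * j)) k)" for j
      by (simp add: s_def power2_norm_eq_inner symn mult_2 funpow_add)
    ultimately show ?thesis
      by (simp add: s_def power2_norm_eq_inner inner_simps inner_commute)
  qed
  have "Cauchy (\<lambda>n. (V ^^ (2 * n)) k)"
    unfolding Cauchy_iff
  proof (intro allI impI)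
    fix e :: real assume e: "0 < e"
    have "\<forall>\<^sub>F n in sequentially. \<bar>s n - L\<bar> < e\<^sup>2 / 4"
      using L e by (simp only: tendsto_iff dist_real_def) (metis zero_less_divide_iff zero_less_numeral zero_less_power)
    then obtain N where N: "\<And>n. n \<ge> N \<Longrightarrow> \<bar>s n - L\<bar> < e\<^sup>2 / 4"
      by (auto simp: eventually_sequentially)
    have "norm ((V ^^ (2 * m)) k - (V ^^ (2 * n)) k) < e" if "m \<ge> N" "n \<ge> N" for m n
    proof -
      have "(norm ((V ^^ (2 * m)) k - (V ^^ (2 * n)) k))\<^sup>2 < e\<^sup>2"
        using that N[of "2 * m"] N[of "2 * n"] N[of "m + n"] unfolding dist2 by linarith
      then show ?thesis using e by (simp add: power_less_imp_less_base)
    qed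
    then show "\<exists>M. \<forall>m\<ge>M. \<forall>n\<ge>M. norm ((V ^^ (2 * m)) k - (V ^^ (2 * n)) k) < e" by blast
  qed
  then obtain p where p: "(\<lambda>n. (V ^^ (2 * n)) k) \<longlonglongrightarrow> p"
    by (auto simp: Cauchy_convergent_iff convergent_def)
  have "(\<lambda>n. V (V ((V ^^ (2 * n)) k))) \<longlonglongrightarrow> V (V p)"
    by (intro bounded_linear.tendsto[OF V] p)
  moreover have "(\<lambda>n. V (V ((V ^^ (2 * n)) k))) \<longlonglongrightarrow> p"
    using LIMSEQ_Suc[OF p] by simp
  ultimately show ?thesis
    using p LIMSEQ_unique by blast
qed

section \<open>The functional calculus of an injective positive contraction\<close>

text \<open>The Weierstrass approximation theorem as an induction rule, the form in which properties of
  the functional calculus pass from polynomials to continuous functions.\<close>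

lemma continuous_on_unit_interval_induct [consumes 1, case_names one mult_id add scale limit]:
  fixes \<phi> :: "real \<Rightarrow> complex"
  assumes cont: "continuous_on {0..1} \<phi>"
    and one: "P (\<lambda>r. 1)"
    and mult_id: "\<And>\<phi>. continuous_on {0..1} \<phi> \<Longrightarrow> P \<phi> \<Longrightarrow> P (\<lambda>r. complex_of_real r * \<phi> r)"
    and add: "\<And>\<phi> \<psi>. continuous_on {0..1} \<phi> \<Longrightarrow> continuous_on {0..1} \<psi> \<Longrightarrow> P \<phi> \<Longrightarrow> P \<psi> \<Longrightarrow>
        P (\<lambda>r. \<phi> r + \<psi> r)"
    and scale: "\<And>c \<phi>. continuous_on {0..1} \<phi> \<Longrightarrow> P \<phi> \<Longrightarrow> P (\<lambda>r. c * \<phi> r)"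
    and limit: "\<And>\<phi>. continuous_on {0..1} \<phi> \<Longrightarrow>
        (\<And>e. 0 < e \<Longrightarrow> \<exists>\<psi>. continuous_on {0..1} \<psi> \<and> P \<psi> \<and> (\<forall>r\<in>{0..1}. cmod (\<phi> r - \<psi> r) \<le> e)) \<Longrightarrow> P \<phi>"
  shows "P \<phi>"
proof -
  have mono: "P (\<lambda>r. complex_of_real r ^ n)" for n
    by (induct n) (simp_all add: one mult_id continuous_intros)
  have poly: "P (\<lambda>r. \<Sum>i\<le>n. c i * complex_of_real r ^ i)" for c :: "nat \<Rightarrow> complex" and n :: nat
  proof (induct n)
    case (Suc n)
    have "P (\<lambda>r. (\<Sum>i\<le>n. c i * complex_of_real r ^ i) + c (Suc n) * complex_of_real r ^ Suc n)"
      using Suc by (intro add scale mono continuous_intros)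
    then show ?case by simp
  qed (simp add: scale[OF _ mono[of 0], simplified])
  have real: "P (\<lambda>r. complex_of_real (f r))" if f: "continuous_on {0..1} f" for f :: "real \<Rightarrow> real"
  proof (rule limit)
    fix e :: real assume "0 < e"
    then obtain g where g: "real_polynomial_function g" "\<And>r. r \<in> {0..1} \<Longrightarrow> \<bar>f r - g r\<bar> < e"
      using Stone_Weierstrass_real_polynomial_function[OF compact_Icc f] by blast
    then obtain a n where "g = (\<lambda>r. \<Sum>i\<le>n. a i * r ^ i)"
      using real_polynomial_function_iff_sum by blast
    then have eq: "(\<lambda>r. complex_of_real (g r)) = (\<lambda>r. \<Sum>i\<le>n. complex_of_real (a i) * complex_of_real r ^ i)"
      by simp
    have "P (\<lambda>r. complex_of_real (g r))" "continuous_on {0..1} (\<lambda>r. complex_of_real (g r))"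
      unfolding eq by (rule poly, intro continuous_intros)
    then show "\<exists>\<psi>. continuous_on {0..1} \<psi> \<and> P \<psi> \<and> (\<forall>r\<in>{0..1}. cmod (complex_of_real (f r) - \<psi> r) \<le> e)"
      using g(2) by (intro exI[of _ "\<lambda>r. complex_of_real (g r)"])
        (auto simp flip: of_real_diff intro: less_imp_le)
  qed (intro continuous_intros f)
  have "P (\<lambda>r. complex_of_real (Re (\<phi> r)) + \<i> * complex_of_real (Im (\<phi> r)))"
    by (intro add scale real continuous_intros cont)
  then show ?thesis
    by (simp flip: complex_eq)
qed

text \<open>The resolvent at \<open>-1\<close> of a positive operator has its spectrum in \<open>[0, 1]\<close>, and \<open>0\<close> corresponds to
  the point \<open>\<infinity>\<close> in the spectrum of that operator. A bounded continuous function need not have a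
  limit there, whence no continuity at \<open>0\<close>.\<close>

definition unit_bounded :: "(real \<Rightarrow> complex) set" where
  "unit_bounded = {\<phi>. continuous_on {0<..1} \<phi> \<and> (\<exists>M. \<forall>r\<in>{0..1}. cmod (\<phi> r) \<le> M)}"

lemma unit_bounded_continuous: "continuous_on {0..1} \<phi> \<Longrightarrow> \<phi> \<in> unit_bounded"
proof -
  assume c: "continuous_on {0..1} \<phi>"
  then have "bounded (\<phi> ` {0..1})"
    by (intro compact_imp_bounded compact_continuous_image compact_Icc)
  then show ?thesis
    using continuous_on_subset[OF c greaterThanAtMost_subseteq_atLeastAtMost_iff[THEN iffD2]]
    by (auto simp: unit_bounded_def bounded_iff)
qed

lemma unit_bounded_add:
  assumes "\<phi> \<in> unit_bounded" "\<psi> \<in> unit_bounded"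
  shows "(\<lambda>r. \<phi> r + \<psi> r) \<in> unit_bounded"
proof -
  obtain M N where *: "continuous_on {0<..1} \<phi>" "continuous_on {0<..1} \<psi>"
    "\<And>r. r \<in> {0..1} \<Longrightarrow> cmod (\<phi> r) \<le> M" "\<And>r. r \<in> {0..1} \<Longrightarrow> cmod (\<psi> r) \<le> N"
    using assms unfolding unit_bounded_def by blast
  then have "cmod (\<phi> r + \<psi> r) \<le> M + N" if "r \<in> {0..1}" for r
    using that by (intro norm_add_rule_thm)
  then show ?thesis
    using continuous_on_add[OF *(1,2)] unfolding unit_bounded_def by blast
qed

lemma unit_bounded_mult:
  assumes "\<phi> \<in> unit_bounded" "\<psi> \<in> unit_bounded"
  shows "(\<lambda>r. \<phi> r * \<psi> r) \<in> unit_bounded"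
proof -
  obtain M N where *: "continuous_on {0<..1} \<phi>" "continuous_on {0<..1} \<psi>"
    "\<And>r. r \<in> {0..1} \<Longrightarrow> cmod (\<phi> r) \<le> M" "\<And>r. r \<in> {0..1} \<Longrightarrow> cmod (\<psi> r) \<le> N"
    using assms unfolding unit_bounded_def by blast
  then have "cmod (\<phi> r * \<psi> r) \<le> M * N" if "r \<in> {0..1}" for r
    using that by (intro norm_mult_ineq[THEN order_trans] mult_mono')  auto
  then show ?thesis
    using continuous_on_mult[OF *(1,2)] unfolding unit_bounded_def by blast
qed

lemma unit_bounded_cnj: "\<phi> \<in> unit_bounded \<Longrightarrow> (\<lambda>r. cnj (\<phi> r)) \<in> unit_bounded"
  unfolding unit_bounded_def by (auto intro!: continuous_intros)

lemma unit_bounded_scale: "\<phi> \<in> unit_bounded \<Longrightarrow> (\<lambda>r. c * \<phi> r) \<in> unit_bounded"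
  using unit_bounded_mult[OF unit_bounded_continuous[of "\<lambda>_. c"]] by simp

text \<open>The factor \<open>r\<close> kills the discontinuity at \<open>0\<close>. This reduces statements about \<open>unit_bounded\<close>
  functions to continuous ones.\<close>

lemma continuous_on_mult_id:
  assumes "\<phi> \<in> unit_bounded"
  shows "continuous_on {0..1} (\<lambda>r. complex_of_real r * \<phi> r)"
  unfolding continuous_on_eq_continuous_within
proof
  obtain M where M: "\<And>r. r \<in> {0..1} \<Longrightarrow> cmod (\<phi> r) \<le> M" and c: "continuous_on {0<..1} \<phi>"
    using assms unfolding unit_bounded_def by blast
  fix x :: real assume x: "x \<in> {0..1}"
  show "continuous (at x within {0..1}) (\<lambda>r. complex_of_real r * \<phi> r)"
  proof (cases "x = 0")
    case True
    have "((\<lambda>r. complex_of_real r * \<phi> r) \<longlongrightarrow> 0) (at 0 within {0..1})"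
    proof (rule Lim_null_comparison[where g = "\<lambda>r. \<bar>r\<bar> * M"])
      show "\<forall>\<^sub>F r in at 0 within {0..1}. norm (complex_of_real r * \<phi> r) \<le> \<bar>r\<bar> * M"
        using M by (auto simp: eventually_at_filter norm_mult intro!: always_eventually mult_left_mono)
      show "((\<lambda>r. \<bar>r\<bar> * M) \<longlongrightarrow> 0) (at 0 within {0..1})"
        by (auto intro!: tendsto_eq_intros)
    qed
    then show ?thesis by (simp add: True continuous_within)
  next
    case False
    then have "x \<in> {0<..1}" using x by auto
    have "continuous (at x within {0<..1}) \<phi>"
      using c \<open>x \<in> {0<..1}\<close> by (auto simp: continuous_on_eq_continuous_within)
    moreover have "at x within {0<..1} = at x within {0..1}"
      using \<open>x \<in> {0<..1}\<close> by (intro at_within_nhd[of _ "{0<..}"]) auto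
    ultimately show ?thesis
      by (auto intro!: continuous_intros)
  qed
qed

lemma bdd_cont_add:
  assumes "\<phi> \<in> bdd_cont" "\<psi> \<in> bdd_cont"
  shows "(\<lambda>x. \<phi> x + \<psi> x) \<in> bdd_cont"
proof -
  obtain M N where *: "continuous_on UNIV \<phi>" "continuous_on UNIV \<psi>"
    "\<And>x. cmod (\<phi> x) \<le> M" "\<And>x. cmod (\<psi> x) \<le> N"
    using assms unfolding bdd_cont_def bounded_iff by blast
  then have "cmod (\<phi> x + \<psi> x) \<le> M + N" for x
    by (intro norm_add_rule_thm)
  then show ?thesis
    using continuous_on_add[OF *(1,2)] unfolding bdd_cont_def bounded_iff by blast
qed

lemma bdd_cont_scale:
  assumes "\<phi> \<in> bdd_cont"
  shows "(\<lambda>x. c * \<phi> x) \<in> bdd_cont"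
proof -
  obtain M where *: "continuous_on UNIV \<phi>" "\<And>x. cmod (\<phi> x) \<le> M"
    using assms unfolding bdd_cont_def bounded_iff by blast
  then have "cmod (c * \<phi> x) \<le> cmod c * M" for x
    unfolding norm_mult by (intro mult_left_mono) auto
  then show ?thesis
    using continuous_on_mult[OF continuous_on_const *(1)] unfolding bdd_cont_def bounded_iff by blast
qed

text \<open>The last assumption means \<open>R\<^sup>2 \<le> R\<close>, that is, \<open>0 \<le> R \<le> 1\<close>.\<close>

locale positive_contraction =
  fixes R :: "'a::complex_hilbert \<Rightarrow> 'a"
  assumes R_add: "R (x + y) = R x + R y"
    and R_scaleC: "R (c *\<^sub>C x) = c *\<^sub>C R x"
    and R_sym: "cinner (R x) y = cinner x (R y)"
    and R_le: "(norm (R x))\<^sup>2 \<le> inner (R x) x"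
begin

lemma R_inner_sym: "inner (R x) y = inner x (R y)"
  by (simp add: inner_eq_Re_cinner R_sym)

lemma R_norm_le: "norm (R x) \<le> norm x"
proof -
  have "norm (R x) * norm (R x) \<le> norm (R x) * norm x"
    using R_le[of x] norm_cauchy_schwarz[of "R x" x] by (simp add: power2_eq_square)
  then show ?thesis
    by (metis mult_le_cancel_left_pos norm_ge_zero order_less_le)
qed

lemma bounded_linear_R: "bounded_linear R"
  by (rule bounded_linear_intro[where K = 1])
    (simp_all add: R_add R_scaleC scaleR_scaleC R_norm_le)

lemma R_diff: "R (x - y) = R x - R y"
  by (rule linear_diff[OF bounded_linear.linear[OF bounded_linear_R]])

definition S :: "'a \<Rightarrow> 'a" where "S x = x - R x"

definition b :: "nat \<Rightarrow> nat \<Rightarrow> 'a \<Rightarrow> 'a" where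
  "b i j u = (R ^^ i) ((S ^^ j) u)"

lemma S_add: "S (x + y) = S x + S y" and S_scaleC: "S (c *\<^sub>C x) = c *\<^sub>C S x"
  and S_sym: "cinner (S x) y = cinner x (S y)" and R_S: "R (S x) = S (R x)"
  by (simp_all add: S_def R_add R_scaleC R_diff cinner_simps R_sym
      linear_diff[OF bounded_linear.linear[OF bounded_linear_scaleC]])

lemma R_S_pow: "R ((S ^^ j) x) = (S ^^ j) (R x)"
  by (induct j arbitrary: x) (simp_all add: R_S)

lemma b_Suc: "b (Suc i) j u = b i j (R u)" "b i (Suc j) u = b i j (S u)" "b 0 0 u = u"
  by (simp_all add: b_def funpow_swap1 R_S_pow)

lemma b_add: "b i j (u + v) = b i j u + b i j v"
proof -
  have "(R ^^ i) (x + y) = (R ^^ i) x + (R ^^ i) y" "(S ^^ j) (x + y) = (S ^^ j) x + (S ^^ j) y" for x y i j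
    by (induct i, auto simp: R_add) (induct j, auto simp: S_add)
  then show ?thesis by (simp add: b_def)
qed

lemma b_scaleC: "b i j (c *\<^sub>C u) = c *\<^sub>C b i j u"
proof -
  have "(R ^^ i) (c *\<^sub>C x) = c *\<^sub>C (R ^^ i) x" "(S ^^ j) (c *\<^sub>C x) = c *\<^sub>C (S ^^ j) x" for x i j
    by (induct i, auto simp: R_scaleC) (induct j, auto simp: S_scaleC)
  then show ?thesis by (simp add: b_def)
qed

lemma R_b: "R (b i j u) = b i j (R u)"
  by (simp add: b_def R_S_pow[symmetric] funpow_swap1)

lemma S_b: "S (b i j u) = b i j (S u)"
proof -
  have "S ((R ^^ i) x) = (R ^^ i) (S x)" for x
    by (induct i) (simp_all flip: R_S)
  then show ?thesis by (simp add: b_def funpow_swap1)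
qed

lemma b_sym: "cinner (b i j u) v = cinner u (b i j v)"
proof -
  have "cinner ((R ^^ i) x) y = cinner x ((R ^^ i) y)" "cinner ((S ^^ j) x) y = cinner x ((S ^^ j) y)"
    for x y i j
    by (induct i arbitrary: x y, auto simp: R_sym funpow_swap1)
      (induct j arbitrary: x y, auto simp: S_sym funpow_swap1)
  moreover have "(R ^^ i) ((S ^^ j) v) = (S ^^ j) ((R ^^ i) v)"
    by (induct i arbitrary: v) (simp_all add: R_S_pow)
  ultimately show ?thesis by (simp add: b_def)
qed

text \<open>Pairs of factors \<open>R\<close> or \<open>1 - R\<close> can be moved to the two sides of the quadratic form, so
  only the exponents \<open>0\<close> and \<open>1\<close> matter.\<close>

lemma b_pos: "0 \<le> inner (b i j u) u"
proof (induct i arbitrary: u rule: nat_less_induct)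
  case (1 i)
  show ?case
  proof (cases "i \<ge> 2")
    case True
    define l where "l = i - 2"
    have i: "i = Suc (Suc l)" "l < i" using True by (auto simp: l_def)
    have "inner (b i j u) u = inner (b l j (R u)) (R u)"
      by (simp add: i b_Suc flip: R_b) (simp add: R_inner_sym)
    then show ?thesis using 1 i(2) by simp
  next
    case False
    have base: "0 \<le> inner (b i 0 u) u" "0 \<le> inner (b i 1 u) u" for u
    proof -
      have "0 \<le> inner (R u) u"
        using R_le[of u] by (meson order_trans zero_le_power2)
      moreover have "inner (R u) u \<le> inner u u"
        using norm_cauchy_schwarz[of "R u" u] mult_right_mono[OF R_norm_le[of u], of "norm u"]
        by (simp add: power2_norm_eq_inner[symmetric] power2_eq_square)
      moreover have "inner (R (R u)) u \<le> inner (R u) u"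
        using R_le[of u] by (simp add: power2_norm_eq_inner R_inner_sym)
      moreover have "i = 0 \<or> i = 1" using False by auto
      ultimately show "0 \<le> inner (b i 0 u) u" "0 \<le> inner (b i 1 u) u"
        by (auto simp: b_def S_def R_diff inner_diff_left)
    qed
    show ?thesis
    proof (induct j arbitrary: u rule: nat_less_induct)
      case (1 j)
      show ?case
      proof (cases "j \<ge> 2")
        case True
        define l where "l = j - 2"
        have j: "j = Suc (Suc l)" "l < j" using True by (auto simp: l_def)
        have "inner (b i j u) u = inner (b i l (S u)) (S u)"
          by (simp add: j b_Suc inner_eq_Re_cinner flip: S_b) (simp add: S_sym)
        then show ?thesis using 1 j(2) by simp
      next
        case False
        then have "j = 0 \<or> j = 1" by auto
        then show ?thesis using base by auto
      qed
    qed
  qed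
qed

text \<open>The Cauchy-Schwarz inequality of a positive operator, in the additive form that can be summed
  against \<open>bern_one\<close>.\<close>

lemma b_cauchy_schwarz: "cmod (cinner (b i j u) v) \<le> (inner (b i j u) u + inner (b i j v) v) / 2"
proof -
  obtain c where c: "cmod c = 1" "c * cinner (b i j u) v = complex_of_real (cmod (cinner (b i j u) v))"
    using unimodular_rotation by blast
  define u' where "u' = c *\<^sub>C u"
  have "inner (b i j u') v = Re (c * cinner (b i j u) v)"
    by (simp add: u'_def b_scaleC inner_eq_Re_cinner cinner_scaleC_left)
  moreover have "inner (b i j u') u' = Re ((c * cnj c) * cinner (b i j u) u)"
    by (simp add: u'_def b_scaleC inner_eq_Re_cinner cinner_scaleC_left cinner_scaleC_right mult.left_commute mult.assoc
        del: complex_mult_cnj times_complex.simps)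
  ultimately have u': "inner (b i j u') v = cmod (cinner (b i j u) v)" "inner (b i j u') u' = inner (b i j u) u"
    unfolding complex_norm_square[symmetric] c by (simp_all add: inner_eq_Re_cinner)
  have "u' = (u' - v) + v" by simp
  then have d: "b i j (u' - v) = b i j u' - b i j v"
    by (metis b_add add_diff_cancel_right')
  have "0 \<le> inner (b i j (u' - v)) (u' - v)"
    by (rule b_pos)
  also have "\<dots> = inner (b i j u') u' + inner (b i j v) v - 2 * inner (b i j u') v"
  proof -
    have "inner (b i j v) u' = inner (b i j u') v"
      by (metis b_sym inner_commute inner_eq_Re_cinner)
    then show ?thesis unfolding d by (simp add: inner_simps)
  qed
  finally show ?thesis by (simp add: u')
qed

definition bern :: "nat \<Rightarrow> (nat \<Rightarrow> complex) \<Rightarrow> 'a \<Rightarrow> 'a" where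
  "bern N c u = (\<Sum>k\<le>N. (c k * of_nat (N choose k)) *\<^sub>C b k (N - k) u)"

lemma bern_add: "bern N c (u + v) = bern N c u + bern N c v"
  by (simp add: bern_def b_add scaleC_add_right sum.distrib)

lemma bern_scaleC: "bern N c (d *\<^sub>C u) = d *\<^sub>C bern N c u"
  by (simp add: bern_def b_scaleC scaleC_scaleC linear_sum[OF bounded_linear.linear[OF bounded_linear_scaleC]] mult.commute)

lemma bern_coeff_add: "bern N (\<lambda>k. c k + d k) u = bern N c u + bern N d u"
  by (simp add: bern_def distrib_right scaleC_add_left sum.distrib)

lemma bern_coeff_scale: "bern N (\<lambda>k. a * c k) u = a *\<^sub>C bern N c u"
  by (simp add: bern_def scaleC_scaleC linear_sum[OF bounded_linear.linear[OF bounded_linear_scaleC]] mult.assoc)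

lemma bern_coeff_diff: "bern N (\<lambda>k. c k - d k) u = bern N c u - bern N d u"
  using bern_coeff_add[of N c "\<lambda>k. -1 * d k" u] unfolding bern_coeff_scale by (simp add: scaleC_minus1)

lemma bern_cnj: "cinner (bern N (\<lambda>k. cnj (c k)) u) v = cinner u (bern N c v)"
proof -
  have sum: "cinner u (sum f A) = (\<Sum>i\<in>A. cinner u (f i))" "cinner (sum f A) u = (\<Sum>i\<in>A. cinner (f i) u)"
    for u :: 'a and f and A :: "nat set"
    by (induct A rule: infinite_finite_induct; simp add: cinner_add_right cinner_add_left)+
  show ?thesis
    by (simp add: bern_def sum cinner_scaleC_left cinner_scaleC_right b_sym)
qed

text \<open>Pascal's rule, or de Casteljau's algorithm.\<close>

lemma bern_Suc: "bern (Suc N) c u = bern N (\<lambda>k. c (Suc k)) (R u) + bern N c (S u)"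
proof -
  have *: "bern N c (S u) = (\<Sum>k\<le>Suc N. (c k * of_nat (N choose k)) *\<^sub>C b k (Suc N - k) u)"
    by (simp add: bern_def b_Suc[symmetric] Suc_diff_le binomial_eq_0)
  show ?thesis
    unfolding * sum.atMost_Suc_shift
    by (simp add: bern_def sum.atMost_Suc_shift b_Suc distrib_left scaleC_add_left sum.distrib del: sum.atMost_Suc)
qed

lemma bern_one: "bern N (\<lambda>k. 1) u = u"
proof (induct N arbitrary: u)
  case 0
  show ?case by (simp add: bern_def b_Suc)
next
  case (Suc N)
  then show ?case by (simp add: bern_Suc S_def)
qed

lemma bern_R: "bern N c (R u) = bern (Suc N) (\<lambda>k. of_real (real k / real (Suc N)) * c (k - 1)) u"
proof -
  have "of_nat (N choose k) = complex_of_real (real (Suc k) / real (Suc N)) * of_nat (Suc N choose Suc k)" for k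
  proof -
    have "real (Suc N) * real (N choose k) = real (Suc k) * real (Suc N choose Suc k)"
      by (metis Suc_times_binomial_eq of_nat_mult mult.commute)
    then have "real (N choose k) = real (Suc k) / real (Suc N) * real (Suc N choose Suc k)"
      by (simp add: field_simps)
    then show ?thesis by (metis of_real_mult of_real_of_nat_eq)
  qed
  then show ?thesis
    unfolding bern_def sum.atMost_Suc_shift
    by (simp add: b_Suc mult.assoc mult.left_commute del: of_nat_Suc binomial_Suc_Suc)
qed

text \<open>The operators \<open>b k (N - k)\<close>, weighted with binomial coefficients, are positive and add up to
  the identity. So Bernstein sums are bounded by their largest coefficient, like a positive
  operator-valued measure.\<close>

lemma bern_norm_le:
  assumes "\<And>k. k \<le> N \<Longrightarrow> cmod (c k) \<le> M"
  shows "norm (bern N c u) \<le> M * norm u"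
proof -
  define w where "w = bern N c u"
  have one: "(\<Sum>k\<le>N. real (N choose k) * inner (b k (N - k) x) x) = (norm x)\<^sup>2" for x
  proof -
    have "inner (bern N (\<lambda>k. 1) x) x = (\<Sum>k\<le>N. real (N choose k) * inner (b k (N - k) x) x)"
      unfolding bern_def inner_sum_left by (simp add: inner_eq_Re_cinner cinner_scaleC_left)
    then show ?thesis by (simp add: bern_one power2_norm_eq_inner)
  qed
  have *: "inner w v \<le> M * (((norm u)\<^sup>2 + (norm v)\<^sup>2) / 2)" for v
  proof -
    have "inner w v = (\<Sum>k\<le>N. Re (c k * of_nat (N choose k) * cinner (b k (N - k) u) v))"
      unfolding w_def bern_def inner_sum_left by (simp add: inner_eq_Re_cinner cinner_scaleC_left)
    also have "\<dots> \<le> (\<Sum>k\<le>N. M * (real (N choose k) * ((inner (b k (N - k) u) u + inner (b k (N - k) v) v) / 2)))"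
    proof (rule sum_mono)
      fix k assume "k \<in> {..N}"
      then have k: "cmod (c k) \<le> M" using assms by simp
      then have "M \<ge> 0" using norm_ge_zero order_trans by blast
      have "Re (c k * of_nat (N choose k) * cinner (b k (N - k) u) v)
          \<le> cmod (c k) * (real (N choose k) * cmod (cinner (b k (N - k) u) v))"
        by (rule order_trans[OF complex_Re_le_cmod]) (simp add: norm_mult)
      also have "\<dots> \<le> M * (real (N choose k) * ((inner (b k (N - k) u) u + inner (b k (N - k) v) v) / 2))"
        using k \<open>M \<ge> 0\<close> b_cauchy_schwarz by (intro mult_mono mult_left_mono) auto
      finally show "Re (c k * of_nat (N choose k) * cinner (b k (N - k) u) v)
          \<le> M * (real (N choose k) * ((inner (b k (N - k) u) u + inner (b k (N - k) v) v) / 2))" .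
    qed
    also have "\<dots> = M * (((\<Sum>k\<le>N. real (N choose k) * inner (b k (N - k) u) u)
        + (\<Sum>k\<le>N. real (N choose k) * inner (b k (N - k) v) v)) / 2)"
      by (simp add: sum_distrib_left sum.distrib[symmetric] sum_divide_distrib algebra_simps add_divide_distrib)
    finally show ?thesis unfolding one .
  qed
  have "M \<ge> 0" using assms[of 0] norm_ge_zero[of "c 0"] by linarith
  show ?thesis
  proof (cases "w = 0")
    case True
    then show ?thesis using \<open>M \<ge> 0\<close> by (simp add: w_def)
  next
    case False
    define t where "t = norm u / norm w"
    have "t * (norm w)\<^sup>2 \<le> M * (norm u)\<^sup>2"
      using *[of "t *\<^sub>R w"] False by (simp add: t_def power2_norm_eq_inner[symmetric])
    then have "norm u * norm w \<le> norm u * (M * norm u)"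
      using False by (simp add: t_def power2_eq_square field_simps)
    moreover have "norm u \<noteq> 0"
    proof
      assume "norm u = 0"
      then have "w = 0"
        using bern_scaleC[of N c 0 u] by (simp add: w_def)
      then show False using False by simp
    qed
    ultimately show ?thesis
      unfolding w_def by (metis mult_le_cancel_left_pos norm_ge_zero order_less_le)
  qed
qed

definition approx :: "nat \<Rightarrow> (real \<Rightarrow> complex) \<Rightarrow> 'a \<Rightarrow> 'a" where
  "approx N \<phi> u = bern N (\<lambda>k. \<phi> (real k / real N)) u"

definition calc :: "(real \<Rightarrow> complex) \<Rightarrow> 'a \<Rightarrow> 'a" where
  "calc \<phi> u = lim (\<lambda>N. approx N \<phi> u)"

lemma node_in_unit: "k \<le> N \<Longrightarrow> real k / real N \<in> {0..1}"
  by (cases "N = 0") (auto simp: field_simps)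

lemma approx_norm_le:
  assumes "\<And>r. r \<in> {0..1} \<Longrightarrow> cmod (\<phi> r) \<le> M"
  shows "norm (approx N \<phi> u) \<le> M * norm u"
  unfolding approx_def using assms node_in_unit by (intro bern_norm_le) blast

lemma approx_diff_right: "approx N \<phi> (u - v) = approx N \<phi> u - approx N \<phi> v"
  using bern_add[of N _ "u - v" v] by (simp add: approx_def)

lemma approx_diff: "approx N (\<lambda>r. \<phi> r - \<psi> r) u = approx N \<phi> u - approx N \<psi> u"
  by (simp add: approx_def bern_coeff_diff)

text \<open>Multiplying a Bernstein polynomial by \<open>r\<close> gives a Bernstein polynomial of the next
  degree, whose nodes are displaced by at most \<open>1 / N\<close>. The factor \<open>r\<close> damps the coefficients
  near \<open>0\<close>, where \<open>\<phi>\<close> need not be continuous.\<close>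

lemma approx_mult_id:
  assumes \<phi>: "\<phi> \<in> unit_bounded"
  shows "(\<lambda>N. approx (Suc N) (\<lambda>r. complex_of_real r * \<phi> r) v - approx N \<phi> (R v)) \<longlonglongrightarrow> 0"
proof -
  obtain M0 where c: "continuous_on {0<..1} \<phi>" and M0: "\<And>r. r \<in> {0..1} \<Longrightarrow> cmod (\<phi> r) \<le> M0"
    using \<phi> unfolding unit_bounded_def by blast
  define M where "M = max M0 1"
  have M: "M > 0" "\<And>r. r \<in> {0..1} \<Longrightarrow> cmod (\<phi> r) \<le> M"
    using M0 by (auto simp: M_def intro: max.coboundedI1)
  define d where "d N k = complex_of_real (real k / real (Suc N))
      * (\<phi> (real k / real (Suc N)) - \<phi> (real (k - 1) / real N))" for N k
  have d: "approx (Suc N) (\<lambda>r. complex_of_real r * \<phi> r) v - approx N \<phi> (R v) = bern (Suc N) (d N) v" for N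
    unfolding approx_def bern_R bern_coeff_diff[symmetric] d_def by (simp add: right_diff_distrib)
  have small: "\<exists>N0. \<forall>N\<ge>N0. \<forall>k\<le>Suc N. cmod (d N k) \<le> e" if e: "e > 0" for e
  proof -
    \<comment> \<open>Below \<open>s\<close> the factor \<open>r\<close> makes the coefficient small; above \<open>s\<close> both nodes stay in \<open>[s/2, 1]\<close>.\<close>
    define s where "s = e / (2 * M)"
    have s: "s > 0" using e M by (simp add: s_def)
    have "uniformly_continuous_on {s/2..1} \<phi>"
      using s by (intro compact_uniformly_continuous continuous_on_subset[OF c]) auto
    then obtain \<delta> where \<delta>: "\<delta> > 0"
      "\<And>x y. x \<in> {s/2..1} \<Longrightarrow> y \<in> {s/2..1} \<Longrightarrow> dist x y < \<delta> \<Longrightarrow> dist (\<phi> x) (\<phi> y) < e"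
      using e unfolding uniformly_continuous_on_def by metis
    obtain N0 where N0: "N0 > 0" "inverse (real N0) < min \<delta> (s / 2)"
    proof -
      have "0 < min \<delta> (s / 2)" using \<delta>(1) s by simp
      then obtain n where "inverse (real (Suc n)) < min \<delta> (s / 2)"
        using reals_Archimedean by blast
      then show ?thesis using that[of "Suc n"] by simp
    qed
    have "cmod (d N k) \<le> e" if "N \<ge> N0" and k: "k \<le> Suc N" for N k
    proof (cases "k = 0")
      case True
      then show ?thesis using e by (simp add: d_def)
    next
      case False
      define x y where "x = real k / real (Suc N)" and "y = real (k - 1) / real N"
      have N: "real N > 0" "inverse (real N) < \<delta>" "inverse (real N) < s / 2"
      proof -
        show "real N > 0" using that N0 by simp
        have "inverse (real N) \<le> inverse (real N0)"
          using that N0 by (intro le_imp_inverse_le) auto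
        then show "inverse (real N) < \<delta>" "inverse (real N) < s / 2"
          using N0(2) by auto
      qed
      have xy: "x \<in> {0..1}" "y \<in> {0..1}"
        unfolding x_def y_def using k by (intro node_in_unit; simp)+
      have diff: "x - y = (real (Suc N) - real k) / (real N * real (Suc N))"
        using False N(1) by (simp add: x_def y_def of_nat_diff field_simps)
      have "0 \<le> x - y"
        unfolding diff using k by (intro divide_nonneg_nonneg) auto
      then have "y \<le> x" by simp
      have "x - y \<le> real (Suc N) / (real N * real (Suc N))"
        unfolding diff using N(1) by (intro divide_right_mono) auto
      then have "x - y \<le> inverse (real N)"
        using N(1) by (simp only: inverse_eq_divide) (simp add: divide_simps)
      have cd: "cmod (d N k) = x * cmod (\<phi> x - \<phi> y)"
        unfolding d_def x_def[symmetric] y_def[symmetric] using xy by (simp add: norm_mult)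
      show ?thesis
      proof (cases "x < s")
        case True
        have "cmod (\<phi> x - \<phi> y) \<le> 2 * M"
          using norm_triangle_ineq4[of "\<phi> x" "\<phi> y"] M(2)[OF xy(1)] M(2)[OF xy(2)] by simp
        then have "cmod (d N k) \<le> s * (2 * M)"
          unfolding cd using True xy by (intro mult_mono) auto
        then show ?thesis using M by (simp add: s_def)
      next
        case False
        then have "dist (\<phi> x) (\<phi> y) < e"
          using xy s N \<open>y \<le> x\<close> \<open>x - y \<le> inverse (real N)\<close> by (intro \<delta>(2)) (auto simp: dist_real_def)
        then have "x * cmod (\<phi> x - \<phi> y) \<le> 1 * e"
          using xy by (intro mult_mono) (auto simp: dist_norm)
        then show ?thesis by (simp add: cd)
      qed
    qed
    then show ?thesis by blast
  qed
  show ?thesis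
    unfolding d
  proof (rule LIMSEQ_I)
    fix e :: real assume e: "0 < e"
    then have "0 < e / (norm v + 1)" by (simp add: add_nonneg_pos)
    from small[OF this] obtain N0 where N0: "\<And>N k. N \<ge> N0 \<Longrightarrow> k \<le> Suc N \<Longrightarrow> cmod (d N k) \<le> e / (norm v + 1)"
      by blast
    have "norm (bern (Suc N) (d N) v) < e" if "N \<ge> N0" for N
    proof -
      have "norm (bern (Suc N) (d N) v) \<le> e / (norm v + 1) * norm v"
        using N0[OF that] by (rule bern_norm_le)
      also have "\<dots> < e"
        using e by (simp add: divide_less_eq add_nonneg_pos)
      finally show ?thesis .
    qed
    then show "\<exists>N0. \<forall>N\<ge>N0. norm (bern (Suc N) (d N) v - 0) < e" by auto
  qed
qed

lemma approx_mult_id_tendsto_iff: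
  assumes "\<phi> \<in> unit_bounded"
  shows "(\<lambda>N. approx N (\<lambda>r. complex_of_real r * \<phi> r) v) \<longlonglongrightarrow> l \<longleftrightarrow> (\<lambda>N. approx N \<phi> (R v)) \<longlonglongrightarrow> l"
    (is "?A \<longlonglongrightarrow> l \<longleftrightarrow> ?B \<longlonglongrightarrow> l")
proof -
  have "?A \<longlonglongrightarrow> l \<longleftrightarrow> (\<lambda>N. ?A (Suc N)) \<longlonglongrightarrow> l"
    by (rule filterlim_sequentially_Suc[symmetric])
  also have "\<dots> \<longleftrightarrow> ?B \<longlonglongrightarrow> l"
    by (rule Lim_transform_eq[OF approx_mult_id[OF assms]])
  finally show ?thesis .
qed

text \<open>Both the function and the vector may be replaced by nearby ones, uniformly in the degree.\<close>

lemma approx_convergentI: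
  assumes "\<And>e. 0 < e \<Longrightarrow> \<exists>\<psi> v. convergent (\<lambda>N. approx N \<psi> v) \<and>
      (\<forall>N. norm (approx N \<phi> u - approx N \<psi> v) \<le> e)"
  shows "convergent (\<lambda>N. approx N \<phi> u)"
  unfolding Cauchy_convergent_iff[symmetric]
proof (rule metric_CauchyI)
  fix e :: real assume "0 < e"
  then obtain \<psi> v where *: "Cauchy (\<lambda>N. approx N \<psi> v)" "\<And>N. norm (approx N \<phi> u - approx N \<psi> v) \<le> e / 4"
    using assms[of "e / 4"] by (auto simp: Cauchy_convergent_iff)
  then obtain N0 where N0: "\<And>m n. m \<ge> N0 \<Longrightarrow> n \<ge> N0 \<Longrightarrow> dist (approx m \<psi> v) (approx n \<psi> v) < e / 2"
    using metric_CauchyD[OF *(1), of "e / 2"] \<open>0 < e\<close> by auto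
  have "dist (approx m \<phi> u) (approx n \<phi> u) < e" if "m \<ge> N0" "n \<ge> N0" for m n
    using N0[OF that] *(2)[of m] *(2)[of n] \<open>0 < e\<close>
      dist_triangle[of "approx m \<phi> u" "approx n \<phi> u" "approx m \<psi> v"]
      dist_triangle[of "approx m \<psi> v" "approx n \<phi> u" "approx n \<psi> v"]
    by (simp add: dist_norm norm_minus_commute)
  then show "\<exists>M. \<forall>m\<ge>M. \<forall>n\<ge>M. dist (approx m \<phi> u) (approx n \<phi> u) < e" by blast
qed

lemma approx_convergent_continuous:
  assumes "continuous_on {0..1} \<phi>"
  shows "convergent (\<lambda>N. approx N \<phi> u)"
  using assms
proof (induct \<phi> arbitrary: u rule: continuous_on_unit_interval_induct)
  case one
  show ?case by (simp add: approx_def bern_one convergent_const)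
next
  case (mult_id \<phi>)
  then show ?case
    using approx_mult_id_tendsto_iff[OF unit_bounded_continuous] unfolding convergent_def by blast
next
  case (add \<phi> \<psi>)
  then show ?case by (simp add: approx_def bern_coeff_add convergent_add)
next
  case (scale c \<phi>)
  obtain l where "(\<lambda>N. approx N \<phi> u) \<longlonglongrightarrow> l"
    using scale(2)[of u] unfolding convergent_def by blast
  then have "(\<lambda>N. approx N (\<lambda>r. c * \<phi> r) u) \<longlonglongrightarrow> c *\<^sub>C l"
    unfolding approx_def bern_coeff_scale by (rule tendsto_scaleC)
  then show ?case by (rule convergentI)
next
  case (limit \<phi>)
  show ?case
  proof (rule approx_convergentI)
    fix e :: real assume e: "0 < e"
    then have e': "0 < e / (norm u + 1)" by (simp add: add_nonneg_pos)
    from limit(2)[OF this] obtain \<psi> where \<psi>: "convergent (\<lambda>N. approx N \<psi> u)"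
      "\<And>r. r \<in> {0..1} \<Longrightarrow> cmod (\<phi> r - \<psi> r) \<le> e / (norm u + 1)"
      by blast
    have "norm (approx N \<phi> u - approx N \<psi> u) \<le> e" for N
    proof -
      have "norm (approx N \<phi> u - approx N \<psi> u) \<le> e / (norm u + 1) * norm u"
        unfolding approx_diff[symmetric] by (rule approx_norm_le[OF \<psi>(2)])
      also have "\<dots> \<le> e"
        using e by (simp add: divide_le_eq add_nonneg_pos)
      finally show ?thesis .
    qed
    with \<psi>(1) show "\<exists>\<psi> v. convergent (\<lambda>N. approx N \<psi> v) \<and> (\<forall>N. norm (approx N \<phi> u - approx N \<psi> v) \<le> e)"
      by blast
  qed
qed

end

locale injective_positive_contraction = positive_contraction +
  assumes R_inj: "R x = 0 \<Longrightarrow> x = 0"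
begin

lemma closure_range_R: "closure (range R) = UNIV"
proof -
  have sub: "csubspace (range R)"
    unfolding csubspace_def
  proof (intro conjI ballI allI)
    show "0 \<in> range R" using R_scaleC[of 0 0] by (intro range_eqI[of _ _ 0]) simp
    show "x + y \<in> range R" if "x \<in> range R" "y \<in> range R" for x y
      using that by (auto simp flip: R_add)
    show "c *\<^sub>C x \<in> range R" if "x \<in> range R" for c x
      using that by (auto simp flip: R_scaleC)
  qed
  have "x \<in> closure (range R)" for x
  proof (rule ccontr)
    assume "x \<notin> closure (range R)"
    from exists_orthogonal_vector[OF sub this]
    obtain s where s: "x - s \<noteq> 0" "\<And>y. cinner (x - s) (R y) = 0" by blast
    then have "cinner (R (x - s)) (R (x - s)) = 0" by (simp add: R_sym)
    then have "R (x - s) = 0" by (simp add: cinner_self)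
    then show False using s(1) R_inj by blast
  qed
  then show ?thesis by blast
qed

lemma dense_approx:
  assumes "0 < e"
  shows "\<exists>v. norm (u - R v) \<le> e"
proof -
  have "u \<in> closure (range R)" by (simp add: closure_range_R)
  then obtain v where "dist (R v) u < e"
    using assms unfolding closure_approachable by blast
  then show ?thesis by (intro exI[of _ v]) (simp add: dist_norm norm_minus_commute)
qed

text \<open>On the range of \<open>R\<close>, the sums for \<open>\<phi>\<close> behave like those for the continuous function \<open>r \<phi> (r)\<close>.
  The range is dense and the sums are uniformly bounded.\<close>

lemma approx_tendsto_calc:
  assumes \<phi>: "\<phi> \<in> unit_bounded"
  shows "(\<lambda>N. approx N \<phi> u) \<longlonglongrightarrow> calc \<phi> u"
proof -
  obtain M where M: "\<And>r. r \<in> {0..1} \<Longrightarrow> cmod (\<phi> r) \<le> M"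
    using \<phi> unfolding unit_bounded_def by blast
  have "0 \<le> M" using order_trans[OF norm_ge_zero M[of 0]] by simp
  have "convergent (\<lambda>N. approx N \<phi> u)"
  proof (rule approx_convergentI)
    fix e :: real assume e: "0 < e"
    obtain v where v: "norm (u - R v) \<le> e / (M + 1)"
      using dense_approx[of "e / (M + 1)"] e \<open>0 \<le> M\<close> by (auto simp: add_nonneg_pos)
    have "norm (approx N \<phi> u - approx N \<phi> (R v)) \<le> e" for N
    proof -
      have "norm (approx N \<phi> u - approx N \<phi> (R v)) \<le> M * norm (u - R v)"
        unfolding approx_diff_right[symmetric] by (rule approx_norm_le[OF M])
      also have "\<dots> \<le> M * (e / (M + 1))"
        using v \<open>0 \<le> M\<close> by (intro mult_left_mono)
      also have "\<dots> \<le> e"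
        using e \<open>0 \<le> M\<close> by (simp add: divide_le_eq add_nonneg_pos)
      finally show ?thesis .
    qed
    moreover have "convergent (\<lambda>N. approx N \<phi> (R v))"
      using approx_convergent_continuous[OF continuous_on_mult_id[OF \<phi>]]
        approx_mult_id_tendsto_iff[OF \<phi>] unfolding convergent_def by blast
    ultimately show "\<exists>\<psi> v. convergent (\<lambda>N. approx N \<psi> v) \<and> (\<forall>N. norm (approx N \<phi> u - approx N \<psi> v) \<le> e)"
      by blast
  qed
  then show ?thesis by (simp add: calc_def convergent_LIMSEQ_iff)
qed

lemma calcI: "\<phi> \<in> unit_bounded \<Longrightarrow> (\<lambda>N. approx N \<phi> u) \<longlonglongrightarrow> l \<Longrightarrow> calc \<phi> u = l"
  using approx_tendsto_calc LIMSEQ_unique by blast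

lemma calc_norm_le:
  assumes "\<phi> \<in> unit_bounded" "\<And>r. r \<in> {0..1} \<Longrightarrow> cmod (\<phi> r) \<le> M"
  shows "norm (calc \<phi> u) \<le> M * norm u"
  by (rule LIMSEQ_le_const2[OF tendsto_norm[OF approx_tendsto_calc[OF assms(1)]]])
    (use approx_norm_le[of \<phi> M, OF assms(2)] in blast)

lemma calc_one: "calc (\<lambda>r. 1) u = u"
  by (intro calcI unit_bounded_continuous) (simp_all add: approx_def bern_one)

lemma calc_add:
  assumes "\<phi> \<in> unit_bounded" "\<psi> \<in> unit_bounded"
  shows "calc (\<lambda>r. \<phi> r + \<psi> r) u = calc \<phi> u + calc \<psi> u"
  using tendsto_add[OF approx_tendsto_calc[OF assms(1)] approx_tendsto_calc[OF assms(2)], of u u]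
  by (intro calcI unit_bounded_add assms) (simp add: approx_def bern_coeff_add)

lemma calc_scale:
  assumes "\<phi> \<in> unit_bounded"
  shows "calc (\<lambda>r. c * \<phi> r) u = c *\<^sub>C calc \<phi> u"
  using tendsto_scaleC[OF approx_tendsto_calc[OF assms(1)], of c u]
  by (intro calcI unit_bounded_scale assms) (simp add: approx_def bern_coeff_scale)

lemma calc_add_right:
  assumes "\<phi> \<in> unit_bounded"
  shows "calc \<phi> (u + v) = calc \<phi> u + calc \<phi> v"
  using tendsto_add[OF approx_tendsto_calc[OF assms(1)] approx_tendsto_calc[OF assms(1)], of u v]
  by (intro calcI assms) (simp add: approx_def bern_add)

lemma calc_scaleC:
  assumes "\<phi> \<in> unit_bounded"
  shows "calc \<phi> (c *\<^sub>C u) = c *\<^sub>C calc \<phi> u"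
  using tendsto_scaleC[OF approx_tendsto_calc[OF assms(1)], of c u]
  by (intro calcI assms) (simp add: approx_def bern_scaleC)

lemma calc_diff_right:
  assumes "\<phi> \<in> unit_bounded"
  shows "calc \<phi> (u - v) = calc \<phi> u - calc \<phi> v"
  using calc_add_right[OF assms, of "u - v" v] by simp

lemma calc_cnj:
  assumes "\<phi> \<in> unit_bounded"
  shows "cinner (calc (\<lambda>r. cnj (\<phi> r)) u) v = cinner u (calc \<phi> v)"
proof -
  have "(\<lambda>N. cinner (approx N (\<lambda>r. cnj (\<phi> r)) u) v) \<longlonglongrightarrow> cinner (calc (\<lambda>r. cnj (\<phi> r)) u) v"
    by (intro tendsto_cinner_left approx_tendsto_calc unit_bounded_cnj assms)
  moreover have "(\<lambda>N. cnj (cinner (approx N \<phi> v) u)) \<longlonglongrightarrow> cnj (cinner (calc \<phi> v) u)"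
    by (intro tendsto_cnj tendsto_cinner_left approx_tendsto_calc assms)
  moreover have "cinner (approx N (\<lambda>r. cnj (\<phi> r)) u) v = cnj (cinner (approx N \<phi> v) u)" for N
    by (simp only: approx_def bern_cnj cinner_commute[symmetric])
  ultimately have "cinner (calc (\<lambda>r. cnj (\<phi> r)) u) v = cnj (cinner (calc \<phi> v) u)"
    using LIMSEQ_unique by simp
  then show ?thesis by (simp only: cinner_commute[symmetric])
qed

lemma calc_mult_id:
  assumes "\<phi> \<in> unit_bounded"
  shows "calc (\<lambda>r. complex_of_real r * \<phi> r) u = calc \<phi> (R u)"
  using approx_mult_id_tendsto_iff[OF assms] approx_tendsto_calc[OF assms]
  by (intro calcI unit_bounded_continuous continuous_on_mult_id assms) blast

lemma eq_if_norm_diff_le: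
  assumes "\<And>e. 0 < e \<Longrightarrow> norm (x - y) \<le> e"
  shows "x = (y::'a)"
proof -
  have "norm (x - y) \<le> 0"
    by (rule field_le_epsilon) (simp add: assms)
  then show ?thesis by simp
qed

text \<open>By induction on \<open>\<psi>\<close> if \<open>\<psi>\<close> is continuous up to \<open>0\<close>; then on the range of \<open>R\<close>, where \<open>\<psi>\<close> can be
  replaced by \<open>r \<psi> (r)\<close>; then everywhere by density.\<close>

lemma calc_mult:
  assumes \<phi>: "\<phi> \<in> unit_bounded" and \<psi>: "\<psi> \<in> unit_bounded"
  shows "calc (\<lambda>r. \<phi> r * \<psi> r) u = calc \<phi> (calc \<psi> u)"
proof -
  obtain M where M: "\<And>r. r \<in> {0..1} \<Longrightarrow> cmod (\<phi> r) \<le> M"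
    using \<phi> unfolding unit_bounded_def by blast
  have "0 \<le> M" using order_trans[OF norm_ge_zero M[of 0]] by simp
  obtain L where L: "\<And>r. r \<in> {0..1} \<Longrightarrow> cmod (\<psi> r) \<le> L"
    using \<psi> unfolding unit_bounded_def by blast
  have "0 \<le> L" using order_trans[OF norm_ge_zero L[of 0]] by simp
  note ub = unit_bounded_continuous
  have cont: "calc (\<lambda>r. \<phi> r * \<psi> r) u = calc \<phi> (calc \<psi> u)" if "continuous_on {0..1} \<psi>" for \<psi> u
    using that
  proof (induct \<psi> arbitrary: u rule: continuous_on_unit_interval_induct)
    case one
    show ?case by (simp add: calc_one)
  next
    case (mult_id \<psi>)
    have "calc (\<lambda>r. \<phi> r * (complex_of_real r * \<psi> r)) u = calc (\<lambda>r. complex_of_real r * (\<phi> r * \<psi> r)) u"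
      by (simp add: mult.left_commute)
    also have "\<dots> = calc (\<lambda>r. \<phi> r * \<psi> r) (R u)"
      by (intro calc_mult_id unit_bounded_mult \<phi> ub mult_id)
    also have "\<dots> = calc \<phi> (calc (\<lambda>r. complex_of_real r * \<psi> r) u)"
      using mult_id by (simp add: calc_mult_id ub)
    finally show ?case .
  next
    case (add \<psi> \<xi>)
    then show ?case
      using calc_add[OF unit_bounded_mult[OF \<phi> ub] unit_bounded_mult[OF \<phi> ub], of \<psi> \<xi> u]
      by (simp add: calc_add calc_add_right \<phi> ub distrib_left)
  next
    case (scale c \<psi>)
    then show ?case
      using calc_scale[OF unit_bounded_mult[OF \<phi> ub], of \<psi> c u]
      by (simp add: calc_scale calc_scaleC \<phi> ub mult.left_commute)
  next
    case (limit \<psi>)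
    show ?case
    proof (rule eq_if_norm_diff_le)
      fix e :: real assume e: "0 < e"
      define d where "d = e / (2 * (M + 1) * (norm u + 1))"
      have d: "0 < d" "M * d * norm u \<le> e / 2"
      proof -
        have p: "0 < 2 * (M + 1) * (norm u + 1)" using \<open>0 \<le> M\<close> by (simp add: add_nonneg_pos)
        then show "0 < d" using e by (simp add: d_def)
        have "M * norm u \<le> (M + 1) * (norm u + 1)"
          using \<open>0 \<le> M\<close> by (intro mult_mono) auto
        then have "d * (M * norm u) \<le> d * ((M + 1) * (norm u + 1))"
          using \<open>0 < d\<close> by (intro mult_left_mono) auto
        also have "\<dots> = e / 2" using p by (simp add: d_def field_simps)
        finally show "M * d * norm u \<le> e / 2" by (simp add: mult_ac)
      qed
      from limit(2)[OF d(1)] obtain \<xi> where \<xi>: "continuous_on {0..1} \<xi>"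
        "calc (\<lambda>r. \<phi> r * \<xi> r) u = calc \<phi> (calc \<xi> u)" "\<And>r. r \<in> {0..1} \<Longrightarrow> cmod (\<psi> r - \<xi> r) \<le> d"
        by blast
      have cd: "continuous_on {0..1} (\<lambda>r. \<psi> r - \<xi> r)"
        by (intro continuous_intros limit \<xi>)
      have "calc (\<lambda>r. (\<psi> r - \<xi> r) + \<xi> r) u = calc (\<lambda>r. \<psi> r - \<xi> r) u + calc \<xi> u"
        by (intro calc_add ub cd \<xi>)
      then have 1: "calc \<phi> (calc \<psi> u) = calc \<phi> (calc (\<lambda>r. \<psi> r - \<xi> r) u) + calc \<phi> (calc \<xi> u)"
        by (simp add: calc_add_right \<phi>)
      have "calc (\<lambda>r. \<phi> r * (\<psi> r - \<xi> r) + \<phi> r * \<xi> r) u = calc (\<lambda>r. \<phi> r * (\<psi> r - \<xi> r)) u + calc (\<lambda>r. \<phi> r * \<xi> r) u"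
        by (intro calc_add unit_bounded_mult \<phi> ub cd \<xi>)
      then have 2: "calc (\<lambda>r. \<phi> r * \<psi> r) u = calc (\<lambda>r. \<phi> r * (\<psi> r - \<xi> r)) u + calc (\<lambda>r. \<phi> r * \<xi> r) u"
        by (simp add: algebra_simps)
      have "norm (calc \<phi> (calc (\<lambda>r. \<psi> r - \<xi> r) u)) \<le> M * norm (calc (\<lambda>r. \<psi> r - \<xi> r) u)"
        by (rule calc_norm_le[OF \<phi> M])
      also have "\<dots> \<le> M * (d * norm u)"
        by (intro mult_left_mono calc_norm_le ub cd \<xi> \<open>0 \<le> M\<close>)
      finally have 3: "norm (calc \<phi> (calc (\<lambda>r. \<psi> r - \<xi> r) u)) \<le> e / 2"
        using d(2) by simp
      have 4: "norm (calc (\<lambda>r. \<phi> r * (\<psi> r - \<xi> r)) u) \<le> M * d * norm u"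
        using M \<xi>(3) \<open>0 \<le> M\<close>
        by (intro calc_norm_le unit_bounded_mult \<phi> ub cd) (auto simp: norm_mult intro!: mult_mono)
      show "norm (calc (\<lambda>r. \<phi> r * \<psi> r) u - calc \<phi> (calc \<psi> u)) \<le> e"
        unfolding 1 2 \<xi>(2)
        using norm_triangle_ineq4[of "calc (\<lambda>r. \<phi> r * (\<psi> r - \<xi> r)) u" "calc \<phi> (calc (\<lambda>r. \<psi> r - \<xi> r) u)"]
          3 4 d(2) by simp
    qed
  qed
  have range: "calc (\<lambda>r. \<phi> r * \<psi> r) (R v) = calc \<phi> (calc \<psi> (R v))" for v
  proof -
    have "calc (\<lambda>r. \<phi> r * \<psi> r) (R v) = calc (\<lambda>r. complex_of_real r * (\<phi> r * \<psi> r)) v"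
      by (intro calc_mult_id[symmetric] unit_bounded_mult \<phi> \<psi>)
    also have "\<dots> = calc (\<lambda>r. \<phi> r * (complex_of_real r * \<psi> r)) v"
      by (simp add: mult.left_commute)
    also have "\<dots> = calc \<phi> (calc (\<lambda>r. complex_of_real r * \<psi> r) v)"
      by (intro cont continuous_on_mult_id \<psi>)
    finally show ?thesis by (simp add: calc_mult_id \<psi>)
  qed
  show ?thesis
  proof (rule eq_if_norm_diff_le)
    fix e :: real assume e: "0 < e"
    have p: "0 < 2 * (M * L + 1)" using \<open>0 \<le> M\<close> \<open>0 \<le> L\<close> by (simp add: add_nonneg_pos)
    then obtain v where v: "norm (u - R v) \<le> e / (2 * (M * L + 1))"
      using dense_approx[of "e / (2 * (M * L + 1))"] e by auto
    have "(2 * (M * L + 1)) * norm (u - R v) \<le> e"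
      using v p by (simp add: field_simps)
    then have v': "M * L * norm (u - R v) \<le> e / 2"
    proof -
      have "2 * (M * L * norm (u - R v)) + 2 * norm (u - R v) \<le> e"
        using \<open>(2 * (M * L + 1)) * norm (u - R v) \<le> e\<close> by (simp add: algebra_simps)
      then show ?thesis using norm_ge_zero[of "u - R v"] by linarith
    qed
    have 1: "norm (calc (\<lambda>r. \<phi> r * \<psi> r) (u - R v)) \<le> M * L * norm (u - R v)"
      using M L \<open>0 \<le> M\<close>
      by (intro calc_norm_le unit_bounded_mult \<phi> \<psi>) (auto simp: norm_mult intro!: mult_mono)
    have "norm (calc \<phi> (calc \<psi> (u - R v))) \<le> M * norm (calc \<psi> (u - R v))"
      by (rule calc_norm_le[OF \<phi> M])
    also have "\<dots> \<le> M * (L * norm (u - R v))"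
      by (intro mult_left_mono calc_norm_le \<psi> L \<open>0 \<le> M\<close>)
    finally have 2: "norm (calc \<phi> (calc \<psi> (u - R v))) \<le> M * L * norm (u - R v)"
      by (simp add: mult.assoc)
    have "calc (\<lambda>r. \<phi> r * \<psi> r) u - calc \<phi> (calc \<psi> u)
        = calc (\<lambda>r. \<phi> r * \<psi> r) (u - R v) - calc \<phi> (calc \<psi> (u - R v))"
      by (simp add: calc_diff_right unit_bounded_mult \<phi> \<psi> range)
    then show "norm (calc (\<lambda>r. \<phi> r * \<psi> r) u - calc \<phi> (calc \<psi> u)) \<le> e"
      using norm_triangle_ineq4[of "calc (\<lambda>r. \<phi> r * \<psi> r) (u - R v)" "calc \<phi> (calc \<psi> (u - R v))"]
        1 2 v' by simp
  qed
qed

lemma calc_commute_R: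
  assumes "\<phi> \<in> unit_bounded"
  shows "calc \<phi> (R u) = R (calc \<phi> u)"
proof -
  have id: "(\<lambda>r. complex_of_real r) \<in> unit_bounded"
    by (intro unit_bounded_continuous continuous_intros)
  have "calc (\<lambda>r. complex_of_real r) v = R v" for v
    using calc_mult_id[of "\<lambda>r. 1" v] by (simp add: calc_one unit_bounded_continuous)
  then show ?thesis
    using calc_mult[OF id assms] calc_mult_id[OF assms] by simp
qed

text \<open>The value at \<open>0\<close>, a point that corresponds to \<open>\<infinity>\<close> under \<open>r = 1 / (1 + x)\<close>, does not
  affect the operator.\<close>

lemma calc_cong:
  assumes "\<phi> \<in> unit_bounded" "\<psi> \<in> unit_bounded" "\<And>r. 0 < r \<Longrightarrow> r \<le> 1 \<Longrightarrow> \<phi> r = \<psi> r"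
  shows "calc \<phi> u = calc \<psi> u"
proof -
  have "complex_of_real r * \<phi> r = complex_of_real r * \<psi> r" if "r \<in> {0..1}" for r
    using assms(3)[of r] that by (cases "r = 0") auto
  then have "approx N (\<lambda>r. complex_of_real r * \<phi> r) u = approx N (\<lambda>r. complex_of_real r * \<psi> r) u" for N
    unfolding approx_def bern_def by (intro sum.cong refl) (simp only: atMost_iff node_in_unit)
  then have "R (calc \<phi> u) = R (calc \<psi> u)"
    unfolding calc_commute_R[OF assms(1), symmetric] calc_commute_R[OF assms(2), symmetric]
      calc_mult_id[OF assms(1), symmetric] calc_mult_id[OF assms(2), symmetric]
    by (simp add: calc_def)
  then have "R (calc \<phi> u - calc \<psi> u) = 0" by (simp add: R_diff)
  then show ?thesis using R_inj by fastforce
qed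

lemma calc_in_invariant_subspace:
  assumes H: "csubspace H" "closed H" and inv: "\<And>x. x \<in> H \<Longrightarrow> R x \<in> H"
    and u: "u \<in> H" and \<phi>: "\<phi> \<in> unit_bounded"
  shows "calc \<phi> u \<in> H"
proof (rule closed_sequentially[OF H(2) _ approx_tendsto_calc[OF \<phi>]])
  have S: "(S ^^ j) u \<in> H" for j
    by (induct j) (auto simp: u S_def intro: csubspaceD[OF H(1)] inv)
  have b: "b i j u \<in> H" for i j
    unfolding b_def by (induct i) (auto simp: S inv)
  fix N
  have "(\<Sum>k\<in>A. (\<phi> (real k / real N) * of_nat (N choose k)) *\<^sub>C b k (N - k) u) \<in> H" for A
    by (induct A rule: infinite_finite_induct) (auto intro: csubspaceD[OF H(1)] b)
  then show "approx N \<phi> u \<in> H"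
    unfolding approx_def bern_def .
qed

text \<open>The spectral parameter \<open>x\<close> of \<open>A\<close> and that of its resolvent \<open>R = (A + 1)\<^sup>-\<^sup>1\<close> are related by
  \<open>r = 1 / (1 + x)\<close>. At \<open>r = 0\<close> the lifted function takes the meaningless value \<open>g (-1)\<close>, which
  is harmless.\<close>

definition lift :: "(real \<Rightarrow> complex) \<Rightarrow> real \<Rightarrow> complex" where
  "lift g r = g (1 / r - 1)"

lemma lift_unit_bounded:
  assumes "g \<in> bdd_cont"
  shows "lift g \<in> unit_bounded"
proof -
  have "continuous_on {0<..1} (\<lambda>r. g (1 / r - 1))"
  proof (rule continuous_on_compose2[where g = g and t = UNIV])
    show "continuous_on UNIV g"
      using assms by (simp add: bdd_cont_def)
    show "continuous_on {0<..1} (\<lambda>r. 1 / r - 1 :: real)"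
      by (intro continuous_intros) auto
  qed simp
  moreover obtain M where "\<And>x. cmod (g x) \<le> M"
    using assms unfolding bdd_cont_def bounded_iff by blast
  ultimately show ?thesis
    unfolding unit_bounded_def lift_def by blast
qed

lemma calc_id: "calc (\<lambda>r. complex_of_real r) u = R u"
  using calc_mult_id[of "\<lambda>r. 1" u] by (simp add: calc_one unit_bounded_continuous)

lemma calc_id_power: "calc (\<lambda>r. complex_of_real r ^ n) u = (R ^^ n) u"
proof (induct n arbitrary: u)
  case 0
  show ?case by (simp add: calc_one)
next
  case (Suc n)
  have "(\<lambda>r. complex_of_real r ^ n) \<in> unit_bounded"
    by (intro unit_bounded_continuous continuous_intros)
  then show ?case
    using calc_mult_id[of "\<lambda>r. complex_of_real r ^ n" u] by (simp add: Suc funpow_swap1)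
qed

lemma resolvent_bdd_cont:
  assumes z: "Im z \<noteq> 0"
  shows "(\<lambda>x. 1 / (complex_of_real x - z)) \<in> bdd_cont"
proof -
  have nz: "complex_of_real x - z \<noteq> 0" for x
    using z by (auto simp: complex_eq_iff)
  have "cmod (1 / (complex_of_real x - z)) \<le> 1 / \<bar>Im z\<bar>" for x
  proof -
    have "\<bar>Im z\<bar> \<le> cmod (complex_of_real x - z)"
      using abs_Im_le_cmod[of "complex_of_real x - z"] by simp
    then show ?thesis
      unfolding norm_divide norm_one using z by (intro frac_le) auto
  qed
  moreover have "continuous_on UNIV (\<lambda>x. 1 / (complex_of_real x - z))"
    using nz by (intro continuous_intros) auto
  ultimately show ?thesis
    unfolding bdd_cont_def bounded_iff by blast
qed

text \<open>With \<open>r = 1 / (1 + x)\<close> one has \<open>1 / (x - z) = r / (1 - (1 + z) r)\<close>, and the denominator has no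
  zero on \<open>[0, 1]\<close>. So the lifted function is a quotient of functions that are continuous at \<open>0\<close>.\<close>

lemma lift_resolvent_iff:
  assumes z: "Im z \<noteq> 0"
  shows "calc (lift (\<lambda>x. 1 / (complex_of_real x - z))) u = v \<longleftrightarrow> v = R (v + (u + z *\<^sub>C v))"
proof -
  define \<alpha> where "\<alpha> r = 1 + (- (1 + z)) * complex_of_real r" for r
  define \<beta> where "\<beta> r = 1 / \<alpha> r" for r
  have \<alpha>0: "\<alpha> r \<noteq> 0" for r
    using z by (cases "r = 0") (auto simp: \<alpha>_def complex_eq_iff)
  have \<alpha>: "continuous_on {0..1} \<alpha>"
    unfolding \<alpha>_def by (intro continuous_intros)
  have \<beta>: "continuous_on {0..1} \<beta>"
    unfolding \<beta>_def using \<alpha>0 by (intro continuous_intros \<alpha>) auto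
  have id: "continuous_on {0..1} complex_of_real"
    by (intro continuous_intros)
  note ub = unit_bounded_continuous
  have calc_\<alpha>: "calc \<alpha> w = w - (1 + z) *\<^sub>C R w" for w
  proof -
    have "calc \<alpha> w = calc (\<lambda>r. 1) w + calc (\<lambda>r. - (1 + z) * complex_of_real r) w"
      unfolding \<alpha>_def by (intro calc_add ub continuous_intros)
    also have "\<dots> = w + (- (1 + z)) *\<^sub>C R w"
      by (simp only: calc_one calc_scale[OF ub[OF id]] calc_id)
    also have "(- (1 + z)) *\<^sub>C R w = - ((1 + z) *\<^sub>C R w)"
      by (simp flip: scaleC_minus1 add: scaleC_scaleC)
    finally show ?thesis by simp
  qed
  have inv: "calc \<beta> (calc \<alpha> w) = w" "calc \<alpha> (calc \<beta> w) = w" for w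
    using calc_mult[OF ub[OF \<beta>] ub[OF \<alpha>], of w] calc_mult[OF ub[OF \<alpha>] ub[OF \<beta>], of w] \<alpha>0
    by (simp_all add: \<beta>_def calc_one)
  have "calc (lift (\<lambda>x. 1 / (complex_of_real x - z))) u = calc (\<lambda>r. \<beta> r * complex_of_real r) u"
  proof (rule calc_cong)
    fix r :: real assume r: "0 < r" "r \<le> 1"
    have "complex_of_real (1 / r - 1) - z = \<alpha> r / complex_of_real r"
      using r by (simp add: \<alpha>_def field_simps)
    then show "lift (\<lambda>x. 1 / (complex_of_real x - z)) r = \<beta> r * complex_of_real r"
      by (simp add: lift_def \<beta>_def)
  qed (intro lift_unit_bounded resolvent_bdd_cont z unit_bounded_mult ub \<beta> id)+
  also have "\<dots> = calc \<beta> (R u)"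
    by (simp add: calc_mult ub \<beta> id calc_id)
  also have "\<dots> = v \<longleftrightarrow> calc \<alpha> v = R u"
    using inv by metis
  also have "\<dots> \<longleftrightarrow> v = R (v + (u + z *\<^sub>C v))"
    unfolding calc_\<alpha> by (auto simp: R_add R_scaleC scaleC_add_left algebra_simps)
  finally show ?thesis .
qed

text \<open>The spectral theorem for a positive operator \<open>A\<close>, given by its resolvent \<open>R = (A + 1)\<^sup>-\<^sup>1\<close>, in the
  form of a functional calculus.\<close>

theorem functional_calculus_lift:
  assumes H: "csubspace H" "closed H" and inv: "\<And>x. x \<in> H \<Longrightarrow> R x \<in> H"
    and A: "\<And>v g. (v, g) \<in> A \<longleftrightarrow> v = R (v + g)"
  shows "functional_calculus H (op_restrict A H) (\<lambda>g. calc (lift g))"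
proof -
  note ub = lift_unit_bounded and mem = calc_in_invariant_subspace[OF H]
  have lift_simps: "lift (\<lambda>x. 1) = (\<lambda>r. 1)" "lift (\<lambda>x. \<phi> x + \<psi> x) = (\<lambda>r. lift \<phi> r + lift \<psi> r)"
    "lift (\<lambda>x. \<phi> x * \<psi> x) = (\<lambda>r. lift \<phi> r * lift \<psi> r)" "lift (\<lambda>x. c * \<phi> x) = (\<lambda>r. c * lift \<phi> r)"
    "lift (\<lambda>x. cnj (\<phi> x)) = (\<lambda>r. cnj (lift \<phi> r))" for \<phi> \<psi> c
    by (simp_all add: lift_def fun_eq_iff)
  have bdd: "\<exists>C. \<forall>u\<in>H. norm (calc \<phi> u) \<le> C * norm u" if "\<phi> \<in> unit_bounded" for \<phi>
    using calc_norm_le[OF that] that unfolding unit_bounded_def by blast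
  show ?thesis
    unfolding functional_calculus_def bounded_op_on_def
  proof (intro conjI ballI allI impI)
    fix \<phi> assume \<phi>: "\<phi> \<in> bdd_cont"
    note \<phi>' = ub[OF \<phi>]
    show "calc (lift \<phi>) u \<in> H" if "u \<in> H" for u
      by (rule mem[OF inv that \<phi>'])
    show "calc (lift \<phi>) (u + v) = calc (lift \<phi>) u + calc (lift \<phi>) v" for u v
      by (rule calc_add_right[OF \<phi>'])
    show "calc (lift \<phi>) (c *\<^sub>C u) = c *\<^sub>C calc (lift \<phi>) u" for c u
      by (rule calc_scaleC[OF \<phi>'])
    show "\<exists>C. \<forall>u\<in>H. norm (calc (lift \<phi>) u) \<le> C * norm u"
      by (rule bdd[OF \<phi>'])
    show "calc (lift (\<lambda>x. c * \<phi> x)) u = c *\<^sub>C calc (lift \<phi>) u" for c u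
      unfolding lift_simps(4) by (rule calc_scale[OF \<phi>'])
    show "cinner (calc (lift (\<lambda>x. cnj (\<phi> x))) u) v = cinner u (calc (lift \<phi>) v)" for u v
      unfolding lift_simps by (rule calc_cnj[OF \<phi>'])
    fix \<psi> assume \<psi>: "\<psi> \<in> bdd_cont"
    show "calc (lift (\<lambda>x. \<phi> x + \<psi> x)) u = calc (lift \<phi>) u + calc (lift \<psi>) u" for u
      unfolding lift_simps by (rule calc_add[OF \<phi>' ub[OF \<psi>]])
    show "calc (lift (\<lambda>x. \<phi> x * \<psi> x)) u = calc (lift \<phi>) (calc (lift \<psi>) u)" for u
      unfolding lift_simps by (rule calc_mult[OF \<phi>' ub[OF \<psi>]])
  next
    show "calc (lift (\<lambda>x. 1)) u = u" for u
      unfolding lift_simps by (rule calc_one)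
  next
    fix z u v assume z: "Im z \<noteq> 0" and "v \<in> H"
    then show "calc (lift (\<lambda>x. 1 / (complex_of_real x - z))) u = v
        \<longleftrightarrow> (v, u + z *\<^sub>C v) \<in> op_restrict A H"
      by (simp add: lift_resolvent_iff op_restrict_def A)
  qed
qed

text \<open>Powers of \<open>R\<close> are functions of \<open>A\<close>. The absolute value only serves to have a bounded continuous
  function on the whole line.\<close>

lemma calc_lift_resolvent_power: "calc (lift (\<lambda>x. complex_of_real (1 / (1 + \<bar>x\<bar>)) ^ n)) u = (R ^^ n) u"
  and resolvent_power_bdd_cont: "(\<lambda>x. complex_of_real (1 / (1 + \<bar>x\<bar>)) ^ n) \<in> bdd_cont"
proof -
  show *: "(\<lambda>x. complex_of_real (1 / (1 + \<bar>x\<bar>)) ^ n) \<in> bdd_cont"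
  proof -
    have "cmod (complex_of_real (1 / (1 + \<bar>x\<bar>)) ^ n) \<le> 1" for x
      by (simp only: norm_power norm_of_real) (intro power_le_one; simp)
    moreover have "1 + \<bar>x\<bar> \<noteq> 0" for x :: real by (simp add: add_nonneg_eq_0_iff)
    then have "continuous_on UNIV (\<lambda>x. complex_of_real (1 / (1 + \<bar>x\<bar>)) ^ n)"
      by (intro continuous_intros) auto
    ultimately show ?thesis
      unfolding bdd_cont_def bounded_iff by blast
  qed
  have "lift (\<lambda>x. complex_of_real (1 / (1 + \<bar>x\<bar>)) ^ n) r = complex_of_real r ^ n" if "0 < r" "r \<le> 1" for r
    using that by (simp add: lift_def)
  then have "calc (lift (\<lambda>x. complex_of_real (1 / (1 + \<bar>x\<bar>)) ^ n)) u = calc (\<lambda>r. complex_of_real r ^ n) u"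
    by (intro calc_cong lift_unit_bounded[OF *] unit_bounded_continuous continuous_intros) auto
  then show "calc (lift (\<lambda>x. complex_of_real (1 / (1 + \<bar>x\<bar>)) ^ n)) u = (R ^^ n) u"
    by (simp only: calc_id_power)
qed

end

section \<open>Square integrable functions\<close>

definition sq_integrable :: "'a measure \<Rightarrow> ('a \<Rightarrow> complex) \<Rightarrow> bool" where
  "sq_integrable M F \<longleftrightarrow> F \<in> borel_measurable M \<and> integrable M (\<lambda>x. (cmod (F x))\<^sup>2)"

lemma sq_integrable_measurable [measurable_dest]: "sq_integrable M F \<Longrightarrow> F \<in> borel_measurable M"
  by (simp add: sq_integrable_def)

lemma sq_integrable_scale: "sq_integrable M F \<Longrightarrow> sq_integrable M (\<lambda>x. c * F x)"
  unfolding sq_integrable_def by (auto simp: norm_mult power_mult_distrib)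

lemma sq_integrable_add:
  assumes "sq_integrable M F" "sq_integrable M G"
  shows "sq_integrable M (\<lambda>x. F x + G x)"
  unfolding sq_integrable_def
proof
  note [measurable] = assms[THEN sq_integrable_measurable]
  show [measurable]: "(\<lambda>x. F x + G x) \<in> borel_measurable M" by measurable
  have b: "(cmod (a + b))\<^sup>2 \<le> 2 * (cmod a)\<^sup>2 + 2 * (cmod b)\<^sup>2" for a b :: complex
  proof -
    have "(cmod (a + b))\<^sup>2 \<le> (cmod a + cmod b)\<^sup>2"
      by (intro power_mono norm_triangle_ineq) auto
    also have "\<dots> \<le> 2 * (cmod a)\<^sup>2 + 2 * (cmod b)\<^sup>2"
      using sum_squares_bound[of "cmod a" "cmod b"] by (simp add: power2_sum)
    finally show ?thesis .
  qed
  show "integrable M (\<lambda>x. (cmod (F x + G x))\<^sup>2)"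
  proof (rule Bochner_Integration.integrable_bound)
    show "integrable M (\<lambda>x. 2 * (cmod (F x))\<^sup>2 + 2 * (cmod (G x))\<^sup>2)"
      using assms by (simp add: sq_integrable_def)
    show "AE x in M. norm ((cmod (F x + G x))\<^sup>2) \<le> norm (2 * (cmod (F x))\<^sup>2 + 2 * (cmod (G x))\<^sup>2)"
      using b by (intro AE_I2) simp
  qed measurable
qed

lemma sq_integrable_diff:
  assumes "sq_integrable M F" "sq_integrable M G"
  shows "sq_integrable M (\<lambda>x. F x - G x)"
  using sq_integrable_add[OF assms(1) sq_integrable_scale[OF assms(2), of "-1"]] by simp

lemma sq_integrable_bound:
  assumes "F \<in> borel_measurable M" "integrable M g" "\<And>x. x \<in> space M \<Longrightarrow> (cmod (F x))\<^sup>2 \<le> g x"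
  shows "sq_integrable M F"
proof -
  have "integrable M (\<lambda>x. (cmod (F x))\<^sup>2)"
  proof (rule Bochner_Integration.integrable_bound[OF assms(2)])
    show "AE x in M. norm ((cmod (F x))\<^sup>2) \<le> norm (g x)"
      using order_trans[OF assms(3) abs_ge_self] by (intro AE_I2) simp
  qed (use assms(1) in measurable)
  then show ?thesis using assms(1) by (simp add: sq_integrable_def)
qed

lemma sq_integrable_mult_norm:
  assumes "sq_integrable M F" "sq_integrable M G"
  shows "integrable M (\<lambda>x. cmod (F x) * cmod (G x))"
proof (rule Bochner_Integration.integrable_bound)
  note [measurable] = assms[THEN sq_integrable_measurable]
  show "integrable M (\<lambda>x. (cmod (F x))\<^sup>2 + (cmod (G x))\<^sup>2)"
    using assms by (simp add: sq_integrable_def)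
  show "(\<lambda>x. cmod (F x) * cmod (G x)) \<in> borel_measurable M" by measurable
  have "a * b \<le> a\<^sup>2 + b\<^sup>2" if "a \<ge> 0" "b \<ge> 0" for a b :: real
    using that sum_squares_bound[of a b] mult_nonneg_nonneg[of a b] by linarith
  then show "AE x in M. norm (cmod (F x) * cmod (G x)) \<le> norm ((cmod (F x))\<^sup>2 + (cmod (G x))\<^sup>2)"
    by (intro AE_I2) simp
qed

lemma sq_integrable_mult_cnj:
  assumes "sq_integrable M F" "sq_integrable M G"
  shows "integrable M (\<lambda>x. F x * cnj (G x))"
proof (rule Bochner_Integration.integrable_bound[OF sq_integrable_mult_norm[OF assms]])
  note [measurable] = assms[THEN sq_integrable_measurable]
  show "(\<lambda>x. F x * cnj (G x)) \<in> borel_measurable M" by measurable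
qed (simp add: norm_mult)

lemma sq_integrable_iff_nn_integral:
  assumes "F \<in> borel_measurable M"
  shows "sq_integrable M F \<longleftrightarrow> (\<integral>\<^sup>+x. ennreal ((cmod (F x))\<^sup>2) \<partial>M) < \<infinity>"
proof -
  have "(\<lambda>x. (cmod (F x))\<^sup>2) \<in> borel_measurable M" using assms by measurable
  then show ?thesis
    using assms by (simp add: sq_integrable_def integrable_iff_bounded)
qed

section \<open>The Laplace transform\<close>

lemma exp_integral_Rplus:
  assumes c: "c > 0"
  shows "has_bochner_integral Rplus (\<lambda>t. exp (- (t * c))) (1 / c)"
proof (rule has_bochner_integral_nn_integral)
  show "(\<lambda>t. exp (- (t * c))) \<in> borel_measurable Rplus"
    by (intro measurable_restrict_space1) measurable
  have "(\<integral>\<^sup>+t. ennreal (exp (- (t * c))) \<partial>Rplus) = (\<integral>\<^sup>+t. ennreal (exp (- (t * c))) * indicator {0<..} t \<partial>lborel)"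
    by (rule nn_integral_restrict_space) simp
  also have "\<dots> = (\<integral>\<^sup>+t. ennreal (exp (- (t * c))) * indicator {0..} t \<partial>lborel)"
  proof (rule nn_integral_cong_AE)
    show "AE t in lborel. ennreal (exp (- (t * c))) * indicator {0<..} t = ennreal (exp (- (t * c))) * indicator {0..} t"
      using AE_lborel_singleton[of 0] by eventually_elim (auto simp: indicator_def)
  qed
  also have "\<dots> = ennreal (0 - (- (exp (- (0 * c)) / c)))"
  proof (rule nn_integral_FTC_atLeast)
    show "((\<lambda>t. - (exp (- (t * c)) / c)) has_real_derivative exp (- (t * c))) (at t)" for t
      using c by (auto intro!: derivative_eq_intros)
    have "LIM t at_top. c * t :> at_top"
      by (rule filterlim_tendsto_pos_mult_at_top[OF tendsto_const c filterlim_ident])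
    then have "LIM t at_top. - (t * c) :> at_bot"
      by (simp only: filterlim_uminus_at_top minus_minus mult.commute)
    then have "((\<lambda>t. exp (- (t * c))) \<longlongrightarrow> 0) at_top"
      by (rule filterlim_compose[OF exp_at_bot])
    from tendsto_minus[OF tendsto_divide[OF this tendsto_const[of c]]]
    show "((\<lambda>t. - (exp (- (t * c)) / c)) \<longlongrightarrow> 0) at_top"
      using c by simp
  qed auto
  finally show "(\<integral>\<^sup>+t. ennreal (exp (- (t * c))) \<partial>Rplus) = ennreal (1 / c)"
    by simp
qed (use c in auto)

lemma exp_measurable_Rplus [measurable]: "(\<lambda>t. complex_of_real (exp (- (t * x)))) \<in> borel_measurable Rplus"
  by (intro measurable_restrict_space1) measurable

definition exp_fun :: "real \<Rightarrow> L2" where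
  "exp_fun x = abs_L2 (\<lambda>t. complex_of_real (exp (- (t * x))))"

lemma square_int_exp: "0 < x \<Longrightarrow> square_int (\<lambda>t. complex_of_real (exp (- (t * x))))"
proof -
  have "(cmod (complex_of_real (exp (- (t * x)))))\<^sup>2 = exp (- (t * (2 * x)))" for t
    by (simp add: power2_eq_square flip: exp_add)
  moreover assume "0 < x"
  ultimately show ?thesis
    using exp_integral_Rplus[of "2 * x"]
    by (simp add: square_int_def has_bochner_integral_iff del: norm_of_real)
qed

lemma laplace_abs: "square_int F \<Longrightarrow> laplace (abs_L2 F) x = (\<integral>t. complex_of_real (exp (- (t * x))) * F t \<partial>Rplus)"
  by (simp add: laplace.abs_eq L2_rel_def)

lemma cinner_abs: "square_int F \<Longrightarrow> square_int G \<Longrightarrow>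
    cinner (abs_L2 F) (abs_L2 G) = (\<integral>t. F t * cnj (G t) \<partial>Rplus)"
  by (simp add: cinner_L2_def L2_inner.abs_eq L2_rel_def)

lemma laplace_eq_cinner:
  assumes "0 < x"
  shows "laplace f x = cinner f (exp_fun x)"
proof -
  obtain F where "square_int F" "f = abs_L2 F" using L2_abs_cases by blast
  then show ?thesis
    using square_int_exp[OF assms] by (simp add: laplace_abs cinner_abs exp_fun_def mult.commute)
qed

text \<open>The Carleman kernel.\<close>

lemma laplace_exp_fun:
  assumes "0 < x" "0 < y"
  shows "laplace (exp_fun x) y = complex_of_real (1 / (x + y))"
proof -
  have "laplace (exp_fun x) y = (\<integral>t. complex_of_real (exp (- (t * (x + y)))) \<partial>Rplus)"
    using square_int_exp[OF assms(1)]
    by (simp add: exp_fun_def laplace_abs algebra_simps flip: of_real_mult exp_add)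
  also have "\<dots> = complex_of_real (1 / (x + y))"
    using has_bochner_integral_integral_eq[OF exp_integral_Rplus[of "x + y"]] assms by simp
  finally show ?thesis .
qed

lemma laplace_add: "0 < x \<Longrightarrow> laplace (f + g) x = laplace f x + laplace g x"
  and laplace_scaleC: "0 < x \<Longrightarrow> laplace (c *\<^sub>C f) x = c * laplace f x"
  and laplace_zero: "0 < x \<Longrightarrow> laplace 0 x = 0"
  by (simp_all add: laplace_eq_cinner cinner_simps)

lemma laplace_scaleR: "0 < x \<Longrightarrow> laplace (r *\<^sub>R f) x = complex_of_real r * laplace f x"
  by (simp add: scaleR_scaleC laplace_scaleC)

section \<open>The form and its resolvent\<close>

locale hankel_measure =
  fixes \<mu> :: "real measure"
  assumes M: "\<mu> \<in> M_class"
begin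

lemma sets_mu: "sets \<mu> = sets (restrict_space borel {0<..})"
  using M by (simp add: M_class_def)

lemma space_mu: "space \<mu> = {0<..}"
  using sets_eq_imp_space_eq[OF sets_mu] by (simp add: space_restrict_space)

lemma id_measurable: "(\<lambda>x. x) \<in> borel_measurable \<mu>"
  by (subst measurable_cong_sets[OF sets_mu refl]) (intro measurable_restrict_space1 measurable_ident_sets refl)

lemma kernel_finite: "0 < t \<Longrightarrow> (\<integral>\<^sup>+x. ennreal (exp (- (t * x))) \<partial>\<mu>) < \<infinity>"
  using M by (simp add: M_class_def hankel_kernel_def)

lemma kernel_measurable [measurable]: "(\<lambda>x. exp (- (t * x))) \<in> borel_measurable \<mu>"
  by (intro borel_measurable_exp[THEN measurable_compose[rotated]] borel_measurable_uminus borel_measurable_times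
      borel_measurable_const id_measurable)

lemma kernel_integrable: "0 < t \<Longrightarrow> integrable \<mu> (\<lambda>x. exp (- (t * x)))"
  using kernel_finite by (intro integrableI_nonneg) auto

sublocale sigma_finite_measure \<mu>
proof
  \<comment> \<open>On \<open>(0, n]\<close> the integrand of the kernel function at \<open>t = 1\<close> is at least \<open>exp (- n)\<close>.\<close>
  define A where "A n = {x \<in> space \<mu>. x \<le> real n}" for n
  have meas: "A n \<in> sets \<mu>" for n
    unfolding A_def by (rule borel_measurable_le[OF id_measurable]) simp
  have fin: "emeasure \<mu> (A n) \<noteq> \<infinity>" for n
  proof -
    have "emeasure \<mu> (A n) = (\<integral>\<^sup>+x. indicator (A n) x \<partial>\<mu>)"
      using meas by simp
    also have "\<dots> \<le> (\<integral>\<^sup>+x. ennreal (exp (real n)) * ennreal (exp (- (1 * x))) \<partial>\<mu>)"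
    proof (intro nn_integral_mono)
      fix x
      have "1 \<le> ennreal (exp (real n) * exp (- (1 * x)))" if "x \<le> real n"
        using that by (subst ennreal_1[symmetric], intro ennreal_leI) (simp flip: exp_add)
      then show "indicator (A n) x \<le> ennreal (exp (real n)) * ennreal (exp (- (1 * x)))"
        by (simp add: A_def indicator_def ennreal_mult)
    qed
    also have "\<dots> = ennreal (exp (real n)) * (\<integral>\<^sup>+x. ennreal (exp (- (1 * x))) \<partial>\<mu>)"
      by (intro nn_integral_cmult) measurable
    also have "\<dots> < \<infinity>"
      using kernel_finite[of 1] by (simp add: ennreal_mult_less_top)
    finally show ?thesis by simp
  qed
  have "(\<Union>n. A n) = space \<mu>"
    by (auto simp: A_def intro: real_arch_simple)
  then show "\<exists>A. countable A \<and> A \<subseteq> sets \<mu> \<and> \<Union> A = space \<mu> \<and> (\<forall>a\<in>A. emeasure \<mu> a \<noteq> \<infinity>)"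
    using meas fin by (intro exI[of _ "range A"]) auto
qed

lemma laplace_measurable [measurable]: "laplace f \<in> borel_measurable \<mu>"
proof -
  obtain F where F: "square_int F" "f = abs_L2 F" using L2_abs_cases by blast
  note [measurable] = square_int_measurable[OF F(1)]
  interpret R: sigma_finite_measure Rplus
    by (rule sigma_finite_measure_restrict_space[OF sigma_finite_lborel]) simp
  have "(\<lambda>t. t) \<in> borel_measurable Rplus"
    by (intro measurable_restrict_space1) measurable
  then have [measurable]: "fst \<in> borel_measurable (\<mu> \<Otimes>\<^sub>M Rplus)" "snd \<in> borel_measurable (\<mu> \<Otimes>\<^sub>M Rplus)"
    "(\<lambda>z. F (snd z)) \<in> borel_measurable (\<mu> \<Otimes>\<^sub>M Rplus)"
    using measurable_compose[OF measurable_fst id_measurable] measurable_compose[OF measurable_snd]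
      square_int_measurable[OF F(1)] by blast+
  have "(\<lambda>z. complex_of_real (exp (- (snd z * fst z))) * F (snd z)) \<in> borel_measurable (\<mu> \<Otimes>\<^sub>M Rplus)"
    by measurable
  have "(\<lambda>x. \<integral>t. complex_of_real (exp (- (t * x))) * F t \<partial>Rplus) \<in> borel_measurable \<mu>"
    by (intro R.borel_measurable_lebesgue_integral) (simp add: case_prod_beta')
  moreover have "laplace f = (\<lambda>x. \<integral>t. complex_of_real (exp (- (t * x))) * F t \<partial>Rplus)"
    by (simp add: F laplace_abs fun_eq_iff)
  ultimately show ?thesis by simp
qed

abbreviation D :: "L2 set" where "D \<equiv> hankel_form_dom \<mu>"

abbreviation Q :: "L2 \<Rightarrow> L2 \<Rightarrow> complex" where "Q \<equiv> hankel_form \<mu>"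

lemma D_iff: "f \<in> D \<longleftrightarrow> sq_integrable \<mu> (laplace f)"
  by (simp add: hankel_form_dom_def sq_integrable_iff_nn_integral)

lemma sq_integrable_cong_mu: "(\<And>x. 0 < x \<Longrightarrow> F x = G x) \<Longrightarrow> F \<in> borel_measurable \<mu> \<Longrightarrow> sq_integrable \<mu> G \<Longrightarrow> sq_integrable \<mu> F"
  unfolding sq_integrable_def
  using Bochner_Integration.integrable_cong[OF refl, of \<mu> "\<lambda>x. (cmod (F x))\<^sup>2" "\<lambda>x. (cmod (G x))\<^sup>2"]
  by (simp add: space_mu)

lemma csubspace_D: "csubspace D"
  unfolding csubspace_def
proof (intro conjI ballI allI)
  have "sq_integrable \<mu> (\<lambda>x. 0)"
    by (simp add: sq_integrable_def)
  then show "0 \<in> D"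
    using sq_integrable_cong_mu[of "laplace 0" "\<lambda>x. 0"] by (simp add: D_iff laplace_zero)
next
  fix f g assume "f \<in> D" "g \<in> D"
  then have "sq_integrable \<mu> (\<lambda>x. laplace f x + laplace g x)"
    by (intro sq_integrable_add) (simp_all only: D_iff)
  then show "f + g \<in> D"
    using sq_integrable_cong_mu[of "laplace (f + g)" "\<lambda>x. laplace f x + laplace g x"] by (simp add: D_iff laplace_add)
next
  fix f c assume "f \<in> D"
  then have "sq_integrable \<mu> (\<lambda>x. c * laplace f x)"
    by (intro sq_integrable_scale) (simp only: D_iff)
  then show "c *\<^sub>C f \<in> D"
    using sq_integrable_cong_mu[of "laplace (c *\<^sub>C f)" "\<lambda>x. c * laplace f x"] by (simp add: D_iff laplace_scaleC)
qed

lemmas D_simps = csubspaceD[OF csubspace_D]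

lemma Q_integrable: "f \<in> D \<Longrightarrow> g \<in> D \<Longrightarrow> integrable \<mu> (\<lambda>x. laplace f x * cnj (laplace g x))"
  unfolding D_iff by (rule sq_integrable_mult_cnj)

lemma Q_add_left: "f \<in> D \<Longrightarrow> f' \<in> D \<Longrightarrow> g \<in> D \<Longrightarrow> Q (f + f') g = Q f g + Q f' g"
proof -
  assume *: "f \<in> D" "f' \<in> D" "g \<in> D"
  have "Q (f + f') g = (\<integral>x. laplace f x * cnj (laplace g x) + laplace f' x * cnj (laplace g x) \<partial>\<mu>)"
    unfolding hankel_form_def by (intro Bochner_Integration.integral_cong) (auto simp: space_mu laplace_add distrib_right)
  then show ?thesis
    using * by (simp add: hankel_form_def Q_integrable)
qed

lemma Q_scaleC_left: "Q (c *\<^sub>C f) g = c * Q f g"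
proof -
  have "Q (c *\<^sub>C f) g = (\<integral>x. c * (laplace f x * cnj (laplace g x)) \<partial>\<mu>)"
    unfolding hankel_form_def by (intro Bochner_Integration.integral_cong) (auto simp: space_mu laplace_scaleC)
  then show ?thesis by (simp add: hankel_form_def)
qed

lemma Q_diff_left: "f \<in> D \<Longrightarrow> f' \<in> D \<Longrightarrow> g \<in> D \<Longrightarrow> Q (f - f') g = Q f g - Q f' g"
  using Q_add_left[of "f - f'" f' g] D_simps(4)[of f f'] by simp

lemma Q_commute: "Q f g = cnj (Q g f)"
  unfolding hankel_form_def by (simp add: mult.commute flip: Bochner_Integration.integral_cnj)

lemma Q_self: "Q f f = complex_of_real (\<integral>x. (cmod (laplace f x))\<^sup>2 \<partial>\<mu>)"
  unfolding hankel_form_def by (simp flip: complex_norm_square of_real_power)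

lemma Q_self_nonneg: "0 \<le> Re (Q f f)"
  unfolding Q_self by simp

text \<open>Fatou's lemma; the Laplace transform converges pointwise because evaluation at \<open>x\<close> is the
  inner product with \<open>exp_fun x\<close>. This is where the closedness of the form comes from.\<close>

lemma distance_lower_semicontinuous:
  assumes \<phi>: "sq_integrable \<mu> \<phi>" and X: "\<And>n. X n \<in> D" and l: "X \<longlonglongrightarrow> l"
    and c: "(\<lambda>n. \<integral>x. (cmod (laplace (X n) x - \<phi> x))\<^sup>2 \<partial>\<mu>) \<longlonglongrightarrow> c"
  shows "l \<in> D \<and> (\<integral>x. (cmod (laplace l x - \<phi> x))\<^sup>2 \<partial>\<mu>) \<le> c"
proof -
  note [measurable] = sq_integrable_measurable[OF \<phi>]
  let ?g = "\<lambda>n x. ennreal ((cmod (laplace (X n) x - \<phi> x))\<^sup>2)"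
  have int: "integrable \<mu> (\<lambda>x. (cmod (laplace (X n) x - \<phi> x))\<^sup>2)" for n
    using sq_integrable_diff[OF X[of n, unfolded D_iff] \<phi>] by (simp add: sq_integrable_def)
  have pt: "(\<lambda>n. laplace (X n) x) \<longlonglongrightarrow> laplace l x" if "0 < x" for x
    using tendsto_cinner_left[OF l] by (simp add: laplace_eq_cinner that)
  have "(\<integral>\<^sup>+x. ennreal ((cmod (laplace l x - \<phi> x))\<^sup>2) \<partial>\<mu>) = (\<integral>\<^sup>+x. liminf (\<lambda>n. ?g n x) \<partial>\<mu>)"
  proof (rule nn_integral_cong)
    fix x assume "x \<in> space \<mu>"
    then have "(\<lambda>n. ?g n x) \<longlonglongrightarrow> ennreal ((cmod (laplace l x - \<phi> x))\<^sup>2)"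
      by (intro tendsto_intros pt) (simp add: space_mu)
    then show "ennreal ((cmod (laplace l x - \<phi> x))\<^sup>2) = liminf (\<lambda>n. ?g n x)"
      by (intro lim_imp_Liminf[symmetric]) simp_all
  qed
  also have "\<dots> \<le> liminf (\<lambda>n. \<integral>\<^sup>+x. ?g n x \<partial>\<mu>)"
    by (rule nn_integral_liminf) measurable
  also have "\<dots> = ennreal c"
  proof (rule lim_imp_Liminf)
    show "(\<lambda>n. \<integral>\<^sup>+x. ?g n x \<partial>\<mu>) \<longlonglongrightarrow> ennreal c"
      using tendsto_ennrealI[OF c] by (simp add: nn_integral_eq_integral[OF int])
  qed simp
  finally have le: "(\<integral>\<^sup>+x. ennreal ((cmod (laplace l x - \<phi> x))\<^sup>2) \<partial>\<mu>) \<le> ennreal c" .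
  have c0: "0 \<le> c"
    by (rule LIMSEQ_le_const[OF c]) (auto intro!: exI[of _ 0])
  have sq: "sq_integrable \<mu> (\<lambda>x. laplace l x - \<phi> x)"
    using le by (subst sq_integrable_iff_nn_integral) (auto intro: le_less_trans)
  then have "l \<in> D"
    using sq_integrable_add[OF sq \<phi>] by (simp add: D_iff)
  moreover have "(\<integral>x. (cmod (laplace l x - \<phi> x))\<^sup>2 \<partial>\<mu>) \<le> c"
    using le sq c0 by (simp add: sq_integrable_def nn_integral_eq_integral)
  ultimately show ?thesis by simp
qed

text \<open>The orthogonal projection of \<open>(f, \<phi>)\<close> onto the graph of the Laplace transform
  \<open>D \<rightarrow> L\<^sup>2(\<mu>)\<close>. With \<open>\<phi> = 0\<close> this is the resolvent of the Hankel operator at \<open>-1\<close>.\<close>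

lemma exists_graph_projection:
  assumes \<phi>: "sq_integrable \<mu> \<phi>"
  shows "\<exists>u\<in>D. \<forall>g\<in>D. (\<integral>x. (laplace u x - \<phi> x) * cnj (laplace g x) \<partial>\<mu>) + cinner (u - f) g = 0"
proof -
  note [measurable] = sq_integrable_measurable[OF \<phi>]
  define p where "p u = (\<integral>x. (cmod (laplace u x - \<phi> x))\<^sup>2 \<partial>\<mu>)" for u
  have sq: "sq_integrable \<mu> (\<lambda>x. laplace u x - \<phi> x)" if "u \<in> D" for u
    using that by (intro sq_integrable_diff \<phi>) (simp add: D_iff)
  have int: "integrable \<mu> (\<lambda>x. (cmod (laplace u x - \<phi> x))\<^sup>2)" if "u \<in> D" for u
    using sq[OF that] by (simp add: sq_integrable_def)
  have "\<exists>u\<in>D. \<forall>v\<in>D. p u + (norm (u - f))\<^sup>2 \<le> p v + (norm (v - f))\<^sup>2"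
  proof (rule exists_minimiser)
    show "convex D" by (rule convex_csubspace[OF csubspace_D])
    show "D \<noteq> {}" using D_simps(1) by blast
    show "0 \<le> p u" for u unfolding p_def by simp
    show "p ((1/2) *\<^sub>R (u + v)) \<le> (p u + p v) / 2" if uv: "u \<in> D" "v \<in> D" for u v
    proof -
      have "p ((1/2) *\<^sub>R (u + v)) \<le> (\<integral>x. ((cmod (laplace u x - \<phi> x))\<^sup>2 + (cmod (laplace v x - \<phi> x))\<^sup>2) / 2 \<partial>\<mu>)"
        unfolding p_def
      proof (rule integral_mono)
        show "integrable \<mu> (\<lambda>x. (cmod (laplace ((1/2) *\<^sub>R (u + v)) x - \<phi> x))\<^sup>2)"
          using uv by (intro int D_simps)
        show "integrable \<mu> (\<lambda>x. ((cmod (laplace u x - \<phi> x))\<^sup>2 + (cmod (laplace v x - \<phi> x))\<^sup>2) / 2)"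
          using uv int by simp
        fix x assume "x \<in> space \<mu>"
        then have "laplace ((1/2) *\<^sub>R (u + v)) x - \<phi> x = ((laplace u x - \<phi> x) + (laplace v x - \<phi> x)) / 2"
          by (simp add: space_mu laplace_scaleR laplace_add field_simps)
        moreover have "(cmod ((a + b) / 2))\<^sup>2 \<le> ((cmod a)\<^sup>2 + (cmod b)\<^sup>2) / 2" for a b :: complex
        proof -
          have "(cmod (a + b))\<^sup>2 + (cmod (a - b))\<^sup>2 = 2 * ((cmod a)\<^sup>2 + (cmod b)\<^sup>2)"
            unfolding cmod_power2 by (simp add: power2_eq_square algebra_simps)
          moreover have "(cmod ((a + b) / 2))\<^sup>2 = (cmod (a + b))\<^sup>2 / 4"
            by (simp add: norm_divide power_divide)
          ultimately show ?thesis
            using zero_le_power2[of "cmod (a - b)"] by linarith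
        qed
        ultimately show "(cmod (laplace ((1/2) *\<^sub>R (u + v)) x - \<phi> x))\<^sup>2
            \<le> ((cmod (laplace u x - \<phi> x))\<^sup>2 + (cmod (laplace v x - \<phi> x))\<^sup>2) / 2"
          by (simp only:)
      qed
      also have "\<dots> = (p u + p v) / 2"
        using uv int by (simp add: p_def)
      finally show ?thesis .
    qed
    show "l \<in> D \<and> p l \<le> c" if "\<And>n. X n \<in> D" "X \<longlonglongrightarrow> l" "(\<lambda>n. p (X n)) \<longlonglongrightarrow> c" for X l c
      using distance_lower_semicontinuous[OF \<phi>] that unfolding p_def by blast
  qed
  then obtain u where u: "u \<in> D" and min: "\<And>v. v \<in> D \<Longrightarrow> p u + (norm (u - f))\<^sup>2 \<le> p v + (norm (v - f))\<^sup>2"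
    by blast
  define B where "B g = (\<integral>x. (laplace u x - \<phi> x) * cnj (laplace g x) \<partial>\<mu>) + cinner (u - f) g" for g
  have intB: "integrable \<mu> (\<lambda>x. (laplace u x - \<phi> x) * cnj (laplace g x))" if "g \<in> D" for g
    using that by (intro sq_integrable_mult_cnj sq u) (simp add: D_iff)
  have re: "Re (B g) = 0" if g: "g \<in> D" for g
  proof (rule linear_term_eq_0)
    fix t :: real
    have v: "u + t *\<^sub>R g \<in> D" using u g by (intro D_simps)
    have intg: "integrable \<mu> (\<lambda>x. (cmod (laplace g x))\<^sup>2)"
      using g by (simp add: D_iff sq_integrable_def)
    have "p (u + t *\<^sub>R g) = (\<integral>x. (cmod (laplace u x - \<phi> x))\<^sup>2
        + 2 * t * Re ((laplace u x - \<phi> x) * cnj (laplace g x)) + t\<^sup>2 * (cmod (laplace g x))\<^sup>2 \<partial>\<mu>)"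
      unfolding p_def
    proof (rule Bochner_Integration.integral_cong)
      fix x assume "x \<in> space \<mu>"
      then have "laplace (u + t *\<^sub>R g) x - \<phi> x = (laplace u x - \<phi> x) + complex_of_real t * laplace g x"
        by (simp add: space_mu laplace_scaleR laplace_add)
      moreover have "(cmod (a + complex_of_real t * b))\<^sup>2 = (cmod a)\<^sup>2 + 2 * t * Re (a * cnj b) + t\<^sup>2 * (cmod b)\<^sup>2" for a b
        unfolding cmod_power2 by (simp add: power2_eq_square algebra_simps)
      ultimately show "(cmod (laplace (u + t *\<^sub>R g) x - \<phi> x))\<^sup>2 = (cmod (laplace u x - \<phi> x))\<^sup>2
        + 2 * t * Re ((laplace u x - \<phi> x) * cnj (laplace g x)) + t\<^sup>2 * (cmod (laplace g x))\<^sup>2"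
        by (simp only:)
    qed simp
    also have "\<dots> = p u + 2 * t * Re (\<integral>x. (laplace u x - \<phi> x) * cnj (laplace g x) \<partial>\<mu>) + t\<^sup>2 * Re (Q g g)"
      using int[OF u] intB[OF g] intg
      by (simp only: p_def Q_self Re_complex_of_real Bochner_Integration.integral_add
          Bochner_Integration.integrable_add integral_mult_right_zero integrable_Re integral_Re integrable_mult_right)
    finally have "p (u + t *\<^sub>R g) = p u + 2 * t * Re (\<integral>x. (laplace u x - \<phi> x) * cnj (laplace g x) \<partial>\<mu>) + t\<^sup>2 * Re (Q g g)" .
    moreover have "(norm (u + t *\<^sub>R g - f))\<^sup>2 = (norm (u - f))\<^sup>2 + 2 * t * Re (cinner (u - f) g) + t\<^sup>2 * (norm g)\<^sup>2"
      unfolding power2_norm_eq_inner inner_eq_Re_cinner[symmetric]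
      by (simp add: inner_simps inner_commute algebra_simps power2_eq_square)
    ultimately show "0 \<le> 2 * t * Re (B g) + t\<^sup>2 * (Re (Q g g) + (norm g)\<^sup>2)"
      using min[OF v] by (simp add: B_def algebra_simps)
  qed
  have "B g = 0" if g: "g \<in> D" for g
  proof -
    have "(\<integral>x. (laplace u x - \<phi> x) * cnj (laplace (\<i> *\<^sub>C g) x) \<partial>\<mu>)
        = (\<integral>x. - \<i> * ((laplace u x - \<phi> x) * cnj (laplace g x)) \<partial>\<mu>)"
      by (intro Bochner_Integration.integral_cong) (auto simp: space_mu laplace_scaleC)
    also have "\<dots> = - \<i> * (\<integral>x. (laplace u x - \<phi> x) * cnj (laplace g x) \<partial>\<mu>)"
      by (rule integral_mult_right_zero)
    finally have "B (\<i> *\<^sub>C g) = - \<i> * B g"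
      by (simp add: B_def cinner_scaleC_right algebra_simps)
    then show ?thesis
      using re[OF g] re[OF D_simps(3)[OF g, of \<i>]] by (simp add: complex_eq_iff)
  qed
  then show ?thesis using u unfolding B_def by blast
qed

text \<open>Cutting off \<open>f\<close> to a compact interval \<open>[a, b]\<close> gives exponential decay of the Laplace
  transform, so these functions lie in the form domain.\<close>

lemma form_domain_dense:
  assumes f: "\<And>g. g \<in> D \<Longrightarrow> cinner f g = 0"
  shows "f = 0"
proof -
  obtain F where F: "square_int F" "f = abs_L2 F" using L2_abs_cases by blast
  note [measurable] = square_int_measurable[OF F(1)]
  have iF: "integrable Rplus (\<lambda>t. (cmod (F t))\<^sup>2)" using F(1) by (simp add: square_int_def)
  have zero: "AE t in Rplus. a \<le> t \<and> t \<le> b \<longrightarrow> F t = 0" if a: "0 < a" for a b :: real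
  proof -
    define I where "I t = (indicator {a..b} t :: real)" for t
    define G where "G t = F t * complex_of_real (I t)" for t
    have [measurable]: "I \<in> borel_measurable Rplus"
      unfolding I_def by (intro measurable_restrict_space1) measurable
    have [measurable]: "G \<in> borel_measurable Rplus"
      unfolding G_def by measurable
    have I: "I t = 0 \<or> I t = 1" for t by (simp add: I_def indicator_def)
    have iI: "integrable Rplus I"
    proof -
      have "integrable lborel (\<lambda>t. indicator {0<..} t *\<^sub>R I t)"
      proof (rule Bochner_Integration.integrable_bound)
        show "integrable lborel (indicator {a..b} :: real \<Rightarrow> real)"
          by (intro integrable_real_indicator) (auto simp: emeasure_lborel_Icc_eq)
        show "(\<lambda>t. indicator {0<..} t *\<^sub>R I t) \<in> borel_measurable lborel"
          unfolding I_def by measurable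
        show "AE t in lborel. norm (indicator {0<..} t *\<^sub>R I t) \<le> norm (indicator {a..b} t :: real)"
          by (auto simp: I_def indicator_def)
      qed
      then show ?thesis by (simp add: integrable_restrict_space)
    qed
    have G: "square_int G"
      unfolding square_int_def
    proof
      show "integrable Rplus (\<lambda>t. (cmod (G t))\<^sup>2)"
      proof (rule Bochner_Integration.integrable_bound[OF iF])
        have "(cmod (G t))\<^sup>2 \<le> (cmod (F t))\<^sup>2" for t
          using I[of t] by (auto simp: G_def)
        then show "AE t in Rplus. norm ((cmod (G t))\<^sup>2) \<le> norm ((cmod (F t))\<^sup>2)"
          by (intro AE_I2) simp
      qed measurable
    qed measurable
    define c where "c = (\<integral>t. (cmod (F t))\<^sup>2 + I t \<partial>Rplus)"
    have bound: "cmod (laplace (abs_L2 G) x) \<le> exp (- (a * x)) * c" if x: "0 < x" for x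
    proof -
      have pt: "cmod (complex_of_real (exp (- (t * x))) * G t) \<le> exp (- (a * x)) * ((cmod (F t))\<^sup>2 + I t)" for t
      proof (cases "I t = 1")
        case True
        then have "a \<le> t" by (simp add: I_def indicator_def split: if_splits)
        then have "exp (- (t * x)) \<le> exp (- (a * x))" using x by simp
        moreover have "cmod (F t) \<le> (cmod (F t))\<^sup>2 + 1"
          using sum_squares_bound[of "cmod (F t)" 1] by (simp add: power2_eq_square) (smt (verit) norm_ge_zero)
        ultimately show ?thesis
          using True by (simp add: norm_mult G_def) (intro mult_mono; simp)
      next
        case False
        then have "I t = 0" using I by blast
        then show ?thesis by (simp add: G_def)
      qed
      have int: "integrable Rplus (\<lambda>t. exp (- (a * x)) * ((cmod (F t))\<^sup>2 + I t))"
        using iF iI by simp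
      have "cmod (laplace (abs_L2 G) x) \<le> (\<integral>t. cmod (complex_of_real (exp (- (t * x))) * G t) \<partial>Rplus)"
        unfolding laplace_abs[OF G] by (rule integral_norm_bound)
      also have "\<dots> \<le> (\<integral>t. exp (- (a * x)) * ((cmod (F t))\<^sup>2 + I t) \<partial>Rplus)"
      proof (rule integral_mono[OF _ int pt])
        show "integrable Rplus (\<lambda>t. cmod (complex_of_real (exp (- (t * x))) * G t))"
        proof (rule Bochner_Integration.integrable_bound[OF int])
          show "AE t in Rplus. norm (cmod (complex_of_real (exp (- (t * x))) * G t))
              \<le> norm (exp (- (a * x)) * ((cmod (F t))\<^sup>2 + I t))"
            using order_trans[OF pt abs_ge_self] by (intro AE_I2) simp
        qed measurable
      qed
      finally show ?thesis by (simp add: c_def)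
    qed
    have "abs_L2 G \<in> D"
      unfolding D_iff
    proof (rule sq_integrable_bound)
      show "integrable \<mu> (\<lambda>x. c\<^sup>2 * exp (- ((2 * a) * x)))"
        using kernel_integrable[of "2 * a"] a by simp
      fix x assume "x \<in> space \<mu>"
      then have "(cmod (laplace (abs_L2 G) x))\<^sup>2 \<le> (exp (- (a * x)) * c)\<^sup>2"
        using bound by (intro power_mono) (auto simp: space_mu)
      also have "\<dots> = c\<^sup>2 * exp (- ((2 * a) * x))"
        by (simp add: power_mult_distrib power2_eq_square flip: exp_add)
      finally show "(cmod (laplace (abs_L2 G) x))\<^sup>2 \<le> c\<^sup>2 * exp (- ((2 * a) * x))" .
    qed measurable
    then have "0 = cinner f (abs_L2 G)" using f by simp
    also have "\<dots> = (\<integral>t. complex_of_real ((cmod (G t))\<^sup>2) \<partial>Rplus)"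
      unfolding F(2) cinner_abs[OF F(1) G]
    proof (rule Bochner_Integration.integral_cong)
      show "F t * cnj (G t) = complex_of_real ((cmod (G t))\<^sup>2)" for t
        using I[of t] by (auto simp: G_def complex_norm_square simp del: of_real_power)
    qed simp
    finally have "(\<integral>t. (cmod (G t))\<^sup>2 \<partial>Rplus) = 0"
      by (simp del: of_real_power)
    then have "AE t in Rplus. (cmod (G t))\<^sup>2 = 0"
      using G by (subst (asm) integral_nonneg_eq_0_iff_AE) (auto simp: square_int_def)
    then show ?thesis
      by eventually_elim (auto simp: G_def I_def indicator_def)
  qed
  have "AE t in Rplus. \<forall>n. inverse (real (Suc n)) \<le> t \<and> t \<le> real n \<longrightarrow> F t = 0"
    unfolding AE_all_countable by (intro allI zero) simp
  then have "AE t in Rplus. F t = 0"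
    using AE_space
  proof eventually_elim
    case (elim t)
    then have t: "0 < t" by (simp add: space_restrict_space)
    obtain n m where n: "inverse (real (Suc n)) < t" and m: "t \<le> real m"
      using reals_Archimedean[OF t] real_arch_simple by blast
    have "inverse (real (Suc (max n m))) \<le> inverse (real (Suc n))"
      by (intro le_imp_inverse_le) auto
    then have "inverse (real (Suc (max n m))) \<le> t"
      using n by linarith
    moreover have "t \<le> real (max n m)"
      using m by auto
    ultimately show ?case using elim by blast
  qed
  then have "L2_rel F (\<lambda>t. 0)"
    using F(1) by (simp add: L2_rel_def square_int_zero)
  then show ?thesis
    using F(2) Quotient3_rel_abs[OF Quotient3_L2, of F "\<lambda>t. 0"] by (simp add: zero_L2_def)
qed

lemma energy_zero_imp_zero:
  assumes u: "u \<in> D" "\<And>g. g \<in> D \<Longrightarrow> Q u g + cinner u g = 0"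
  shows "u = 0"
proof -
  have "Re (Q u u) + (norm u)\<^sup>2 = 0"
    using arg_cong[OF u(2)[OF u(1)], of Re] by (simp add: cinner_self)
  then show ?thesis using Q_self_nonneg[of u] zero_le_power2[of "norm u"]
    by (smt (verit) norm_eq_zero zero_eq_power2)
qed

text \<open>The resolvent \<open>(\<Gamma> + 1)\<^sup>-\<^sup>1\<close>.\<close>

definition res :: "L2 \<Rightarrow> L2" where
  "res f = (SOME u. u \<in> D \<and> (\<forall>g\<in>D. Q u g = cinner (f - u) g))"

lemma res_props: "res f \<in> D" "g \<in> D \<Longrightarrow> Q (res f) g = cinner (f - res f) g"
proof -
  have "sq_integrable \<mu> (\<lambda>x. 0)" by (simp add: sq_integrable_def)
  from exists_graph_projection[OF this, of f]
  obtain u where u: "u \<in> D" "\<And>g. g \<in> D \<Longrightarrow> Q u g + cinner (u - f) g = 0"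
    by (auto simp: hankel_form_def)
  have "Q u g = cinner (f - u) g" if "g \<in> D" for g
    using u(2)[OF that] by (simp add: cinner_diff_left algebra_simps add_eq_0_iff)
  with u(1) have "\<exists>u. u \<in> D \<and> (\<forall>g\<in>D. Q u g = cinner (f - u) g)" by blast
  from someI_ex[OF this] show "res f \<in> D" "g \<in> D \<Longrightarrow> Q (res f) g = cinner (f - res f) g"
    unfolding res_def by blast+
qed

lemma res_eqI:
  assumes "u \<in> D" "\<And>g. g \<in> D \<Longrightarrow> Q u g = cinner (f - u) g"
  shows "u = res f"
proof -
  have "u - res f = 0"
  proof (rule energy_zero_imp_zero)
    show "u - res f \<in> D" by (intro D_simps assms res_props)
    show "Q (u - res f) g + cinner (u - res f) g = 0" if "g \<in> D" for g
      using that by (simp add: Q_diff_left assms res_props cinner_diff_left)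
  qed
  then show ?thesis by simp
qed

lemma hankel_op_iff: "(v, g) \<in> hankel_op \<mu> \<longleftrightarrow> v = res (v + g)"
proof
  assume "(v, g) \<in> hankel_op \<mu>"
  then show "v = res (v + g)"
    by (intro res_eqI) (auto simp: hankel_op_def)
next
  assume v: "v = res (v + g)"
  show "(v, g) \<in> hankel_op \<mu>"
    using res_props(1)[of "v + g"] res_props(2)[of _ "v + g"] unfolding v[symmetric]
    by (simp add: hankel_op_def)
qed

sublocale injective_positive_contraction res
proof
  fix x y :: L2 and c :: complex
  show "res (x + y) = res x + res y"
    by (intro res_eqI[symmetric] D_simps res_props) (simp add: Q_add_left res_props cinner_simps)
  show "res (c *\<^sub>C x) = c *\<^sub>C res x"
    by (intro res_eqI[symmetric] D_simps res_props)
      (simp add: Q_scaleC_left res_props cinner_simps right_diff_distrib)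
  show "cinner (res x) y = cinner x (res y)"
  proof -
    have "cinner (x - res x) (res y) = Q (res x) (res y)"
      by (simp add: res_props)
    also have "\<dots> = cnj (cinner (y - res y) (res x))"
      by (subst Q_commute) (simp add: res_props)
    also have "\<dots> = cinner (res x) (y - res y)"
      by (rule cinner_commute[symmetric])
    finally show ?thesis by (simp add: cinner_simps)
  qed
  have "0 \<le> inner (x - res x) (res x)"
    using Q_self_nonneg[of "res x"] by (simp add: res_props inner_eq_Re_cinner)
  then show "(norm (res x))\<^sup>2 \<le> inner (res x) x"
    by (simp add: power2_norm_eq_inner inner_diff_left) (simp add: inner_commute)
  show "x = 0" if "res x = 0"
  proof (rule form_domain_dense)
    fix g assume "g \<in> D"
    from res_props(2)[OF this, of x] show "cinner x g = 0"
      by (simp add: that Q_scaleC_left[of 0 0, simplified])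
  qed
qed

lemma energy_res_le: "Re (Q (res k) (res k)) \<le> (norm k)\<^sup>2"
proof -
  have "Re (Q (res k) (res k)) = inner k (res k) - (norm (res k))\<^sup>2"
    by (simp add: res_props inner_eq_Re_cinner[symmetric] inner_diff_left power2_norm_eq_inner)
  also have "\<dots> \<le> norm k * norm (res k)"
    using norm_cauchy_schwarz[of k "res k"] zero_le_power2[of "norm (res k)"] by linarith
  also have "\<dots> \<le> norm k * norm k"
    by (intro mult_left_mono R_norm_le) simp
  finally show ?thesis by (simp add: power2_eq_square)
qed

lemma op_ker_iff: "f \<in> op_ker (hankel_op \<mu>) \<longleftrightarrow> res f = f"
  unfolding op_ker_def by (auto simp: hankel_op_iff)

lemma laplace_zero_imp_kernel:
  assumes "AE x in \<mu>. laplace g x = 0"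
  shows "g \<in> op_ker (hankel_op \<mu>)"
proof -
  have sq: "AE x in \<mu>. ennreal ((cmod (laplace g x))\<^sup>2) = 0"
    using assms by eventually_elim simp
  have "(\<integral>\<^sup>+x. ennreal ((cmod (laplace g x))\<^sup>2) \<partial>\<mu>) = 0"
    using nn_integral_cong_AE[OF sq] by simp
  then have "g \<in> D" by (simp add: hankel_form_dom_def)
  moreover have "Q g u = 0" for u
  proof -
    have "AE x in \<mu>. laplace g x * cnj (laplace u x) = 0"
      using assms by eventually_elim simp
    then show ?thesis
      unfolding hankel_form_def by (intro integral_eq_zero_AE)
  qed
  ultimately show ?thesis
    by (simp add: op_ker_def hankel_op_def)
qed

abbreviation H0 :: "L2 set" where "H0 \<equiv> hankel_perp_space \<mu>"

lemma csubspace_H0: "csubspace H0" and closed_H0: "closed H0"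
  by (simp_all add: hankel_perp_space_def csubspace_ortho_compl closed_ortho_compl)

lemma H0_iff: "f \<in> H0 \<longleftrightarrow> (\<forall>g. res g = g \<longrightarrow> cinner f g = 0)"
  by (auto simp: hankel_perp_space_def ortho_compl_def op_ker_iff)

lemma res_H0: "f \<in> H0 \<Longrightarrow> res f \<in> H0"
  by (simp add: H0_iff R_sym)

lemma H0_kernel: "f \<in> H0 \<Longrightarrow> res f = f \<Longrightarrow> f = 0"
  using cinner_self[of f] by (simp add: H0_iff)

end

section \<open>Weights for finite and co-finite measures\<close>

text \<open>The identity \<open>weight_eq\<close> is the scalar form of \<open>X G + G X = \<langle>\<cdot>, m\<rangle> m\<close>. The last assumption
  puts the exponentials into the form domain, so that the Laplace transform of \<open>\<Gamma> f\<close> can be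
  computed by testing the form against them.\<close>

locale hankel_weight = hankel_measure +
  fixes m p :: "real \<Rightarrow> real"
  assumes m_measurable [measurable]: "m \<in> borel_measurable \<mu>"
    and p_measurable [measurable]: "p \<in> borel_measurable \<mu>"
    and m_pos: "0 < x \<Longrightarrow> 0 < m x"
    and p_pos: "0 < x \<Longrightarrow> 0 < p x"
    and weight_eq: "0 < x \<Longrightarrow> 0 < y \<Longrightarrow> (p x + p y) / (x + y) = m x * m y"
    and m_square: "integrable \<mu> (\<lambda>x. (m x)\<^sup>2)"
    and resolvent_le: "0 < x \<Longrightarrow> \<exists>c. \<forall>y>0. 1 / (x + y) \<le> c * m y"
begin

lemma weight_le: "0 < x \<Longrightarrow> 0 < y \<Longrightarrow> p x / (x + y) \<le> m x * m y"
  using p_pos[of y] by (simp add: weight_eq[symmetric] divide_right_mono)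

lemma weight_sq_integrable: "sq_integrable \<mu> (\<lambda>x. complex_of_real (m x))"
  using m_square by (simp add: sq_integrable_def)

lemma exp_fun_D:
  assumes x: "0 < x"
  shows "exp_fun x \<in> D"
proof -
  obtain c where c: "\<And>y. 0 < y \<Longrightarrow> 1 / (x + y) \<le> c * m y"
    using resolvent_le[OF x] by blast
  show ?thesis
    unfolding D_iff
  proof (rule sq_integrable_bound)
    show "integrable \<mu> (\<lambda>y. c\<^sup>2 * (m y)\<^sup>2)" using m_square by simp
    fix y assume "y \<in> space \<mu>"
    then have y: "0 < y" by (simp add: space_mu)
    have "(1 / (x + y))\<^sup>2 \<le> (c * m y)\<^sup>2"
      using c[OF y] x y by (intro power_mono) auto
    then show "(cmod (laplace (exp_fun x) y))\<^sup>2 \<le> c\<^sup>2 * (m y)\<^sup>2"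
      unfolding laplace_exp_fun[OF x y] norm_of_real by (simp only: power2_abs power_mult_distrib)
  qed measurable
qed

text \<open>As \<open>k - R k = \<Gamma> R k\<close>, this is the relation \<open>L \<Gamma> = G L\<close> on the range of \<open>R\<close>.\<close>

lemma laplace_hankel:
  assumes x: "0 < x"
  shows "laplace (k - res k) x = (\<integral>y. laplace (res k) y * complex_of_real (1 / (x + y)) \<partial>\<mu>)"
proof -
  have "laplace (k - res k) x = Q (res k) (exp_fun x)"
    by (simp add: laplace_eq_cinner[OF x] res_props exp_fun_D[OF x])
  also have "\<dots> = (\<integral>y. laplace (res k) y * complex_of_real (1 / (x + y)) \<partial>\<mu>)"
    unfolding hankel_form_def
    by (intro Bochner_Integration.integral_cong) (simp_all add: laplace_exp_fun[OF x] space_mu del: of_real_divide)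
  finally show ?thesis .
qed

text \<open>These are the objects of the formal argument: \<open>ell f = \<langle>L f, m\<rangle>\<close>, and \<open>theta\<close> is the
  quadratic form of \<open>X\<close> pulled back by \<open>L\<close>.\<close>

definition weighted_L1 :: "L2 \<Rightarrow> real" where
  "weighted_L1 f = (\<integral>x. m x * cmod (laplace f x) \<partial>\<mu>)"

definition ell :: "L2 \<Rightarrow> complex" where
  "ell f = (\<integral>x. complex_of_real (m x) * laplace f x \<partial>\<mu>)"

definition theta :: "L2 \<Rightarrow> real" where
  "theta g = (\<integral>x. p x * (cmod (laplace g x))\<^sup>2 \<partial>\<mu>)"

lemma weighted_L1_integrable: "f \<in> D \<Longrightarrow> integrable \<mu> (\<lambda>x. m x * cmod (laplace f x))"
proof -
  assume "f \<in> D"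
  then have "integrable \<mu> (\<lambda>x. cmod (complex_of_real (m x)) * cmod (laplace f x))"
    by (intro sq_integrable_mult_norm weight_sq_integrable) (simp only: D_iff)
  moreover have "cmod (complex_of_real (m x)) * cmod (laplace f x) = m x * cmod (laplace f x)" if "x \<in> space \<mu>" for x
    using m_pos[of x] that by (simp add: space_mu)
  ultimately show ?thesis
    by (subst (asm) Bochner_Integration.integrable_cong[OF refl]) auto
qed

lemma weighted_L1_nonneg: "0 \<le> weighted_L1 f"
  unfolding weighted_L1_def using m_pos by (intro integral_nonneg_AE AE_I2) (auto simp: space_mu less_imp_le)

text \<open>The Cauchy-Schwarz inequality, through \<open>2 a b \<le> t a\<^sup>2 + b\<^sup>2 / t\<close> with \<open>t = \<parallel>k\<parallel>\<close>.\<close>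

lemma weighted_L1_res_le: "\<exists>C\<ge>0. \<forall>k. weighted_L1 (res k) \<le> C * norm k"
proof -
  define C where "C = ((\<integral>x. (m x)\<^sup>2 \<partial>\<mu>) + 1) / 2"
  have "0 \<le> C" unfolding C_def by simp
  moreover have "weighted_L1 (res k) \<le> C * norm k" for k
  proof (cases "k = 0")
    case True
    have "res k = 0" using R_scaleC[of 0 0] True by simp
    then have "weighted_L1 (res k) = (\<integral>x. 0 \<partial>\<mu>)"
      unfolding weighted_L1_def
      by (intro Bochner_Integration.integral_cong) (auto simp: laplace_zero space_mu)
    then show ?thesis using True by simp
  next
    case False
    define t where "t = norm k"
    have t: "t > 0" using False by (simp add: t_def)
    have u: "res k \<in> D" by (rule res_props)
    then have iL: "integrable \<mu> (\<lambda>x. (cmod (laplace (res k) x))\<^sup>2)"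
      by (simp add: D_iff sq_integrable_def)
    have "weighted_L1 (res k) \<le> (\<integral>x. t / 2 * (m x)\<^sup>2 + 1 / (2 * t) * (cmod (laplace (res k) x))\<^sup>2 \<partial>\<mu>)"
      unfolding weighted_L1_def
    proof (rule integral_mono[OF weighted_L1_integrable[OF u]])
      show "integrable \<mu> (\<lambda>x. t / 2 * (m x)\<^sup>2 + 1 / (2 * t) * (cmod (laplace (res k) x))\<^sup>2)"
        using m_square iL by simp
      have "a * b \<le> t / 2 * a\<^sup>2 + 1 / (2 * t) * b\<^sup>2" for a b :: real
      proof -
        have "0 \<le> (t * a - b)\<^sup>2" by simp
        then have "2 * t * (a * b) \<le> 2 * t * (t / 2 * a\<^sup>2 + 1 / (2 * t) * b\<^sup>2)"
          using t by (simp add: power2_diff algebra_simps power_mult_distrib power2_eq_square)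
        then show ?thesis using t by simp
      qed
      then show "m x * cmod (laplace (res k) x) \<le> t / 2 * (m x)\<^sup>2 + 1 / (2 * t) * (cmod (laplace (res k) x))\<^sup>2" for x .
    qed
    also have "\<dots> = t / 2 * (\<integral>x. (m x)\<^sup>2 \<partial>\<mu>) + 1 / (2 * t) * Re (Q (res k) (res k))"
      using m_square iL by (simp add: Q_self)
    also have "\<dots> \<le> t / 2 * (\<integral>x. (m x)\<^sup>2 \<partial>\<mu>) + 1 / (2 * t) * t\<^sup>2"
      using energy_res_le[of k] t by (intro add_left_mono mult_left_mono) (auto simp: t_def)
    also have "\<dots> = C * norm k"
      using t by (simp add: C_def t_def[symmetric] field_simps power2_eq_square)
    finally show ?thesis .
  qed
  ultimately show ?thesis by blast
qed

text \<open>The kernel \<open>p (x) / (x + y)\<close> of \<open>X G\<close> is dominated by \<open>m (x) m (y)\<close>, although \<open>X\<close> and \<open>G\<close> may both be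
  unbounded. This makes \<open>theta\<close> finite on vectors \<open>\<Gamma> R k\<close> of the form domain.\<close>

lemma laplace_hankel_bound:
  assumes x: "0 < x"
  shows "p x * cmod (laplace (k - res k) x) \<le> m x * weighted_L1 (res k)"
proof -
  let ?F = "laplace (res k)"
  have u: "res k \<in> D" by (rule res_props)
  have int: "integrable \<mu> (\<lambda>y. m x * (m y * cmod (?F y)))"
    using weighted_L1_integrable[OF u] by simp
  have pt: "p x * cmod (?F y * complex_of_real (1 / (x + y))) \<le> m x * (m y * cmod (?F y))" if "0 < y" for y
  proof -
    have "p x / (x + y) * cmod (?F y) \<le> m x * m y * cmod (?F y)"
      using weight_le[OF x that] by (intro mult_right_mono) auto
    moreover have "cmod (complex_of_real (1 / (x + y))) = 1 / (x + y)"
      using x that by (simp only: norm_of_real) simp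
    ultimately show ?thesis
      by (simp only: norm_mult) (simp add: mult_ac)
  qed
  have "p x * cmod (laplace (k - res k) x) \<le> p x * (\<integral>y. cmod (?F y * complex_of_real (1 / (x + y))) \<partial>\<mu>)"
    unfolding laplace_hankel[OF x] using p_pos[OF x] by (intro mult_left_mono integral_norm_bound) auto
  also have "\<dots> = (\<integral>y. p x * cmod (?F y * complex_of_real (1 / (x + y))) \<partial>\<mu>)"
    by simp
  also have "\<dots> \<le> (\<integral>y. m x * (m y * cmod (?F y)) \<partial>\<mu>)"
  proof (rule integral_mono')
    show "integrable \<mu> (\<lambda>y. m x * (m y * cmod (?F y)))" by (rule int)
    show "p x * cmod (?F y * complex_of_real (1 / (x + y))) \<le> m x * (m y * cmod (?F y))"
      "0 \<le> m x * (m y * cmod (?F y))" if "y \<in> space \<mu>" for y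
      using pt that x m_pos[of y] m_pos[of x] by (auto simp: space_mu)
  qed
  also have "\<dots> = m x * weighted_L1 (res k)"
    by (simp add: weighted_L1_def)
  finally show ?thesis .
qed

lemma hankel_cross_integrable:
  assumes "f \<in> D"
  shows "integrable \<mu> (\<lambda>x. p x * (cmod (laplace (k - res k) x) * cmod (laplace f x)))"
proof (rule Bochner_Integration.integrable_bound)
  show "integrable \<mu> (\<lambda>x. weighted_L1 (res k) * (m x * cmod (laplace f x)))"
    using weighted_L1_integrable[OF assms] by simp
  show "AE x in \<mu>. norm (p x * (cmod (laplace (k - res k) x) * cmod (laplace f x)))
      \<le> norm (weighted_L1 (res k) * (m x * cmod (laplace f x)))"
  proof (rule AE_I2)
    fix x assume "x \<in> space \<mu>"
    then have x: "0 < x" by (simp add: space_mu)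
    have "p x * cmod (laplace (k - res k) x) * cmod (laplace f x) \<le> m x * weighted_L1 (res k) * cmod (laplace f x)"
      by (intro mult_right_mono laplace_hankel_bound x) simp
    then show "norm (p x * (cmod (laplace (k - res k) x) * cmod (laplace f x)))
      \<le> norm (weighted_L1 (res k) * (m x * cmod (laplace f x)))"
      using p_pos[OF x] m_pos[OF x] weighted_L1_nonneg[of "res k"] by (simp add: abs_mult mult_ac)
  qed
qed measurable

lemma theta_integrable:
  assumes "k - res k \<in> D"
  shows "integrable \<mu> (\<lambda>x. p x * (cmod (laplace (k - res k) x))\<^sup>2)"
  using hankel_cross_integrable[OF assms] by (simp add: power2_eq_square)

lemma theta_le:
  assumes D: "k - res k \<in> D"
  shows "theta (k - res k) \<le> weighted_L1 (res k) * weighted_L1 (k - res k)"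
proof -
  have "theta (k - res k) \<le> (\<integral>x. weighted_L1 (res k) * (m x * cmod (laplace (k - res k) x)) \<partial>\<mu>)"
    unfolding theta_def
  proof (rule integral_mono[OF theta_integrable[OF D]])
    show "integrable \<mu> (\<lambda>x. weighted_L1 (res k) * (m x * cmod (laplace (k - res k) x)))"
      using weighted_L1_integrable[OF D] by simp
    fix x assume "x \<in> space \<mu>"
    then have x: "0 < x" by (simp add: space_mu)
    have "p x * cmod (laplace (k - res k) x) * cmod (laplace (k - res k) x)
        \<le> m x * weighted_L1 (res k) * cmod (laplace (k - res k) x)"
      by (intro mult_right_mono laplace_hankel_bound x) simp
    then show "p x * (cmod (laplace (k - res k) x))\<^sup>2 \<le> weighted_L1 (res k) * (m x * cmod (laplace (k - res k) x))"
      by (simp add: power2_eq_square mult_ac)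
  qed
  then show ?thesis by (simp add: weighted_L1_def)
qed

text \<open>The relation \<open>X G + G X = \<langle>\<cdot>, m\<rangle> m\<close> as a quadratic form: by Fubini's theorem the integral is the double
  integral \<open>I\<close> of \<open>p (x) / (x + y) F (y) cnj (F (x))\<close>, and \<open>I + cnj I\<close> has the kernel
  \<open>m (x) m (y)\<close>, which factorises.\<close>

lemma rank_one_relation:
  assumes f: "f = res k"
  shows "2 * Re (\<integral>x. complex_of_real (p x) * (laplace (k - f) x * cnj (laplace f x)) \<partial>\<mu>) = (cmod (ell f))\<^sup>2"
proof -
  define F where "F = laplace f"
  have D: "f \<in> D" unfolding f by (rule res_props)
  have [measurable]: "F \<in> borel_measurable \<mu>" unfolding F_def by measurable
  define G where "G x = m x * cmod (F x)" for x
  have G: "integrable \<mu> G" "\<And>x. 0 < x \<Longrightarrow> 0 \<le> G x"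
    using weighted_L1_integrable[OF D] m_pos by (auto simp: G_def[abs_def] F_def less_imp_le)
  have Gm [measurable]: "G \<in> borel_measurable \<mu>" using G by simp
  interpret P: pair_sigma_finite \<mu> \<mu> ..
  define T where "T x y = complex_of_real (p x / (x + y)) * (F y * cnj (F x))" for x y
  have [measurable]: "fst \<in> borel_measurable (\<mu> \<Otimes>\<^sub>M \<mu>)" "snd \<in> borel_measurable (\<mu> \<Otimes>\<^sub>M \<mu>)"
    using measurable_compose[OF measurable_fst id_measurable] measurable_compose[OF measurable_snd id_measurable]
    by auto
  have [measurable]: "(\<lambda>z. p (fst z)) \<in> borel_measurable (\<mu> \<Otimes>\<^sub>M \<mu>)" "(\<lambda>z. F (fst z)) \<in> borel_measurable (\<mu> \<Otimes>\<^sub>M \<mu>)"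
    "(\<lambda>z. F (snd z)) \<in> borel_measurable (\<mu> \<Otimes>\<^sub>M \<mu>)" "(\<lambda>z. G (fst z)) \<in> borel_measurable (\<mu> \<Otimes>\<^sub>M \<mu>)"
    "(\<lambda>z. G (snd z)) \<in> borel_measurable (\<mu> \<Otimes>\<^sub>M \<mu>)"
    by (rule measurable_compose[OF measurable_fst] measurable_compose[OF measurable_snd], simp)+
  have Tm: "(\<lambda>z. T (fst z) (snd z)) \<in> borel_measurable (\<mu> \<Otimes>\<^sub>M \<mu>)"
    unfolding T_def by measurable
  have GG: "integrable (\<mu> \<Otimes>\<^sub>M \<mu>) (\<lambda>z. G (fst z) * G (snd z))"
  proof (rule P.Fubini_integrable)
    show "integrable \<mu> (\<lambda>x. \<integral>y. norm (G (fst (x, y)) * G (snd (x, y))) \<partial>\<mu>)"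
      using G(1) by (simp add: abs_mult)
    show "AE x in \<mu>. integrable \<mu> (\<lambda>y. G (fst (x, y)) * G (snd (x, y)))"
      using G(1) by simp
  qed measurable
  have Tle: "cmod (T x y) \<le> G x * G y" if "0 < x" "0 < y" for x y
  proof -
    have "cmod (T x y) = p x / (x + y) * (cmod (F y) * cmod (F x))"
      using that p_pos[OF that(1)] unfolding T_def norm_mult norm_of_real complex_mod_cnj by simp
    also have "\<dots> \<le> m x * m y * (cmod (F y) * cmod (F x))"
      by (intro mult_right_mono weight_le that) simp
    finally show ?thesis by (simp add: G_def mult_ac)
  qed
  have Tint: "integrable (\<mu> \<Otimes>\<^sub>M \<mu>) (\<lambda>z. T (fst z) (snd z))"
  proof (rule Bochner_Integration.integrable_bound[OF GG Tm])
    show "AE z in \<mu> \<Otimes>\<^sub>M \<mu>. norm (T (fst z) (snd z)) \<le> norm (G (fst z) * G (snd z))"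
      using Tle order_trans[OF Tle abs_ge_self] by (intro AE_I2) (auto simp: space_pair_measure space_mu)
  qed
  have Tint1: "integrable \<mu> (\<lambda>x. \<integral>y. T x y \<partial>\<mu>)" and Tint1': "AE x in \<mu>. integrable \<mu> (T x)"
    using P.integrable_fst'[OF Tint] P.AE_integrable_fst'[OF Tint] by simp_all
  have Tint2: "integrable \<mu> (\<lambda>x. \<integral>y. T y x \<partial>\<mu>)" and Tint2': "AE x in \<mu>. integrable \<mu> (\<lambda>y. T y x)"
    using P.integrable_snd[of T] P.AE_integrable_snd[of T] Tint by (simp_all add: case_prod_beta')
  define I where "I = (\<integral>x. \<integral>y. T x y \<partial>\<mu> \<partial>\<mu>)"
  have swap: "I = (\<integral>x. \<integral>y. T y x \<partial>\<mu> \<partial>\<mu>)"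
    using P.Fubini_integral[of T] Tint by (simp add: I_def case_prod_beta')
  have "(\<integral>x. complex_of_real (p x) * (laplace (k - f) x * cnj (laplace f x)) \<partial>\<mu>) = I"
    unfolding I_def
  proof (rule Bochner_Integration.integral_cong)
    fix x assume "x \<in> space \<mu>"
    then have x: "0 < x" by (simp add: space_mu)
    have "(\<integral>y. T x y \<partial>\<mu>) = (\<integral>y. (complex_of_real (p x) * cnj (F x)) * (F y * complex_of_real (1 / (x + y))) \<partial>\<mu>)"
      by (intro Bochner_Integration.integral_cong) (simp_all add: T_def)
    also have "\<dots> = complex_of_real (p x) * cnj (F x) * laplace (k - f) x"
      unfolding f laplace_hankel[OF x] F_def by (rule integral_mult_right_zero)
    finally show "complex_of_real (p x) * (laplace (k - f) x * cnj (laplace f x)) = (\<integral>y. T x y \<partial>\<mu>)"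
      by (simp add: F_def)
  qed simp
  moreover have "I + cnj I = complex_of_real ((cmod (ell f))\<^sup>2)"
  proof -
    have "cnj I = (\<integral>x. \<integral>y. cnj (T y x) \<partial>\<mu> \<partial>\<mu>)"
      unfolding swap by (simp flip: Bochner_Integration.integral_cnj)
    moreover have "integrable \<mu> (\<lambda>x. \<integral>y. cnj (T y x) \<partial>\<mu>)"
      using Tint2 by (simp add: Bochner_Integration.integral_cnj)
    ultimately have "I + cnj I = (\<integral>x. (\<integral>y. T x y \<partial>\<mu>) + (\<integral>y. cnj (T y x) \<partial>\<mu>) \<partial>\<mu>)"
      using Tint1 by (simp add: I_def)
    also have "\<dots> = (\<integral>x. cnj (complex_of_real (m x) * F x) * ell f \<partial>\<mu>)"
    proof (rule integral_cong_AE)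
      show "AE x in \<mu>. (\<integral>y. T x y \<partial>\<mu>) + (\<integral>y. cnj (T y x) \<partial>\<mu>) = cnj (complex_of_real (m x) * F x) * ell f"
        using Tint1' Tint2' AE_space
      proof eventually_elim
        case (elim x)
        then have x: "0 < x" by (simp add: space_mu)
        have "(\<integral>y. T x y \<partial>\<mu>) + (\<integral>y. cnj (T y x) \<partial>\<mu>) = (\<integral>y. T x y + cnj (T y x) \<partial>\<mu>)"
          using elim by simp
        also have "\<dots> = (\<integral>y. cnj (complex_of_real (m x) * F x) * (complex_of_real (m y) * F y) \<partial>\<mu>)"
        proof (rule Bochner_Integration.integral_cong)
          fix y assume "y \<in> space \<mu>"
          then have y: "0 < y" by (simp add: space_mu)
          have "T x y + cnj (T y x) = complex_of_real ((p x + p y) / (x + y)) * (F y * cnj (F x))"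
            by (simp add: T_def add.commute add_divide_distrib distrib_right distrib_left mult_ac)
          then show "T x y + cnj (T y x) = cnj (complex_of_real (m x) * F x) * (complex_of_real (m y) * F y)"
            unfolding weight_eq[OF x y] by (simp add: mult_ac)
        qed simp
        finally show ?case by (simp add: ell_def F_def)
      qed
      show "(\<lambda>x. (\<integral>y. T x y \<partial>\<mu>) + (\<integral>y. cnj (T y x) \<partial>\<mu>)) \<in> borel_measurable \<mu>"
        using borel_measurable_integrable[OF Tint1] borel_measurable_integrable[OF Tint2]
        by (simp add: Bochner_Integration.integral_cnj)
    qed measurable
    also have "\<dots> = cnj (ell f) * ell f"
      by (simp add: ell_def F_def flip: Bochner_Integration.integral_cnj)
    finally show ?thesis
      using complex_norm_square[of "ell f"] by (simp add: mult.commute)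
  qed
  moreover have "2 * Re I = Re (I + cnj I)"
    by simp
  ultimately show ?thesis
    by (simp only: Re_complex_of_real)
qed

text \<open>The cyclic vector is \<open>(\<Gamma> + 1)\<^sup>-\<^sup>1 L\<^sup>* m\<close>, defined weakly. For \<open>m = 1\<close> it is formally
  \<open>(\<Gamma> + 1)\<^sup>-\<^sup>1\<close> applied to the kernel function of \<open>\<Gamma>\<close>.\<close>

definition w :: L2 where
  "w = (SOME w. w \<in> D \<and> (\<forall>g\<in>D. Q w g + cinner w g = cnj (ell g)))"

lemma w_props: "w \<in> D" "g \<in> D \<Longrightarrow> Q w g + cinner w g = cnj (ell g)"
proof -
  obtain u where u: "u \<in> D"
    "\<And>g. g \<in> D \<Longrightarrow> (\<integral>x. (laplace u x - complex_of_real (m x)) * cnj (laplace g x) \<partial>\<mu>) + cinner (u - 0) g = 0"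
    using exists_graph_projection[OF weight_sq_integrable, of 0] by blast
  have "Q u g + cinner u g = cnj (ell g)" if g: "g \<in> D" for g
  proof -
    have int: "integrable \<mu> (\<lambda>x. complex_of_real (m x) * cnj (laplace g x))"
      using g by (intro sq_integrable_mult_cnj weight_sq_integrable) (simp only: D_iff)
    have "(\<integral>x. (laplace u x - complex_of_real (m x)) * cnj (laplace g x) \<partial>\<mu>)
        = (\<integral>x. laplace u x * cnj (laplace g x) - complex_of_real (m x) * cnj (laplace g x) \<partial>\<mu>)"
      by (simp add: left_diff_distrib)
    also have "\<dots> = Q u g - (\<integral>x. complex_of_real (m x) * cnj (laplace g x) \<partial>\<mu>)"
      using Q_integrable[OF u(1) g] int by (simp add: hankel_form_def)
    also have "(\<integral>x. complex_of_real (m x) * cnj (laplace g x) \<partial>\<mu>) = cnj (ell g)"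
      by (simp add: ell_def flip: Bochner_Integration.integral_cnj)
    finally have e: "(\<integral>x. (laplace u x - complex_of_real (m x)) * cnj (laplace g x) \<partial>\<mu>) = Q u g - cnj (ell g)" .
    show ?thesis using u(2)[OF g] unfolding e by (simp add: algebra_simps)
  qed
  with u(1) have "\<exists>w. w \<in> D \<and> (\<forall>g\<in>D. Q w g + cinner w g = cnj (ell g))" by blast
  from someI_ex[OF this] show "w \<in> D" "g \<in> D \<Longrightarrow> Q w g + cinner w g = cnj (ell g)"
    unfolding w_def by blast+
qed

lemma ell_res: "ell (res k) = cinner k w"
proof -
  have "Q (res k) w = cinner (k - res k) w"
    by (intro res_props w_props)
  moreover have "Q w (res k) + cinner w (res k) = cnj (ell (res k))"
    by (intro res_props w_props)
  then have "cnj (Q w (res k)) + cnj (cinner w (res k)) = ell (res k)"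
    by (metis complex_cnj_add complex_cnj_cnj)
  then have "Q (res k) w + cinner (res k) w = ell (res k)"
    by (simp only: Q_commute[symmetric] cinner_commute[symmetric])
  ultimately show ?thesis by (simp add: cinner_diff_left)
qed

lemma w_H0: "w \<in> H0"
  unfolding H0_iff
proof (intro allI impI)
  fix g assume g: "res g = g"
  have D: "g \<in> D" using res_props(1)[of g] g by simp
  have Q0: "Q g u = 0" if "u \<in> D" for u
    using res_props(2)[OF that, of g] g by simp
  have "(\<integral>x. (cmod (laplace g x))\<^sup>2 \<partial>\<mu>) = 0"
    using Q0[OF D] unfolding Q_self by simp
  then have "AE x in \<mu>. (cmod (laplace g x))\<^sup>2 = 0"
    using D by (subst (asm) integral_nonneg_eq_0_iff_AE) (auto simp: D_iff sq_integrable_def)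
  then have "AE x in \<mu>. complex_of_real (m x) * laplace g x = 0"
    by eventually_elim simp
  then have "ell g = 0"
    unfolding ell_def by (intro integral_eq_zero_AE)
  moreover have "Q w g = 0"
    using Q0[OF w_props(1)] Q_commute[of w g] by simp
  ultimately show "cinner w g = 0"
    using w_props(2)[OF D] by simp
qed

section \<open>Simplicity of the spectrum\<close>

text \<open>The Cayley transform of \<open>\<Gamma>\<close>.\<close>

definition V :: "L2 \<Rightarrow> L2" where "V k = k - 2 *\<^sub>R res k"

lemma V_norm_le: "norm (V k) \<le> norm k"
proof -
  have "(norm (V k))\<^sup>2 = (norm k)\<^sup>2 - 4 * (inner (res k) k - (norm (res k))\<^sup>2)"
    unfolding V_def power2_norm_eq_inner
    by (simp add: inner_diff_left inner_diff_right) (simp add: inner_commute)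
  then have "(norm (V k))\<^sup>2 \<le> (norm k)\<^sup>2" using R_le[of k] by simp
  then show ?thesis by (rule power2_le_imp_le) simp
qed

lemma V_sym: "inner (V x) y = inner x (V y)"
  by (simp add: V_def inner_diff_left inner_diff_right R_inner_sym)

lemma bounded_linear_V: "bounded_linear V"
  unfolding V_def
  by (intro bounded_linear_sub bounded_linear_ident bounded_linear_compose[OF bounded_linear_scaleR_right] bounded_linear_R)

text \<open>A fixed vector of \<open>V\<^sup>2 = 1 - 4 R (1 - R)\<close> lies in the kernel of \<open>\<Gamma>\<close>, because \<open>R\<close> is
  injective.\<close>

lemma V_powers_tendsto_0:
  assumes k: "k \<in> H0"
  shows "(\<lambda>n. (V ^^ (2 * n)) k) \<longlonglongrightarrow> 0"
proof -
  obtain q where q: "(\<lambda>n. (V ^^ (2 * n)) k) \<longlonglongrightarrow> q" "V (V q) = q"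
    using symmetric_contraction_even_powers_tendsto[OF bounded_linear_V V_sym V_norm_le] by blast
  have V: "V x \<in> H0" if "x \<in> H0" for x
    unfolding V_def by (intro csubspaceD[OF csubspace_H0] that res_H0)
  have "(V ^^ n) k \<in> H0" for n
    by (induct n) (simp_all add: k V)
  then have "q \<in> H0"
    using closed_sequentially[OF closed_H0 _ q(1)] by blast
  have "V (V q) = q - 2 *\<^sub>R (2 *\<^sub>R res (q - res q))"
    by (simp only: V_def scaleR_2) (simp add: R_diff R_add algebra_simps)
  then have "res (q - res q) = 0" using q(2) by simp
  then have "q - res q = 0" by (rule R_inj)
  then have "q = 0" using H0_kernel[OF \<open>q \<in> H0\<close>] by simp
  then show ?thesis using q(1) by simp
qed

text \<open>Put \<open>f = R\<^sup>2 (1 - R) k\<close> and \<open>u = \<Gamma> f = R (1 - R)\<^sup>2 k\<close>. Then \<open>u + f = R (1 - R) k\<close> and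
  \<open>u - f = R (1 - R) V k\<close>. The difference of the two values of \<open>theta\<close> is
  \<open>4 Re \<langle>X L \<Gamma> f, L f\<rangle> = 2 |ell f|\<^sup>2\<close>, and \<open>ell f = \<langle>R (1 - R) k, w\<rangle> = 0\<close>.\<close>

lemma theta_V:
  assumes k: "cinner (res (k - res k)) w = 0"
  shows "theta (res (V k - res (V k))) = theta (res (k - res k))"
proof -
  define l where "l = res (k - res k)"
  define f where "f = res l"
  define u where "u = l - f"
  have sum: "res (k - res k) = u + f" by (simp add: u_def l_def)
  have diff: "res (V k - res (V k)) = u - f"
    by (simp only: u_def f_def l_def V_def scaleR_2) (simp add: R_diff R_add algebra_simps)
  have fD: "f \<in> D" unfolding f_def by (rule res_props)
  have lD: "l \<in> D" unfolding l_def by (rule res_props)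
  have uD: "u \<in> D" unfolding u_def by (intro D_simps fD lD)
  have iu: "integrable \<mu> (\<lambda>x. p x * (cmod (laplace u x))\<^sup>2)"
    using theta_integrable[of l] uD by (simp add: u_def f_def)
  have "f = res (res k) - res (res (res k))"
    by (simp add: f_def l_def R_diff)
  then have iff: "integrable \<mu> (\<lambda>x. p x * (cmod (laplace f x))\<^sup>2)"
    using theta_integrable[of "res (res k)"] fD by simp
  have cross: "integrable \<mu> (\<lambda>x. complex_of_real (p x) * (laplace u x * cnj (laplace f x)))"
  proof (rule Bochner_Integration.integrable_bound)
    show "integrable \<mu> (\<lambda>x. p x * (cmod (laplace u x) * cmod (laplace f x)))"
      using hankel_cross_integrable[OF fD, of l] by (simp add: u_def f_def)
    show "AE x in \<mu>. norm (complex_of_real (p x) * (laplace u x * cnj (laplace f x)))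
        \<le> norm (p x * (cmod (laplace u x) * cmod (laplace f x)))"
      by (intro AE_I2) (simp add: norm_mult)
  qed measurable
  have rel: "Re (\<integral>x. complex_of_real (p x) * (laplace u x * cnj (laplace f x)) \<partial>\<mu>) = 0"
    using rank_one_relation[OF f_def] k by (simp add: u_def f_def ell_res l_def)
  have "theta (u + s *\<^sub>R f) = theta u + theta f" if s: "s = 1 \<or> s = -1" for s
  proof -
    have "theta (u + s *\<^sub>R f) = (\<integral>x. (p x * (cmod (laplace u x))\<^sup>2 + p x * (cmod (laplace f x))\<^sup>2)
        + 2 * s * Re (complex_of_real (p x) * (laplace u x * cnj (laplace f x))) \<partial>\<mu>)"
      unfolding theta_def
    proof (rule Bochner_Integration.integral_cong)
      fix x assume "x \<in> space \<mu>"
      then have "laplace (u + s *\<^sub>R f) x = laplace u x + complex_of_real s * laplace f x"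
        by (simp add: space_mu laplace_add laplace_scaleR)
      moreover have "(cmod (a + complex_of_real s * b))\<^sup>2 = (cmod a)\<^sup>2 + (cmod b)\<^sup>2 + 2 * s * Re (a * cnj b)" for a b
        using s unfolding cmod_power2 by (auto simp: power2_eq_square algebra_simps)
      moreover have Re_p: "Re (complex_of_real (p x) * z) = p x * Re z" for z
        by simp
      ultimately show "p x * (cmod (laplace (u + s *\<^sub>R f) x))\<^sup>2
          = (p x * (cmod (laplace u x))\<^sup>2 + p x * (cmod (laplace f x))\<^sup>2)
            + 2 * s * Re (complex_of_real (p x) * (laplace u x * cnj (laplace f x)))"
        using Re_p by (simp only: distrib_left mult.assoc mult.left_commute[of _ "p x"])
    qed simp
    also have "\<dots> = theta u + theta f
        + 2 * s * Re (\<integral>x. complex_of_real (p x) * (laplace u x * cnj (laplace f x)) \<partial>\<mu>)"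
      using iu iff cross unfolding theta_def
      by (simp only: Bochner_Integration.integral_add Bochner_Integration.integrable_add integral_mult_right_zero
          integrable_Re integral_Re integrable_mult_right)
    finally show ?thesis using rel by simp
  qed
  from this[of 1] this[of "-1"] show ?thesis
    by (simp add: sum diff)
qed

text \<open>The invariant form \<open>N\<close> is bounded, and the powers of \<open>V\<close> tend to \<open>0\<close>. So \<open>N k = 0\<close>; since
  \<open>p > 0\<close>, this forces \<open>L\<close> to vanish on \<open>R (1 - R) k\<close>, which is then in the kernel of \<open>\<Gamma>\<close> and
  orthogonal to it.\<close>

lemma cyclic_complement_trivial:
  assumes k: "k \<in> H0" and ortho: "\<And>n. cinner k ((res ^^ n) w) = 0"
  shows "k = 0"
proof -
  define K where "K = {k \<in> H0. \<forall>n. cinner k ((res ^^ n) w) = 0}"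
  have sub: "csubspace K"
    using csubspaceD[OF csubspace_H0]
    by (auto simp: csubspace_def K_def cinner_simps)
  have resK: "res x \<in> K" if "x \<in> K" for x
  proof -
    have "cinner (res x) ((res ^^ n) w) = cinner x ((res ^^ Suc n) w)" for n
      by (simp add: R_sym)
    then show ?thesis using that res_H0 by (simp add: K_def del: funpow.simps)
  qed
  have VK: "V x \<in> K" if "x \<in> K" for x
    unfolding V_def by (intro csubspaceD[OF sub] resK that)
  have w0: "cinner x w = 0" if "x \<in> K" for x
    using that funpow_0[of res w] unfolding K_def by (metis (mono_tags, lifting) mem_Collect_eq)
  define N where "N k = theta (res (k - res k))" for k
  have NV: "N (V x) = N x" if "x \<in> K" for x
    unfolding N_def by (intro theta_V w0 resK csubspaceD[OF sub] that)
  have kK: "k \<in> K" using k ortho by (simp add: K_def)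
  have "(V ^^ n) k \<in> K \<and> N ((V ^^ n) k) = N k" for n
    by (induct n) (simp_all add: kK VK NV)
  then have const: "N ((V ^^ (2 * n)) k) = N k" for n by blast
  obtain C where C: "0 \<le> C" "\<And>k. weighted_L1 (res k) \<le> C * norm k"
    using weighted_L1_res_le by blast
  \<comment> \<open>The same vector, now as \<open>\<Gamma>\<close> applied to \<open>R\<^sup>2 x\<close>.\<close>
  have Nform: "res (x - res x) = res x - res (res x)" for x by (simp add: R_diff)
  have ND: "res x - res (res x) \<in> D" for x by (intro D_simps res_props)
  have N0: "0 \<le> N x" for x
    unfolding N_def theta_def using p_pos
    by (intro integral_nonneg_AE AE_I2) (auto simp: space_mu less_imp_le)
  have Nle: "N x \<le> 2 * C\<^sup>2 * (norm x)\<^sup>2" for x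
  proof -
    have 1: "weighted_L1 (res (res x)) \<le> C * norm x"
      using C(2)[of "res x"] mult_left_mono[OF R_norm_le[of x] C(1)] by linarith
    have "norm (x - res x) \<le> 2 * norm x"
      using norm_triangle_ineq4[of x "res x"] R_norm_le[of x] by linarith
    then have 2: "weighted_L1 (res x - res (res x)) \<le> C * (2 * norm x)"
      using C(2)[of "x - res x"] mult_left_mono[of "norm (x - res x)" "2 * norm x" C] C(1)
      unfolding Nform by linarith
    have "N x \<le> weighted_L1 (res (res x)) * weighted_L1 (res x - res (res x))"
      unfolding N_def Nform by (rule theta_le[OF ND])
    also have "\<dots> \<le> (C * norm x) * (C * (2 * norm x))"
      using 1 2 C(1) weighted_L1_nonneg by (intro mult_mono) auto
    finally show ?thesis by (simp add: power2_eq_square mult_ac)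
  qed
  have "(\<lambda>n. 2 * C\<^sup>2 * (norm ((V ^^ (2 * n)) k))\<^sup>2) \<longlonglongrightarrow> 2 * C\<^sup>2 * (norm (0::L2))\<^sup>2"
    by (intro tendsto_intros V_powers_tendsto_0 k)
  then have "(\<lambda>n. 2 * C\<^sup>2 * (norm ((V ^^ (2 * n)) k))\<^sup>2) \<longlonglongrightarrow> 0" by simp
  then have "N k \<le> 0"
    using Nle[of "(V ^^ (2 * n)) k" for n] unfolding const by (intro LIMSEQ_le_const) auto
  then have Nk: "theta (res k - res (res k)) = 0"
    using N0[of k] by (simp add: N_def Nform)
  define g where "g = res k - res (res k)"
  have "AE x in \<mu>. p x * (cmod (laplace g x))\<^sup>2 = 0"
    using Nk theta_integrable[OF ND, of k] p_pos unfolding theta_def g_def[symmetric]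
    by (subst (asm) integral_nonneg_eq_0_iff_AE) (auto simp: space_mu less_imp_le intro!: AE_I2)
  then have "AE x in \<mu>. laplace g x = 0"
    using AE_space
  proof eventually_elim
    case (elim x)
    then show ?case using p_pos[of x] by (simp add: space_mu)
  qed
  then have ker: "res g = g"
    using laplace_zero_imp_kernel op_ker_iff by blast
  have "g \<in> H0"
    unfolding g_def by (intro csubspaceD[OF csubspace_H0] res_H0 k)
  then have "g = 0" using H0_kernel ker by blast
  then have "res (k - res k) = 0" by (simp add: g_def R_diff)
  then have "k - res k = 0" by (rule R_inj)
  then show ?thesis using H0_kernel[OF k] by simp
qed

theorem hankel_perp_simple: "simple_spectrum H0 (hankel_perp \<mu>)"
  unfolding simple_spectrum_def cyclic_vector_def hankel_perp_def
proof (intro exI conjI)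
  let ?\<Phi> = "\<lambda>g. calc (lift g)"
  show "w \<in> H0" by (rule w_H0)
  show fc: "functional_calculus H0 (op_restrict (hankel_op \<mu>) H0) ?\<Phi>"
    by (intro functional_calculus_lift csubspace_H0 closed_H0 res_H0 hankel_op_iff)
  define S where "S = {?\<Phi> \<phi> w |\<phi>. \<phi> \<in> bdd_cont}"
  have sub: "csubspace S"
    unfolding csubspace_def
  proof (intro conjI ballI allI)
    have bc: "(\<lambda>x. \<phi> x + \<psi> x) \<in> bdd_cont" "(\<lambda>x. c * \<phi> x) \<in> bdd_cont"
      if "\<phi> \<in> bdd_cont" "\<psi> \<in> bdd_cont" for \<phi> \<psi> c
      using that bdd_cont_add bdd_cont_scale by blast+
    have add: "?\<Phi> (\<lambda>x. \<phi> x + \<psi> x) w = ?\<Phi> \<phi> w + ?\<Phi> \<psi> w" and scale: "?\<Phi> (\<lambda>x. c * \<phi> x) w = c *\<^sub>C ?\<Phi> \<phi> w"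
      if "\<phi> \<in> bdd_cont" "\<psi> \<in> bdd_cont" for \<phi> \<psi> c
      using fc w_H0 that unfolding functional_calculus_def by blast+
    show "x + y \<in> S" if "x \<in> S" "y \<in> S" for x y
      using that add bc(1) unfolding S_def mem_Collect_eq by metis
    show sc: "c *\<^sub>C x \<in> S" if "x \<in> S" for c x
      using that scale bc(2) unfolding S_def mem_Collect_eq by metis
    have "w \<in> S"
      unfolding S_def mem_Collect_eq
      using calc_lift_resolvent_power[of 0 w] resolvent_power_bdd_cont[of 0] by (metis funpow_0)
    from sc[OF this, of 0] show "0 \<in> S" by simp
  qed
  have SH: "S \<subseteq> H0"
    using calc_in_invariant_subspace[OF csubspace_H0 closed_H0 res_H0 w_H0 lift_unit_bounded]
    by (auto simp: S_def)
  have pow: "(res ^^ n) w \<in> S" for n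
    unfolding S_def mem_Collect_eq
    using calc_lift_resolvent_power[of n w] resolvent_power_bdd_cont[of n] by metis
  show "H0 \<subseteq> closure {?\<Phi> \<phi> w |\<phi>. \<phi> \<in> bdd_cont}"
    unfolding S_def[symmetric]
  proof (rule subsetI, rule ccontr)
    fix k assume k: "k \<in> H0" "k \<notin> closure S"
    obtain s where s: "s \<in> closure S" "k - s \<noteq> 0" "\<And>g. g \<in> S \<Longrightarrow> cinner (k - s) g = 0"
      using exists_orthogonal_vector[OF sub k(2)] by blast
    have "s \<in> H0" using s(1) closure_minimal[OF SH closed_H0] by blast
    then have "k - s \<in> H0" by (intro csubspaceD[OF csubspace_H0] k)
    then have "k - s = 0" by (rule cyclic_complement_trivial) (intro s pow)
    then show False using s(2) by blast
  qed
qed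

end

theorem theorem1p6:
  fixes \<mu> :: "real measure"
  assumes "\<mu> \<in> M_class"
    and "\<mu> \<in> M_finite \<or> \<mu> \<in> M_cofinite"
  shows "simple_spectrum (hankel_perp_space \<mu>) (hankel_perp \<mu>)"
  using assms(2)
proof
  interpret hankel_measure \<mu> by unfold_locales (rule assms(1))
  assume "\<mu> \<in> M_finite"
  then interpret F: finite_measure \<mu> by (simp add: M_finite_def)
  interpret hankel_weight \<mu> "\<lambda>x. 1" "\<lambda>x. x"
  proof
    show "\<exists>c. \<forall>y>0. 1 / (x + y) \<le> c * 1" if "0 < x" for x :: real
      using that by (intro exI[of _ "1 / x"]) (auto intro!: divide_left_mono)
  qed (use id_measurable in auto)
  show ?thesis by (rule hankel_perp_simple)
next
  interpret hankel_measure \<mu> by unfold_locales (rule assms(1))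
  assume "\<mu> \<in> M_cofinite"
  then have fin: "(\<integral>\<^sup>+x. ennreal (1 / x\<^sup>2) \<partial>\<mu>) < \<infinity>" by (simp add: M_cofinite_def)
  note id_measurable [measurable]
  have [measurable]: "(\<lambda>x. 1 / x) \<in> borel_measurable \<mu>" "(\<lambda>x. 1 / x\<^sup>2) \<in> borel_measurable \<mu>"
    by measurable
  interpret hankel_weight \<mu> "\<lambda>x. 1 / x" "\<lambda>x. 1 / x"
  proof
    show "integrable \<mu> (\<lambda>x. (1 / x)\<^sup>2)"
      using fin by (intro integrableI_nonneg) (auto simp: power_divide)
    show "\<exists>c. \<forall>y>0. 1 / (x + y) \<le> c * (1 / y)" if "0 < x" for x :: real
      using that by (intro exI[of _ 1]) (auto intro!: divide_left_mono)
    show "(1 / x + 1 / y) / (x + y) = 1 / x * (1 / y)" if "0 < x" "0 < y" for x y :: real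
    proof -
      have "1 / x + 1 / y = (1 / x * (1 / y)) * (x + y)"
        using that by (simp add: field_simps)
      then show ?thesis
        using that by (simp only: nonzero_mult_div_cancel_right)
    qed
  qed auto
  show ?thesis by (rule hankel_perp_simple)
qed

end
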